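(* Let $\Lambda$ be a tree-shaped network as described in the context, with exterior end-points $\Pi_2=\{Q_1,\dots,Q_{N_2}\}$. Let $r>0$, let $p,q\in L^\infty(\Lambda)$, and fix initial data $u^0,u^1$ on $\Lambda$ and boundary data $h$ (the same for both potentials), with $|u^0(x)|\ge r>0$ for a.e. $x\in\Lambda$. Let $u[p]$ and $u[q]$ denote the solutions of the wave network system $$\partial_t^2u_j-\partial_x^2u_j+p_j(x)u_j=0 \text{ in } e_j\times(0,T),\ j=0,\dots,N;\quad u(Q,t)=h(t),\ Q\in\Pi_2,\ t\in(0,T);\quad u(\cdot,0)=u^0,\ \partial_tu(\cdot,0)=u^1 \text{ in }\Lambda,$$ together with the continuity condition and Kirchhoff law at every interior node (and similarly with $q$ in place of $p$), and assume $u[p],u[q]\in H^3(0,T;L^\infty(\Lambda))\cap H^1(0,T;H^2(\Lambda))$. Then there exists $T_0>0$ such that for all $T\ge T_0$: if $$\partial_xu[p](Q,t)=\partial_xu[q](Q,t)\quad\text{for all } t\in(0,T) \text{ and all } Q\in\Pi_2\setminus\{Q_{N_2}\},$$ then $p=q$ in $\Lambda$.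
   Context: $\Lambda$ is a planar tree-shaped network (a connected graph with no closed loop) made of $N+1$ open segments $e_0,\dots,e_N$ of lengths $\ell_j$, joined at interior nodes (set $\Pi_1$, $N_1$ nodes, at each of which at least three segments meet) and having $N_2$ exterior end-points (set $\Pi_2$, points where only one segment ends), with $N+1=N_1+N_2$. Each segment is oriented, with an initial node $I(e_j)$ and a terminal node $T(e_j)$, and $\partial_x$ on $e_j$ is taken with respect to this orientation. For a function $f$ on $\Lambda$, $f_j=f|_{e_j}$. At an interior node $P$ where the $n_P$ segments $e_1,\dots,e_{n_P}$ meet, the continuity condition is $u_j(P,t)=u_i(P,t)$ for all $i,j\in\{1,\dots,n_P\}$, $0<t<T$, and the Kirchhoff law is $\sum_{j=1}^{n_P}\partial_xu_j(P,t)=0$, $0<t<T$. $L^\gamma(\Lambda)=\{f: f_j\in L^\gamma(e_j)\ \forall j\}$, and $H^k(\Lambda)$ similarly means $f_j\in H^k(e_j)$ for all $j$. $\partial_x u[p](Q,t)$ at an exterior end-point $Q$ means the $x$-derivative of the restriction of $u[p]$ to the unique segment ending at $Q$.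
   Formalization: The stated count N+1=N_1+N_2 is impossible for a tree with N+1 segments, which always has N+2 nodes; the formal statement uses N+2=N_1+N_2 instead and covers all such tree-shaped networks. *)

theory Defs
  imports "HOL-Analysis.Analysis"
begin

section \<open>Tree-shaped networks\<close>

text \<open>Segments are indexed by j = 0..N; segment j is identified with the interval
  [0, l j], oriented from its initial node im j (x = 0) to its terminal node tm j (x = l j).
  Nodes have an arbitrary type 'v.\<close>

definition incident :: "(nat \<Rightarrow> 'v) \<Rightarrow> (nat \<Rightarrow> 'v) \<Rightarrow> nat \<Rightarrow> 'v \<Rightarrow> bool" where
  "incident im tm j P \<longleftrightarrow> im j = P \<or> tm j = P"

definition net_nodes :: "nat \<Rightarrow> (nat \<Rightarrow> 'v) \<Rightarrow> (nat \<Rightarrow> 'v) \<Rightarrow> 'v set" where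
  "net_nodes N im tm = im ` {..N} \<union> tm ` {..N}"

definition net_adj :: "nat \<Rightarrow> (nat \<Rightarrow> 'v) \<Rightarrow> (nat \<Rightarrow> 'v) \<Rightarrow> ('v \<times> 'v) set" where
  "net_adj N im tm = {(im j, tm j) | j. j \<le> N} \<union> {(tm j, im j) | j. j \<le> N}"

definition degree :: "nat \<Rightarrow> (nat \<Rightarrow> 'v) \<Rightarrow> (nat \<Rightarrow> 'v) \<Rightarrow> 'v \<Rightarrow> nat" where
  "degree N im tm P = card {j. j \<le> N \<and> incident im tm j P}"

text \<open>Interior nodes (at least three segments meet) and exterior end-points (exactly one).\<close>
definition interior_nodes :: "nat \<Rightarrow> (nat \<Rightarrow> 'v) \<Rightarrow> (nat \<Rightarrow> 'v) \<Rightarrow> 'v set" where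
  "interior_nodes N im tm = {P \<in> net_nodes N im tm. degree N im tm P \<ge> 3}"

definition exterior_nodes :: "nat \<Rightarrow> (nat \<Rightarrow> 'v) \<Rightarrow> (nat \<Rightarrow> 'v) \<Rightarrow> 'v set" where
  "exterior_nodes N im tm = {P \<in> net_nodes N im tm. degree N im tm P = 1}"

text \<open>A tree-shaped network: positive lengths, no loops, connected, #nodes = #segments + 1
  (so no closed loop), every node is interior or exterior.\<close>
definition tree_network :: "nat \<Rightarrow> (nat \<Rightarrow> real) \<Rightarrow> (nat \<Rightarrow> 'v) \<Rightarrow> (nat \<Rightarrow> 'v) \<Rightarrow> bool" where
  "tree_network N l im tm \<longleftrightarrow>
     (\<forall>j\<le>N. 0 < l j \<and> im j \<noteq> tm j) \<and>
     (\<forall>P\<in>net_nodes N im tm. \<forall>Q\<in>net_nodes N im tm. (P, Q) \<in> (net_adj N im tm)\<^sup>*) \<and>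
     card (net_nodes N im tm) = N + 2 \<and>
     (\<forall>P\<in>net_nodes N im tm. degree N im tm P = 1 \<or> degree N im tm P \<ge> 3)"

section \<open>Function spaces on a segment / on the space-time rectangle\<close>

text \<open>Points of space-time are pairs (x, t).\<close>
definition rect :: "real \<Rightarrow> real \<Rightarrow> (real \<times> real) set" where
  "rect l T = {0<..<l} \<times> {0<..<T}"

text \<open>f \<in> L^\<infinity>(0,l).\<close>
definition Linf_on :: "real \<Rightarrow> (real \<Rightarrow> real) \<Rightarrow> bool" where
  "Linf_on l f \<longleftrightarrow> set_borel_measurable lborel {0<..<l} f \<and>
     (\<exists>C. AE x in lborel. x \<in> {0<..<l} \<longrightarrow> \<bar>f x\<bar> \<le> C)"

definition L2_on :: "(real \<times> real) set \<Rightarrow> (real \<times> real \<Rightarrow> real) \<Rightarrow> bool" where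
  "L2_on A g \<longleftrightarrow> set_borel_measurable lborel A g \<and> set_integrable lborel A (\<lambda>z. (g z)\<^sup>2)"

text \<open>D a b is the partial derivative d_t^a d_x^b of the function D 0 0 (all of them
  existing and continuous, i.e. D 0 0 is C^\<infinity> on R^2).\<close>
definition smooth_family :: "(nat \<Rightarrow> nat \<Rightarrow> real \<times> real \<Rightarrow> real) \<Rightarrow> bool" where
  "smooth_family D \<longleftrightarrow> (\<forall>a b. continuous_on UNIV (D a b) \<and>
     (\<forall>x t. ((\<lambda>y. D a b (y, t)) has_real_derivative D a (Suc b) (x, t)) (at x) \<and>
            ((\<lambda>s. D a b (x, s)) has_real_derivative D (Suc a) b (x, t)) (at t)))"

text \<open>Test functions C_c^\<infinity>(rect l T) (together with their derivatives).\<close>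
definition test_fun :: "real \<Rightarrow> real \<Rightarrow> (nat \<Rightarrow> nat \<Rightarrow> real \<times> real \<Rightarrow> real) \<Rightarrow> bool" where
  "test_fun l T D \<longleftrightarrow> smooth_family D \<and> compact (closure {z. D 0 0 z \<noteq> 0}) \<and>
     closure {z. D 0 0 z \<noteq> 0} \<subseteq> rect l T"

text \<open>g is the weak (distributional) derivative d_t^a d_x^b of w on rect l T.\<close>
definition weak_pderiv :: "real \<Rightarrow> real \<Rightarrow> nat \<Rightarrow> nat \<Rightarrow> (real \<times> real \<Rightarrow> real) \<Rightarrow> (real \<times> real \<Rightarrow> real) \<Rightarrow> bool" where
  "weak_pderiv l T a b w g \<longleftrightarrow>
     (\<forall>K. compact K \<and> K \<subseteq> rect l T \<longrightarrow> set_integrable lborel K w \<and> set_integrable lborel K g) \<and>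
     (\<forall>D. test_fun l T D \<longrightarrow>
        (LINT z:rect l T|lborel. w z * D a b z) = (-1) ^ (a + b) * (LINT z:rect l T|lborel. g z * D 0 0 z))"

section \<open>Functions on the network\<close>

text \<open>A function on the network (time dependent) is u :: nat => real => real => real,
  u j x t being the value on segment j at abscissa x and time t.\<close>

definition dx :: "(nat \<Rightarrow> real \<Rightarrow> real \<Rightarrow> real) \<Rightarrow> (nat \<Rightarrow> real) \<Rightarrow> nat \<Rightarrow> real \<Rightarrow> real \<Rightarrow> real" where
  "dx u l j x t = vector_derivative (\<lambda>y. u j y t) (at x within {0..l j})"

text \<open>Value and (orientation) x-derivative of u_j at an end node P of segment j.\<close>
definition nodeval :: "(nat \<Rightarrow> real \<Rightarrow> real \<Rightarrow> real) \<Rightarrow> (nat \<Rightarrow> real) \<Rightarrow> (nat \<Rightarrow> 'v) \<Rightarrow> nat \<Rightarrow> 'v \<Rightarrow> real \<Rightarrow> real" where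
  "nodeval u l im j P t = (if im j = P then u j 0 t else u j (l j) t)"

definition nodeder :: "(nat \<Rightarrow> real \<Rightarrow> real \<Rightarrow> real) \<Rightarrow> (nat \<Rightarrow> real) \<Rightarrow> (nat \<Rightarrow> 'v) \<Rightarrow> nat \<Rightarrow> 'v \<Rightarrow> real \<Rightarrow> real" where
  "nodeder u l im j P t = (if im j = P then dx u l j 0 t else dx u l j (l j) t)"

text \<open>Regularity u \<in> H^3(0,T;L^\<infinity>(\<Lambda>)) \<inter> H^1(0,T;H^2(\<Lambda>)), segment-wise.\<close>
definition H3_Linf :: "nat \<Rightarrow> (nat \<Rightarrow> real) \<Rightarrow> real \<Rightarrow> (nat \<Rightarrow> real \<Rightarrow> real \<Rightarrow> real) \<Rightarrow> bool" where
  "H3_Linf N l T u \<longleftrightarrow> (\<forall>j\<le>N. \<forall>a\<le>3. \<exists>g M.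
      weak_pderiv (l j) T a 0 (\<lambda>z. u j (fst z) (snd z)) g \<and>
      set_borel_measurable lborel {0<..<T} M \<and> set_integrable lborel {0<..<T} (\<lambda>t. (M t)\<^sup>2) \<and>
      (AE z in lborel. z \<in> rect (l j) T \<longrightarrow> \<bar>g z\<bar> \<le> M (snd z)))"

definition H1_H2 :: "nat \<Rightarrow> (nat \<Rightarrow> real) \<Rightarrow> real \<Rightarrow> (nat \<Rightarrow> real \<Rightarrow> real \<Rightarrow> real) \<Rightarrow> bool" where
  "H1_H2 N l T u \<longleftrightarrow> (\<forall>j\<le>N. \<forall>a\<le>1. \<forall>b\<le>2. \<exists>g.
      weak_pderiv (l j) T a b (\<lambda>z. u j (fst z) (snd z)) g \<and> L2_on (rect (l j) T) g)"

section \<open>The wave network system\<close>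

text \<open>u solves d_t^2 u_j - d_x^2 u_j + p_j u_j = 0 on e_j x (0,T), u = h at exterior nodes,
  continuity and Kirchhoff law at interior nodes, u(.,0) = u0, d_t u(.,0) = u1.
  u is taken to be the canonical (continuous, C^1 in x up to the boundary) representative,
  which exists under the regularity assumptions; traces are then pointwise values.
  The PDE holds a.e. with weak derivatives; the initial velocity is the L^\<infinity>-valued
  right derivative at t = 0.\<close>
definition wave_solution ::
  "nat \<Rightarrow> (nat \<Rightarrow> real) \<Rightarrow> (nat \<Rightarrow> 'v) \<Rightarrow> (nat \<Rightarrow> 'v) \<Rightarrow> (nat \<Rightarrow> real \<Rightarrow> real)
   \<Rightarrow> (nat \<Rightarrow> real \<Rightarrow> real) \<Rightarrow> (nat \<Rightarrow> real \<Rightarrow> real) \<Rightarrow> (real \<Rightarrow> real) \<Rightarrow> real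
   \<Rightarrow> (nat \<Rightarrow> real \<Rightarrow> real \<Rightarrow> real) \<Rightarrow> bool" where
  "wave_solution N l im tm p u0 u1 h T u \<longleftrightarrow>
     (\<forall>j\<le>N.
        continuous_on ({0..l j} \<times> {0..T}) (\<lambda>z. u j (fst z) (snd z)) \<and>
        (\<forall>t\<in>{0..T}. \<forall>x\<in>{0..l j}. (\<lambda>y. u j y t) differentiable (at x within {0..l j})) \<and>
        continuous_on ({0..l j} \<times> {0..T}) (\<lambda>z. dx u l j (fst z) (snd z)) \<and>
        (\<exists>gtt gxx. weak_pderiv (l j) T 2 0 (\<lambda>z. u j (fst z) (snd z)) gtt \<and>
                   weak_pderiv (l j) T 0 2 (\<lambda>z. u j (fst z) (snd z)) gxx \<and>
                   (AE z in lborel. z \<in> rect (l j) T \<longrightarrow>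
                      gtt z - gxx z + p j (fst z) * u j (fst z) (snd z) = 0)) \<and>
        (AE x in lborel. x \<in> {0<..<l j} \<longrightarrow> u j x 0 = u0 j x) \<and>
        (\<forall>\<epsilon>>0. \<exists>\<delta>>0. \<forall>t. 0 < t \<and> t < \<delta> \<longrightarrow>
           (AE x in lborel. x \<in> {0<..<l j} \<longrightarrow> \<bar>(u j x t - u j x 0) / t - u1 j x\<bar> \<le> \<epsilon>))) \<and>
     (\<forall>Q\<in>exterior_nodes N im tm. \<forall>j\<le>N. incident im tm j Q \<longrightarrow>
        (\<forall>t\<in>{0<..<T}. nodeval u l im j Q t = h t)) \<and>
     (\<forall>P\<in>interior_nodes N im tm. \<forall>i\<le>N. \<forall>j\<le>N. incident im tm i P \<and> incident im tm j P \<longrightarrow>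
        (\<forall>t\<in>{0<..<T}. nodeval u l im i P t = nodeval u l im j P t)) \<and>
     (\<forall>P\<in>interior_nodes N im tm. \<forall>t\<in>{0<..<T}.
        (\<Sum>j\<in>{j. j \<le> N \<and> incident im tm j P}. nodeder u l im j P t) = 0)"

end

theory Submission
  imports Defs
begin

text \<open>In one space dimension no Carleman estimate is needed. On a segment whose lateral Cauchy data at
  one end agree, the difference \<open>y = u[p] - u[q]\<close> solves \<open>y_tt - y_xx + p y + f R = 0\<close> with
  \<open>f = p - q\<close>, \<open>R = u[q]\<close>, and has zero Cauchy data on both \<open>x = 0\<close> and \<open>t = 0\<close>. Its extension by
  zero therefore satisfies d'Alembert's formula with \<open>x\<close> as the evolution variable, where the source
  is integrated over the part of the cone in \<open>x > 0\<close>, \<open>t > 0\<close>. The formula makes \<open>y\<close> Lipschitz in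
  \<open>t\<close> with constant controlled by the integral of \<open>|f|\<close>, and, evaluated at \<open>t = 0\<close> and
  differentiated, it says that the source integrates to zero along the characteristics \<open>x + t = c\<close>.
  As \<open>|R(x, 0)| \<ge> r\<close>, this is a Volterra equation for \<open>f\<close>, which forces \<open>f = 0\<close> and
  \<open>y = 0\<close> for \<open>t \<le> T - x\<close>. The segments of the tree are then peeled off one by one, starting from
  the observed end-points: at an interior node with a single segment left, continuity and the
  Kirchhoff law (whatever the signs in it) supply the Cauchy data for that segment. Each segment
  costs its length in observation time.\<close>

section \<open>Smooth cutoff functions\<close>

text \<open>The coefficients are merely bounded, and the source contains \<open>p y\<close> with
  \<open>y\<close> itself unknown. Hence d'Alembert's formula has to come from the weak formulation,
  by testing with products of cutoffs in the characteristic variables \<open>x + t\<close> and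
  \<open>t - x\<close>, and the Volterra equation is exploited through the variation of its two
  sides instead of their derivatives. The dependence on \<open>y\<close> is circular: the Lipschitz
  constant of \<open>y\<close> involves \<open>sup |y|\<close>, while \<open>y (x, 0) = 0\<close>
  bounds \<open>sup |y|\<close> by \<open>T\<close> times that constant. The circle is broken by
  advancing in \<open>x\<close> by a short step \<open>\<delta>\<close>, a factor
  \<open>\<delta>\<close> absorbing the term in \<open>y\<close>. The lower bound on
  \<open>R\<close> is available at \<open>t = 0\<close> only; the deviation of
  \<open>R (x, t)\<close> from \<open>R (x, 0)\<close> is measured by a modulus
  \<open>\<mu>\<close>, which is small on short steps too. The step length depends on global bounds
  alone, so finitely many steps cover a segment. The loss of time originates in the cone: with apex
  \<open>(X, t)\<close> it must not reach beyond \<open>t = T\<close>, which restricts everything to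
  \<open>x + t \<le> T\<close>.\<close>

definition smooth1 :: "(nat \<Rightarrow> real \<Rightarrow> real) \<Rightarrow> bool" where
  "smooth1 d \<longleftrightarrow> (\<forall>n x. (d n has_real_derivative d (Suc n) x) (at x))"

lemma smooth1D: "smooth1 d \<Longrightarrow> (d n has_real_derivative d (Suc n) x) (at x)"
  by (simp add: smooth1_def)

lemma smooth1_isCont: "smooth1 d \<Longrightarrow> isCont (d n) x"
  using smooth1D DERIV_isCont by blast

lemma smooth1_continuous_on: "smooth1 d \<Longrightarrow> continuous_on A (d n)"
  by (simp add: continuous_at_imp_continuous_on smooth1_isCont)

text \<open>The recursion is the chain rule: with \<open>w = 1/x\<close> and
  \<open>w' = - w^2\<close>, the derivative of \<open>P w * exp (- w)\<close> is
  \<open>w^2 * (P w - P' w) * exp (- w)\<close>.\<close>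

fun flat_poly :: "nat \<Rightarrow> real poly" where
  "flat_poly 0 = 1"
| "flat_poly (Suc n) = monom 1 2 * (flat_poly n - pderiv (flat_poly n))"

text \<open>The derivatives of \<open>exp (-1/x)\<close>, extended by 0 to \<open>x \<le> 0\<close>.\<close>
definition flat :: "nat \<Rightarrow> real \<Rightarrow> real" where
  "flat n x = (if x \<le> 0 then 0 else poly (flat_poly n) (1/x) * exp (-(1/x)))"

lemma poly_times_exp_minus_tendsto_0:
  fixes p :: "real poly"
  shows "((\<lambda>w. poly p w * exp (-w)) \<longlongrightarrow> 0) at_top"
proof -
  have "((\<lambda>w. \<Sum>i\<le>Polynomial.degree p. coeff p i * (w ^ i / exp w)) \<longlongrightarrow> (\<Sum>i\<le>Polynomial.degree p. coeff p i * 0)) at_top"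
    by (intro tendsto_sum tendsto_mult tendsto_const tendsto_power_div_exp_0)
  moreover have "(\<lambda>w. \<Sum>i\<le>Polynomial.degree p. coeff p i * (w ^ i / exp w)) = (\<lambda>w. poly p w * exp (-w))"
    by (auto simp: poly_altdef sum_distrib_left exp_minus divide_inverse mult_ac fun_eq_iff)
  ultimately show ?thesis by simp
qed

lemma smooth1_flat: "smooth1 flat"
  unfolding smooth1_def
proof (intro allI)
  fix n :: nat and x :: real
  consider "x < 0" | "x = 0" | "x > 0" by linarith
  then show "(flat n has_real_derivative flat (Suc n) x) (at x)"
  proof cases
    case 1
    have "((\<lambda>_. 0) has_real_derivative 0) (at x)" by simp
    then have "(flat n has_real_derivative 0) (at x)"
      by (rule has_field_derivative_transform_within_open[of _ _ _ "{..<0}"]) (use 1 in \<open>auto simp: flat_def\<close>)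
    with 1 show ?thesis by (simp add: flat_def)
  next
    case 2
    have r: "((\<lambda>h. flat n h / h) \<longlongrightarrow> 0) (at_right 0)"
    proof -
      \<comment> \<open>\<open>pCons 0\<close> multiplies by the variable, so the difference
        quotient at 0 is \<open>w * P w * exp (- w)\<close> with \<open>w = 1/h\<close>.\<close>
      have "((\<lambda>h. poly (pCons 0 (flat_poly n)) (inverse h) * exp (-(inverse h))) \<longlongrightarrow> 0) (at_right (0::real))"
        using filterlim_compose[OF poly_times_exp_minus_tendsto_0 filterlim_inverse_at_top_right] .
      moreover have "\<forall>\<^sub>F h in at_right (0::real). poly (pCons 0 (flat_poly n)) (inverse h) * exp (-(inverse h)) = flat n h / h"
        by (rule eventually_at_rightI[of 0 1]) (auto simp: flat_def divide_inverse)
      ultimately show ?thesis by (rule Lim_transform_eventually)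
    qed
    have l: "((\<lambda>h. flat n h / h) \<longlongrightarrow> 0) (at_left 0)"
    proof -
      have "\<forall>\<^sub>F h in at_left (0::real). 0 = flat n h / h"
        by (rule eventually_at_leftI[of "-1" 0]) (auto simp: flat_def)
      then show ?thesis by (rule Lim_transform_eventually[OF tendsto_const])
    qed
    have "((\<lambda>h. flat n h / h) \<longlongrightarrow> 0) (at 0)"
      using l r by (simp add: filterlim_split_at)
    then show ?thesis using 2
      by (simp add: DERIV_def flat_def)
  next
    case 3
    have "((\<lambda>x. poly (flat_poly n) (1/x) * exp (-(1/x))) has_real_derivative
        flat (Suc n) x) (at x)"
      using 3 by (auto intro!: derivative_eq_intros poly_DERIV[THEN DERIV_chain2]
          simp: flat_def poly_monom field_simps power2_eq_square)
    then show ?thesis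
      by (rule has_field_derivative_transform_within_open[of _ _ _ "{0<..}"]) (use 3 in \<open>auto simp: flat_def\<close>)
  qed
qed

lemma smooth1_affine:
  assumes "smooth1 d"
  shows "smooth1 (\<lambda>n z. m ^ n * d n (m * z + c))"
  unfolding smooth1_def
  by (auto intro!: derivative_eq_intros smooth1D[OF assms, THEN DERIV_chain2])

text \<open>Leibniz's rule without binomial coefficients: on the array \<open>f i * g j\<close>
  differentiation acts as the shift operator \<open>S\<close>, and the iterates of \<open>S\<close>,
  read off at index \<open>(0, 0)\<close>, form the required sequence of derivatives.\<close>

lemma smooth1_mult:
  assumes "smooth1 f" "smooth1 g"
  shows "\<exists>d. smooth1 d \<and> d 0 = (\<lambda>x. f 0 x * g 0 x) \<and> d 1 = (\<lambda>x. f 1 x * g 0 x + f 0 x * g 1 x)"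
proof -
  define S :: "(nat \<Rightarrow> nat \<Rightarrow> real \<Rightarrow> real) \<Rightarrow> nat \<Rightarrow> nat \<Rightarrow> real \<Rightarrow> real"
    where "S = (\<lambda>E i j x. E (Suc i) j x + E i (Suc j) x)"
  define E0 :: "nat \<Rightarrow> nat \<Rightarrow> real \<Rightarrow> real" where "E0 = (\<lambda>i j x. f i x * g j x)"
  have "((S ^^ n) E0 i j has_real_derivative (S ^^ Suc n) E0 i j x) (at x)" for n i j x
  proof (induction n arbitrary: i j x)
    case 0
    show ?case
      unfolding E0_def S_def
      by (auto intro!: derivative_eq_intros smooth1D[OF assms(1)] smooth1D[OF assms(2)])
  next
    case (Suc n)
    have "((\<lambda>x. (S ^^ n) E0 (Suc i) j x + (S ^^ n) E0 i (Suc j) x) has_real_derivative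
        (S ^^ Suc n) E0 (Suc i) j x + (S ^^ Suc n) E0 i (Suc j) x) (at x)"
      by (intro DERIV_add Suc.IH)
    then show ?case by (simp add: S_def)
  qed
  then have "smooth1 (\<lambda>n. (S ^^ n) E0 0 0)" by (simp add: smooth1_def)
  then show ?thesis by (intro exI[of _ "\<lambda>n. (S ^^ n) E0 0 0"]) (auto simp: S_def E0_def)
qed

definition bump :: "nat \<Rightarrow> real \<Rightarrow> real" where
  "bump = (SOME d. smooth1 d \<and> d 0 = (\<lambda>x. flat 0 x * flat 0 (1 - x)))"

lemma smooth1_bump: "smooth1 bump"
  and bump_0: "bump 0 x = flat 0 x * flat 0 (1 - x)"
proof -
  have "\<exists>d. smooth1 d \<and> d 0 = (\<lambda>x. flat 0 x * flat 0 (1 - x))"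
    using smooth1_mult[OF smooth1_flat smooth1_affine[OF smooth1_flat, of "-1" 1]] by auto
  from someI_ex[OF this, folded bump_def]
  show "smooth1 bump" "bump 0 x = flat 0 x * flat 0 (1 - x)" by auto
qed

lemma bump_nonneg: "bump 0 x \<ge> 0"
  by (simp add: bump_0 flat_def)

lemma bump_pos: "0 < x \<Longrightarrow> x < 1 \<Longrightarrow> bump 0 x > 0"
  by (simp add: bump_0 flat_def)

lemma bump_eq_0: "x \<le> 0 \<or> x \<ge> 1 \<Longrightarrow> bump 0 x = 0"
  by (auto simp: bump_0 flat_def)

lemma smooth1_locally_zero:
  assumes "smooth1 d" "open A" "x \<in> A" "\<And>y. y \<in> A \<Longrightarrow> d n y = 0"
  shows "d (Suc n) x = 0"
proof -
  have "((\<lambda>_. 0) has_real_derivative d (Suc n) x) (at x)"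
    using has_field_derivative_transform_within_open[OF smooth1D[OF assms(1)] assms(2,3)] assms(4)
    by auto
  then show ?thesis using DERIV_unique DERIV_const by blast
qed

text \<open>The step is the primitive of the bump divided by its total mass \<open>c\<close>, so
  from the first derivative on the family is that of the bump itself.\<close>

lemma ex_smooth_step:
  "\<exists>s. smooth1 s \<and> (\<forall>x\<le>0. s 0 x = 0) \<and> (\<forall>x\<ge>1. s 0 x = 1) \<and> (\<forall>x. s 0 x \<in> {0..1}) \<and>
     (\<forall>n x. x \<le> 0 \<or> x \<ge> 1 \<longrightarrow> s (Suc n) x = 0) \<and> (\<forall>x. s 1 x \<ge> 0)"
proof -
  define c where "c = integral {-1..1} (bump 0)"
  \<comment> \<open>Integration starts at \<open>-1\<close>, strictly left of the support, so that
    \<open>F\<close> can be differentiated from both sides at 0.\<close>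
  define F where "F x = (if x \<le> -1/2 then 0 else integral {-1..x} (bump 0))" for x :: real
  have int: "bump 0 integrable_on {a..b}" for a b
    by (intro integrable_continuous_real smooth1_continuous_on smooth1_bump)
  have integral_eq_zero_bump: "integral A (bump 0) = 0" if "\<And>y. y \<in> A \<Longrightarrow> y \<le> 0 \<or> y \<ge> 1" for A
    using Henstock_Kurzweil_Integration.integral_cong[of A "bump 0" "\<lambda>_. 0"] that bump_eq_0 by auto
  have left: "integral {-1..x} (bump 0) = 0" if "x \<le> 0" for x
    by (intro integral_eq_zero_bump) (use that in auto)
  have F_left: "F x = 0" if "x \<le> 0" for x
    using that left by (simp add: F_def)
  have F_right: "F x = c" if "x \<ge> 1" for x
  proof -
    have "integral {-1..1} (bump 0) + integral {1..x} (bump 0) = integral {-1..x} (bump 0)"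
      using that int by (intro Henstock_Kurzweil_Integration.integral_combine) auto
    moreover have "integral {1..x} (bump 0) = 0"
      by (intro integral_eq_zero_bump) auto
    ultimately show ?thesis using that by (simp add: F_def c_def)
  qed
  have F': "(F has_real_derivative bump 0 x) (at x)" for x
  proof (cases "x < 0")
    case True
    have "((\<lambda>_. 0) has_real_derivative 0) (at x)" by simp
    then have "(F has_real_derivative 0) (at x)"
      by (rule has_field_derivative_transform_within_open[of _ _ _ "{..<0}"])
        (use True F_left in auto)
    then show ?thesis using True by (simp add: bump_eq_0)
  next
    case False
    have "((\<lambda>u. integral {-1..u} (bump 0)) has_real_derivative bump 0 x) (at x within {-1..x+1})"
      using False by (intro integral_has_real_derivative smooth1_continuous_on smooth1_bump) auto
    then have "((\<lambda>u. integral {-1..u} (bump 0)) has_real_derivative bump 0 x) (at x)"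
      using False by (simp add: at_within_Icc_at)
    then show ?thesis
      by (rule has_field_derivative_transform_within_open[of _ _ _ "{-1/2<..}"])
        (use False in \<open>auto simp: F_def\<close>)
  qed
  have mono: "F x \<le> F y" if "x \<le> y" for x y
    by (rule DERIV_nonneg_imp_nondecreasing[OF that]) (use F' bump_nonneg in blast)
  have "c > 0"
  proof -
    have "c \<ge> 0" unfolding c_def by (intro integral_nonneg int) (auto simp: bump_nonneg)
    \<comment> \<open>If \<open>c = 0\<close>, the monotone \<open>F\<close> is 0 on both sides of
      the unit interval, hence everywhere, against \<open>F' = bump 0 > 0\<close> at
      \<open>1/2\<close>.\<close>
    moreover have "c \<noteq> 0"
    proof
      assume "c = 0"
      have "F x = 0" for x
        using F_left[of x] F_left[of 0] F_right[of x] F_right[of 1] mono[of 0 x] mono[of x 1] \<open>c = 0\<close>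
        by (cases "x \<le> 0"; cases "x \<ge> 1") auto
      then have "F = (\<lambda>_. 0)" by auto
      then have "((\<lambda>_. 0) has_real_derivative bump 0 (1/2)) (at (1/2::real))" using F' by metis
      then have "bump 0 (1/2) = 0" using DERIV_unique DERIV_const by blast
      then show False using bump_pos[of "1/2"] by simp
    qed
    ultimately show ?thesis by simp
  qed
  define s where "s n = (case n of 0 \<Rightarrow> (\<lambda>x. F x / c) | Suc m \<Rightarrow> (\<lambda>x. bump m x / c))" for n
  have s: "smooth1 s"
    unfolding smooth1_def s_def
    by (auto split: nat.split intro!: DERIV_cdivide F' smooth1D[OF smooth1_bump])
  have right: "\<And>x. x \<ge> 1 \<Longrightarrow> s 0 x = 1" and left: "\<And>x. x \<le> 0 \<Longrightarrow> s 0 x = 0"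
    using F_left F_right \<open>c > 0\<close> by (auto simp: s_def)
  have mem: "s 0 x \<in> {0..1}" for x
    using mono[of 0 x] mono[of x 0] mono[of x 1] mono[of 1 x] F_left[of 0] F_right[of 1] \<open>c > 0\<close>
    by (cases "x \<le> 0"; cases "x \<ge> 1") (auto simp: s_def F_left F_right)
  have out: "s (Suc n) x = 0" if "x < 0 \<or> x > 1" for n x
    using that
  proof (induction n arbitrary: x)
    case 0
    then show ?case by (auto simp: s_def bump_eq_0)
  next
    case (Suc n)
    show ?case
      by (rule smooth1_locally_zero[OF s, of "{..<0} \<union> {1<..}"]) (use Suc in auto)
  qed
  have "s (Suc n) x = 0" if "x \<le> 0 \<or> x \<ge> 1" for n x
  proof -
    \<comment> \<open>The local argument reaches only the open complement of the unit interval;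
      continuity adds the end-points.\<close>
    have "closed {x. s (Suc n) x = 0}"
      by (intro closed_Collect_eq smooth1_continuous_on s continuous_on_const)
    then have "closure {x. x < 0 \<or> x > (1::real)} \<subseteq> {x. s (Suc n) x = 0}"
      by (rule closure_minimal[rotated]) (use out in auto)
    moreover have "closure {x. x < 0 \<or> x > (1::real)} = {x. x \<le> 0 \<or> x \<ge> 1}"
    proof -
      have "{x. x < 0 \<or> x > (1::real)} = {..<0} \<union> {1<..}" by auto
      then show ?thesis by (auto simp: closure_Un)
    qed
    ultimately show ?thesis using that by auto
  qed
  moreover have "s 1 x \<ge> 0" for x
    using \<open>c > 0\<close> by (simp add: s_def bump_nonneg)
  ultimately show ?thesis using s right left mem by blast
qed

text \<open>One step is fixed once and for all: every cutoff is a rescaling of it, which makes the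
  bounds on derivatives uniform up to a power of the scale.\<close>

definition sstep :: "nat \<Rightarrow> real \<Rightarrow> real" where
  "sstep = (SOME s. smooth1 s \<and> (\<forall>x\<le>0. s 0 x = 0) \<and> (\<forall>x\<ge>1. s 0 x = 1) \<and> (\<forall>x. s 0 x \<in> {0..1}) \<and>
     (\<forall>n x. x \<le> 0 \<or> x \<ge> 1 \<longrightarrow> s (Suc n) x = 0) \<and> (\<forall>x. s 1 x \<ge> 0))"

lemma
  shows smooth1_sstep: "smooth1 sstep"
    and sstep_left: "x \<le> 0 \<Longrightarrow> sstep 0 x = 0"
    and sstep_right: "x \<ge> 1 \<Longrightarrow> sstep 0 x = 1"
    and sstep_mem: "sstep 0 x \<in> {0..1}"
    and sstep_deriv_0: "x \<le> 0 \<or> x \<ge> 1 \<Longrightarrow> sstep (Suc n) x = 0"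
    and sstep_deriv_nonneg: "sstep 1 x \<ge> 0"
  using someI_ex[OF ex_smooth_step, folded sstep_def] by (metis | simp)+

lemma sstep_bounded: "\<exists>C>0. \<forall>x. \<bar>sstep n x\<bar> \<le> C"
proof (cases n)
  case 0
  then show ?thesis using sstep_mem by (intro exI[of _ 1]) auto
next
  case (Suc m)
  have "bounded (sstep n ` {0..1})"
    by (intro compact_imp_bounded compact_continuous_image smooth1_continuous_on smooth1_sstep) auto
  then obtain C where C: "\<And>x. x \<in> {0..1} \<Longrightarrow> \<bar>sstep n x\<bar> \<le> C"
    unfolding bounded_iff by (metis image_eqI real_norm_def)
  have "\<bar>sstep n x\<bar> \<le> max C 1" for x
    using C[of x] Suc sstep_deriv_0[of x m] by (cases "x \<in> {0..1}") auto
  then show ?thesis by (intro exI[of _ "max C 1"]) auto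
qed

text \<open>The step \<^term>\<open>cutoff d 0\<close> climbs from 0 at \<open>d\<close> to 1 at \<open>2 * d\<close>.\<close>
definition cutoff :: "real \<Rightarrow> nat \<Rightarrow> real \<Rightarrow> real" where
  "cutoff d n z = sstep n ((z - d) / d) / d ^ n"

lemma smooth1_cutoff: "smooth1 (cutoff d)"
proof (cases "d = 0")
  case True
  \<comment> \<open>Division by 0 yields 0, so the entry of order 0 is constant and all others,
    being divided by \<open>0 ^ n\<close>, vanish.\<close>
  have "cutoff 0 n = (\<lambda>z. if n = 0 then sstep 0 0 else 0)" for n
    by (auto simp: cutoff_def fun_eq_iff)
  then show ?thesis using True by (simp add: smooth1_def)
next
  case False
  then show ?thesis
    unfolding smooth1_def cutoff_def
    by (auto intro!: derivative_eq_intros smooth1D[OF smooth1_sstep, THEN DERIV_chain2])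
qed

lemma smooth1_const: "smooth1 (\<lambda>n z. if n = 0 then c else 0)"
  by (simp add: smooth1_def)

section \<open>Product test functions\<close>

text \<open>On functions of \<open>x + t\<close> and \<open>t - x\<close> the operator
  \<open>d_t^2 - d_x^2\<close> is four times the mixed derivative in these variables. So
  \<open>4 c d f' g'\<close> is the only term of \<open>D 2 0 - D 0 2\<close> in which no derivative
  falls on \<open>c\<close> or \<open>d\<close>, the cutoffs towards the boundary. The formula for
  \<open>D 1 0\<close> serves the time regularity.\<close>

lemma ex_product_family:
  assumes c: "smooth1 c" and d: "smooth1 d" and f: "smooth1 f" and g: "smooth1 g"
  shows "\<exists>D. smooth_family D \<and>
    (\<forall>x t. D 0 0 (x, t) = c 0 x * d 0 t * f 0 (x + t) * g 0 (t - x)) \<and>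
    (\<forall>x t. D 1 0 (x, t) = c 0 x * (d 1 t * f 0 (x + t) * g 0 (t - x)
       + d 0 t * f 1 (x + t) * g 0 (t - x) + d 0 t * f 0 (x + t) * g 1 (t - x))) \<and>
    (\<forall>x t. D 2 0 (x, t) - D 0 2 (x, t) = 4 * c 0 x * d 0 t * f 1 (x + t) * g 1 (t - x)
       + c 0 x * (d 2 t * f 0 (x + t) * g 0 (t - x)
           + 2 * d 1 t * (f 1 (x + t) * g 0 (t - x) + f 0 (x + t) * g 1 (t - x)))
       - d 0 t * (c 2 x * f 0 (x + t) * g 0 (t - x)
           + 2 * c 1 x * (f 1 (x + t) * g 0 (t - x) - f 0 (x + t) * g 1 (t - x))))"
    (is "\<exists>D. _ \<and> (\<forall>x t. ?D0 D x t) \<and> (\<forall>x t. ?D1 D x t) \<and> (\<forall>x t. ?D2 D x t)")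
proof -
  \<comment> \<open>The four indices count the derivatives of \<open>c\<close>, \<open>d\<close>,
    \<open>f\<close>, \<open>g\<close>. On such arrays \<open>X\<close> and \<open>S\<close> act as
    \<open>d_x\<close> and \<open>d_t\<close>, with a minus sign in \<open>X\<close> for the
    argument \<open>t - x\<close>; they commute, so the order of differentiation is
    immaterial.\<close>
  define F :: "nat \<Rightarrow> nat \<Rightarrow> nat \<Rightarrow> nat \<Rightarrow> real \<times> real \<Rightarrow> real"
    where "F = (\<lambda>i j k m z. c i (fst z) * d j (snd z) * f k (fst z + snd z) * g m (snd z - fst z))"
  define X where "X = (\<lambda>(E :: nat \<Rightarrow> nat \<Rightarrow> nat \<Rightarrow> nat \<Rightarrow> real \<times> real \<Rightarrow> real) i j k m z.
    E (Suc i) j k m z + E i j (Suc k) m z - E i j k (Suc m) z)"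
  define S where "S = (\<lambda>(E :: nat \<Rightarrow> nat \<Rightarrow> nat \<Rightarrow> nat \<Rightarrow> real \<times> real \<Rightarrow> real) i j k m z.
    E i (Suc j) k m z + E i j (Suc k) m z + E i j k (Suc m) z)"
  define good where "good E \<longleftrightarrow> (\<forall>i j k m. continuous_on UNIV (E i j k m) \<and>
     (\<forall>x t. ((\<lambda>y. E i j k m (y, t)) has_real_derivative X E i j k m (x, t)) (at x) \<and>
       ((\<lambda>s. E i j k m (x, s)) has_real_derivative S E i j k m (x, t)) (at t)))" for E
  have good_lin: "good (\<lambda>i j k m z. \<alpha> * E (Suc i) j k m z + \<beta> * E i (Suc j) k m z + E i j (Suc k) m z + \<gamma> * E i j k (Suc m) z)"
    (is "good ?E") if E: "good E" for E \<alpha> \<beta> \<gamma>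
    unfolding good_def
  proof (intro allI conjI)
    fix i j k m x t
    have E': "continuous_on UNIV (E i j k m)"
      "((\<lambda>y. E i j k m (y, t)) has_real_derivative X E i j k m (x, t)) (at x)"
      "((\<lambda>s. E i j k m (x, s)) has_real_derivative S E i j k m (x, t)) (at t)" for i j k m
      using E by (auto simp: good_def)
    show "continuous_on UNIV (?E i j k m)"
      by (intro continuous_intros E'(1))
    show "((\<lambda>y. ?E i j k m (y, t)) has_real_derivative X ?E i j k m (x, t)) (at x)"
      using DERIV_add[OF DERIV_add[OF DERIV_add[OF DERIV_cmult[OF E'(2)[of "Suc i" j k m], of \<alpha>]
        DERIV_cmult[OF E'(2)[of i "Suc j" k m], of \<beta>]] E'(2)[of i j "Suc k" m]] DERIV_cmult[OF E'(2)[of i j k "Suc m"], of \<gamma>]]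
      by (simp add: X_def algebra_simps)
    show "((\<lambda>s. ?E i j k m (x, s)) has_real_derivative S ?E i j k m (x, t)) (at t)"
      using DERIV_add[OF DERIV_add[OF DERIV_add[OF DERIV_cmult[OF E'(3)[of "Suc i" j k m], of \<alpha>]
        DERIV_cmult[OF E'(3)[of i "Suc j" k m], of \<beta>]] E'(3)[of i j "Suc k" m]] DERIV_cmult[OF E'(3)[of i j k "Suc m"], of \<gamma>]]
      by (simp add: S_def algebra_simps)
  qed
  have goodX: "good (X E)" and goodS: "good (S E)" if "good E" for E
    using good_lin[OF that, of 1 0 "-1"] good_lin[OF that, of 0 1 1] by (simp_all add: X_def S_def)
  have XS: "X (S E) = S (X E)" for E
    by (simp add: X_def S_def fun_eq_iff)
  have XSn: "X ((S ^^ a) E) = (S ^^ a) (X E)" for a E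
    by (induction a) (simp_all add: XS)
  have good0: "good F"
    unfolding good_def
  proof (intro allI conjI)
    fix i j k m x t
    show "continuous_on UNIV (F i j k m)"
      unfolding F_def
      by (intro continuous_intros continuous_on_compose2[OF smooth1_continuous_on[OF c, of UNIV]]
        continuous_on_compose2[OF smooth1_continuous_on[OF d, of UNIV]]
        continuous_on_compose2[OF smooth1_continuous_on[OF f, of UNIV]]
        continuous_on_compose2[OF smooth1_continuous_on[OF g, of UNIV]]) auto
    show "((\<lambda>y. F i j k m (y, t)) has_real_derivative X F i j k m (x, t)) (at x)"
      unfolding X_def F_def
      by (auto intro!: derivative_eq_intros smooth1D[OF c, THEN DERIV_chain2]
        smooth1D[OF f, THEN DERIV_chain2] smooth1D[OF g, THEN DERIV_chain2] simp: algebra_simps)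
    show "((\<lambda>s. F i j k m (x, s)) has_real_derivative S F i j k m (x, t)) (at t)"
      unfolding S_def F_def
      by (auto intro!: derivative_eq_intros smooth1D[OF d, THEN DERIV_chain2]
        smooth1D[OF f, THEN DERIV_chain2] smooth1D[OF g, THEN DERIV_chain2] simp: algebra_simps)
  qed
  have goodn: "good ((S ^^ a) ((X ^^ b) F))" for a b
  proof -
    have "good ((X ^^ b) F)" by (induction b) (simp_all add: good0 goodX)
    then show ?thesis by (induction a) (simp_all add: goodS)
  qed
  define D where "D a b = (S ^^ a) ((X ^^ b) F) 0 0 0 0" for a b
  have "smooth_family D"
    unfolding smooth_family_def
  proof (intro allI conjI)
    fix a b x t
    have E: "D a (Suc b) = X ((S ^^ a) ((X ^^ b) F)) 0 0 0 0" "D (Suc a) b = S ((S ^^ a) ((X ^^ b) F)) 0 0 0 0"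
      by (simp_all add: D_def XSn)
    note g = goodn[of a b, unfolded good_def, rule_format, of 0 0 0 0, folded D_def E]
    show "continuous_on UNIV (D a b)" using g by blast
    show "((\<lambda>y. D a b (y, t)) has_real_derivative D a (Suc b) (x, t)) (at x)" using g by blast
    show "((\<lambda>s. D a b (x, s)) has_real_derivative D (Suc a) b (x, t)) (at t)" using g by blast
  qed
  moreover have "?D0 D x t" for x t
    by (simp add: D_def F_def)
  moreover have "?D1 D x t" for x t
    by (simp add: D_def F_def S_def algebra_simps)
  moreover have "?D2 D x t" for x t
    by (simp add: D_def F_def S_def X_def numeral_2_eq_2 algebra_simps)
  ultimately show ?thesis by (intro exI[of _ D]) blast
qed

lemma test_funI:
  assumes "smooth_family D" "compact K" "K \<subseteq> rect l T" "\<And>z. D 0 0 z \<noteq> 0 \<Longrightarrow> z \<in> K"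
  shows "test_fun l T D"
proof -
  have "closure {z. D 0 0 z \<noteq> 0} \<subseteq> K"
    by (rule closure_minimal) (use assms compact_imp_closed in auto)
  then show ?thesis
    using assms compact_Int_closed[OF assms(2), of "closure {z. D 0 0 z \<noteq> 0}"] unfolding test_fun_def
    by (auto simp: inf.absorb2)
qed

section \<open>Measurability and integrability on the space-time rectangle\<close>

lemma rect_sets [measurable]: "rect l T \<in> sets borel"
  unfolding rect_def by (intro borel_open open_Times) auto

abbreviation crect :: "real \<Rightarrow> real \<Rightarrow> (real \<times> real) set" where
  "crect l T \<equiv> {0..l} \<times> {0..T}"

lemma rect_subset_closed: "rect l T \<subseteq> crect l T"
  by (auto simp: rect_def)

lemma measure_lborel_rectangle:
  assumes "a \<le> b" "c \<le> d"
  shows "measure lborel ({a..b::real} \<times> {c..d::real}) = (b - a) * (d - c)"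
  using assms content_Pair[of a c b d] by (simp add: cbox_Pair_eq)

lemma emeasure_lborel_rectangle_finite: "emeasure lborel ({a..b::real} \<times> {c..d::real}) < \<infinity>"
  using emeasure_lborel_cbox_finite[of "(a, c)" "(b, d)"] by (simp add: cbox_Pair_eq)

lemma emeasure_rect_finite: "emeasure lborel (rect l T) < \<infinity>"
  using emeasure_mono[OF rect_subset_closed, of l T lborel] emeasure_lborel_rectangle_finite[of 0 l 0 T]
  by (auto intro: le_less_trans simp: borel_closed closed_Times)

lemma set_integrable_bounded:
  fixes f :: "'a \<Rightarrow> real"
  assumes "set_borel_measurable M A f" "A \<in> sets M" "emeasure M A < \<infinity>" "\<And>x. x \<in> A \<Longrightarrow> \<bar>f x\<bar> \<le> B"
  shows "set_integrable M A f"
  unfolding set_integrable_def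
  by (rule integrableI_bounded_set[where A = A and B = B])
    (use assms in \<open>auto simp: set_borel_measurable_def\<close>)

lemma set_integrable_rect:
  fixes f :: "real \<times> real \<Rightarrow> real"
  assumes "set_borel_measurable lborel (rect l T) f" "\<And>z. z \<in> rect l T \<Longrightarrow> \<bar>f z\<bar> \<le> B"
  shows "set_integrable lborel (rect l T) f"
  by (rule set_integrable_bounded[OF assms(1) _ emeasure_rect_finite assms(2)]) simp_all

lemma set_borel_measurable_continuous_rect:
  assumes "continuous_on (crect l T) (f :: real \<times> real \<Rightarrow> real)"
  shows "set_borel_measurable lborel (rect l T) f"
  using borel_measurable_continuous_on_indicator[OF rect_sets continuous_on_subset[OF assms rect_subset_closed]]
  by (simp add: set_borel_measurable_def)

lemma continuous_rectangle_bounded: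
  assumes "continuous_on ({0..l::real} \<times> {0..T::real}) (f :: real \<times> real \<Rightarrow> real)"
  obtains B where "B > 0" "\<And>z. z \<in> crect l T \<Longrightarrow> \<bar>f z\<bar> \<le> B"
proof -
  have "bounded (f ` (crect l T))"
    by (intro compact_imp_bounded compact_continuous_image assms compact_Times) auto
  then obtain B where "B > 0" "\<And>v. v \<in> f ` (crect l T) \<Longrightarrow> \<bar>v\<bar> \<le> B"
    unfolding bounded_pos real_norm_def by blast
  then show thesis using that by (metis image_eqI)
qed

lemma set_integrable_rect_continuous:
  assumes "continuous_on (crect l T) (f :: real \<times> real \<Rightarrow> real)"
  shows "set_integrable lborel (rect l T) f"
  using continuous_rectangle_bounded[OF assms] set_integrable_rect set_borel_measurable_continuous_rect[OF assms]
    rect_subset_closed by (metis subsetD)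

lemma set_borel_measurable_times_borel:
  fixes f g :: "'a \<Rightarrow> real"
  assumes "set_borel_measurable M A f" "g \<in> borel_measurable M"
  shows "set_borel_measurable M A (\<lambda>x. f x * g x)"
  using borel_measurable_times[OF assms(1)[unfolded set_borel_measurable_def] assms(2)]
  by (simp add: set_borel_measurable_def mult.assoc)

lemma set_integrable_rect_times:
  fixes f g :: "real \<times> real \<Rightarrow> real"
  assumes "set_integrable lborel (rect l T) f" "g \<in> borel_measurable borel" "\<And>z. z \<in> rect l T \<Longrightarrow> \<bar>g z\<bar> \<le> B"
  shows "set_integrable lborel (rect l T) (\<lambda>z. f z * g z)"
  unfolding set_integrable_def
proof (rule Bochner_Integration.integrable_bound[of _ "\<lambda>z. B * (indicat_real (rect l T) z *\<^sub>R f z)"])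
  show "integrable lborel (\<lambda>z. B * (indicat_real (rect l T) z *\<^sub>R f z))"
    using assms(1) unfolding set_integrable_def by (intro integrable_mult_right)
  show "(\<lambda>z. indicat_real (rect l T) z *\<^sub>R (f z * g z)) \<in> borel_measurable lborel"
    using set_borel_measurable_times_borel[of lborel "rect l T" f g] assms(1,2)
    unfolding set_borel_measurable_def set_integrable_def
    by (auto dest: borel_measurable_integrable)
  have "\<bar>f z * g z\<bar> \<le> \<bar>B * f z\<bar>" if "z \<in> rect l T" for z
    using mult_right_mono[OF assms(3)[OF that], of "\<bar>f z\<bar>"] assms(3)[OF that]
    by (simp add: abs_mult mult_ac)
  then show "AE z in lborel. norm (indicat_real (rect l T) z *\<^sub>R (f z * g z)) \<le> norm (B * (indicat_real (rect l T) z *\<^sub>R f z))"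
    by (auto simp: indicator_def)
qed

section \<open>Weak solutions and their extension by zero\<close>

lemma cutoff_left: "d > 0 \<Longrightarrow> z \<le> d \<Longrightarrow> cutoff d 0 z = 0"
  by (simp add: cutoff_def sstep_left divide_nonpos_pos)

lemma cutoff_right: "d > 0 \<Longrightarrow> z \<ge> 2 * d \<Longrightarrow> cutoff d 0 z = 1"
  by (simp add: cutoff_def sstep_right)

lemma cutoff_mem: "0 \<le> cutoff d 0 z" "cutoff d 0 z \<le> 1" "\<bar>cutoff d 0 z\<bar> \<le> 1"
  using sstep_mem[of "(z - d) / d"] by (auto simp: cutoff_def)

lemma cutoff_deriv_0: "d > 0 \<Longrightarrow> z \<le> d \<or> z \<ge> 2 * d \<Longrightarrow> cutoff d (Suc n) z = 0"
  by (subst cutoff_def, subst sstep_deriv_0) (auto simp: divide_nonpos_pos)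

lemma cutoff_deriv_nonneg: "d > 0 \<Longrightarrow> cutoff d 1 z \<ge> 0"
  using sstep_deriv_nonneg[of "(z - d) / d"] by (simp add: cutoff_def)

lemma cutoff_bounded: "\<exists>C>0. \<forall>d>0. \<forall>z. \<bar>cutoff d n z\<bar> \<le> C / d ^ n"
  using sstep_bounded[of n] by (auto simp: cutoff_def abs_divide intro!: divide_right_mono)

lemma continuous_on_cutoff [continuous_intros]:
  "continuous_on A f \<Longrightarrow> continuous_on A (\<lambda>x. cutoff d n (f x))"
  by (rule continuous_on_compose2[OF smooth1_continuous_on[OF smooth1_cutoff, of UNIV]]) auto

lemma borel_measurable_cutoff [measurable]: "cutoff d n \<in> borel_measurable borel"
  by (intro borel_measurable_continuous_onI continuous_on_cutoff continuous_on_id)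

lemma cutoff_tendsto:
  assumes "\<And>n. e n > 0" "e \<longlonglongrightarrow> 0"
  shows "(\<lambda>n. cutoff (e n) 0 z) \<longlonglongrightarrow> (if z > 0 then 1 else 0)"
proof (cases "z > 0")
  case True
  then have "eventually (\<lambda>n. e n < z / 2) sequentially"
    using order_tendstoD(2)[OF assms(2), of "z / 2"] by simp
  then have "eventually (\<lambda>n. cutoff (e n) 0 z = 1) sequentially"
    by eventually_elim (use assms(1) in \<open>simp add: cutoff_right\<close>)
  then show ?thesis using True by (simp add: tendsto_eventually)
next
  case False
  then show ?thesis using cutoff_left[OF assms(1), of z] order_trans[OF _ less_imp_le[OF assms(1)], of z] by simp
qed

text \<open>The sign convention is \<open>y_tt - y_xx + G = 0\<close>.\<close>
definition weak_wave :: "real \<Rightarrow> real \<Rightarrow> (real \<times> real \<Rightarrow> real) \<Rightarrow> (real \<times> real \<Rightarrow> real) \<Rightarrow> bool" where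
  "weak_wave l T y G \<longleftrightarrow> (\<forall>D. test_fun l T D \<longrightarrow>
     (LBINT z:rect l T. y z * (D 2 0 z - D 0 2 z)) = - (LBINT z:rect l T. G z * D 0 0 z))"

lemma borel_measurable_indicator_fst_snd:
  fixes A :: "real set"
  assumes "A \<in> sets borel"
  shows "(\<lambda>z :: real \<times> real. indicat_real A (fst z)) \<in> borel_measurable borel"
    and "(\<lambda>z :: real \<times> real. indicat_real A (snd z)) \<in> borel_measurable borel"
  by (intro measurable_compose[OF _ borel_measurable_indicator[OF assms]]
      borel_measurable_continuous_onI continuous_intros)+

lemma set_borel_measurable_rect_borel:
  fixes f :: "real \<times> real \<Rightarrow> real"
  assumes "f \<in> borel_measurable borel"
  shows "set_borel_measurable lborel (rect l T) f"
  unfolding set_borel_measurable_def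
  using borel_measurable_scaleR[OF borel_measurable_indicator[OF rect_sets] assms] by simp

lemma strip_integral:
  assumes "u \<le> v" "0 \<le> l" "0 \<le> T"
  shows "(LBINT z:rect l T. indicat_real {u..v} (fst z)) \<le> (v - u) * T"
    and "(LBINT z:rect l T. indicat_real {u..v} (snd z)) \<le> (v - u) * l"
proof -
  have *: "(LBINT z:rect l T. f z) \<le> measure lborel A"
    if "A = {a..b} \<times> {c..d}" "\<And>z. z \<in> rect l T \<Longrightarrow> f z \<le> indicat_real A z"
      "f \<in> borel_measurable borel" "\<And>z. \<bar>f z\<bar> \<le> 1" for f A a b c d
  proof -
    have A: "A \<in> sets lborel" "emeasure lborel A < \<infinity>"
      unfolding that(1) using emeasure_lborel_rectangle_finite by (auto simp: closed_Times borel_closed)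
    have "(LBINT z:rect l T. f z) \<le> (LBINT z. indicat_real A z)"
      unfolding set_lebesgue_integral_def
    proof (rule integral_mono)
      have "set_integrable lborel (rect l T) f"
        using that by (intro set_integrable_rect[of _ _ _ 1]) (auto simp: set_borel_measurable_def)
      then show "integrable lborel (\<lambda>z. indicat_real (rect l T) z *\<^sub>R f z)"
        by (simp add: set_integrable_def)
      show "integrable lborel (indicat_real A)"
        using A by simp
      show "indicat_real (rect l T) z *\<^sub>R f z \<le> indicat_real A z" for z
        using that(2)[of z] by (cases "z \<in> rect l T") auto
    qed
    then show ?thesis using A by simp
  qed
  show "(LBINT z:rect l T. indicat_real {u..v} (fst z)) \<le> (v - u) * T"
    using *[where a = u and b = v and c = 0 and d = T and f = "\<lambda>z. indicat_real {u..v} (fst z)",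
        OF refl _ borel_measurable_indicator_fst_snd(1)] assms
    by (auto simp: measure_lborel_rectangle rect_def indicator_def mult.commute split: if_splits)
  show "(LBINT z:rect l T. indicat_real {u..v} (snd z)) \<le> (v - u) * l"
    using *[where a = 0 and b = l and c = u and d = v and f = "\<lambda>z. indicat_real {u..v} (snd z)",
        OF refl _ borel_measurable_indicator_fst_snd(2)] assms
    by (auto simp: measure_lborel_rectangle rect_def indicator_def mult.commute split: if_splits)
qed

text \<open>Scaling: second derivatives of a cutoff have size \<open>e^-2\<close> on a strip of
  width \<open>e\<close> along the boundary, where \<open>|y| \<le> 2 \<eta> e\<close>. The powers
  of \<open>e\<close> cancel and leave an integral of order \<open>\<eta>\<close>; it is
  \<open>y = o(x)\<close> and \<open>y = o(t)\<close>, not a small \<open>e\<close>, that makes the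
  error small.\<close>

lemma cutoff_error:
  assumes e: "0 < e" "e \<le> 1" and "0 \<le> l" "0 \<le> T" "\<eta> \<ge> 0"
    and cont: "continuous_on (crect l T) y" and contE: "continuous_on UNIV E"
    and C1: "\<And>z. \<bar>cutoff e 1 z\<bar> \<le> C1 / e" and C2: "\<And>z. \<bar>cutoff e 2 z\<bar> \<le> C2 / e ^ 2"
    and y1: "\<And>x t. (x, t) \<in> rect l T \<Longrightarrow> x \<le> 2 * e \<Longrightarrow> \<bar>y (x, t)\<bar> \<le> \<eta> * x"
    and y2: "\<And>x t. (x, t) \<in> rect l T \<Longrightarrow> t \<le> 2 * e \<Longrightarrow> \<bar>y (x, t)\<bar> \<le> \<eta> * t"
    and E: "\<And>x t. \<bar>E (x, t)\<bar> \<le> C * (\<bar>cutoff e 2 t\<bar> + 2 * \<bar>cutoff e 1 t\<bar>)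
       + C * (\<bar>cutoff e 2 x\<bar> + 2 * \<bar>cutoff e 1 x\<bar>)" and "C \<ge> 0"
  shows "\<bar>LBINT z:rect l T. y z * E z\<bar> \<le> \<eta> * (C * (2 * C2 + 4 * C1)) * (T + l)"
proof -
  define B where "B = \<eta> * (C * (2 * C2 + 4 * C1)) / e"
  have C0: "C1 \<ge> 0" "C2 \<ge> 0"
    using order_trans[OF abs_ge_zero C1] order_trans[OF abs_ge_zero C2] e
    by (auto simp: zero_le_divide_iff not_less dest: leD)
  have key: "\<bar>w\<bar> * (C * (\<bar>cutoff e 2 x\<bar> + 2 * \<bar>cutoff e 1 x\<bar>)) \<le> B * indicat_real {e..2*e} x"
    if w: "x \<le> 2 * e \<Longrightarrow> \<bar>w\<bar> \<le> \<eta> * x" for w x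
  proof (cases "x \<in> {e..2*e}")
    case False
    then show ?thesis
      using cutoff_deriv_0[OF e(1), of x 0] cutoff_deriv_0[OF e(1), of x 1] by (auto simp: numeral_2_eq_2)
  next
    case True
    have "\<bar>w\<bar> \<le> \<eta> * (2 * e)"
      using w True \<open>\<eta> \<ge> 0\<close> by (meson atLeastAtMost_iff mult_left_mono order_trans)
    note m1 = this
    have "C * (\<bar>cutoff e 2 x\<bar> + 2 * \<bar>cutoff e 1 x\<bar>) \<le> C * (C2 / e ^ 2 + 2 * (C1 / e))"
      using C1 C2 \<open>C \<ge> 0\<close> by (intro mult_left_mono add_mono) auto
    from mult_mono[OF m1 this] have "\<bar>w\<bar> * (C * (\<bar>cutoff e 2 x\<bar> + 2 * \<bar>cutoff e 1 x\<bar>)) \<le> \<eta> * (2 * e) * (C * (C2 / e ^ 2 + 2 * (C1 / e)))"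
      using \<open>C \<ge> 0\<close> \<open>\<eta> \<ge> 0\<close> e by simp
    also have "\<dots> = \<eta> * C * (2 * C2 / e + 4 * C1)"
      using e by (simp add: field_simps power2_eq_square)
    \<comment> \<open>First derivatives are of lower order; \<open>e \<le> 1\<close> lets them be
      counted like second ones.\<close>
    also have "\<dots> \<le> \<eta> * C * (2 * C2 / e + 4 * C1 / e)"
    proof -
      have "4 * C1 \<le> 4 * C1 / e" using e C0 by (simp add: le_divide_eq mult_left_le)
      then show ?thesis using \<open>C \<ge> 0\<close> \<open>\<eta> \<ge> 0\<close> by (intro mult_left_mono add_left_mono) auto
    qed
    also have "\<dots> = B * indicat_real {e..2*e} x" using True e by (simp add: B_def field_simps)
    finally show ?thesis .
  qed
  have B0: "B \<ge> 0" using C0 e \<open>C \<ge> 0\<close> \<open>\<eta> \<ge> 0\<close> by (simp add: B_def)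
  have int: "set_integrable lborel (rect l T) (\<lambda>z. y z * E z)"
    by (intro set_integrable_rect_continuous continuous_intros cont continuous_on_subset[OF contE]) auto
  have ind: "set_integrable lborel (rect l T) (\<lambda>z. indicat_real {e..2*e} (fst z))"
    "set_integrable lborel (rect l T) (\<lambda>z. indicat_real {e..2*e} (snd z))"
    by (intro set_integrable_rect[of _ _ _ 1] set_borel_measurable_rect_borel borel_measurable_indicator_fst_snd; simp)+
  have "\<bar>LBINT z:rect l T. y z * E z\<bar> \<le> (LBINT z:rect l T. \<bar>y z * E z\<bar>)"
    using set_integral_norm_bound[OF int] by simp
  also have "\<dots> \<le> (LBINT z:rect l T. B * indicat_real {e..2*e} (snd z) + B * indicat_real {e..2*e} (fst z))"
  proof (rule set_integral_mono)
    show "set_integrable lborel (rect l T) (\<lambda>z. \<bar>y z * E z\<bar>)"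
      using set_integrable_abs[OF int] .
    show "set_integrable lborel (rect l T) (\<lambda>z. B * indicat_real {e..2*e} (snd z) + B * indicat_real {e..2*e} (fst z))"
      using ind by (intro set_integral_add(1) set_integrable_mult_right) auto
    fix z assume z: "z \<in> rect l T"
    obtain x t where zz: "z = (x, t)" by force
    have "\<bar>y z * E z\<bar> \<le> \<bar>y z\<bar> * (C * (\<bar>cutoff e 2 t\<bar> + 2 * \<bar>cutoff e 1 t\<bar>)
       + C * (\<bar>cutoff e 2 x\<bar> + 2 * \<bar>cutoff e 1 x\<bar>))"
      unfolding abs_mult zz by (intro mult_left_mono E) auto
    also have "\<dots> \<le> B * indicat_real {e..2*e} t + B * indicat_real {e..2*e} x"
      using key[of t "y z"] key[of x "y z"] y1[of x t] y2[of x t] z zz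
      by (simp only: distrib_left) (intro add_mono; blast)
    finally show "\<bar>y z * E z\<bar> \<le> B * indicat_real {e..2*e} (snd z) + B * indicat_real {e..2*e} (fst z)"
      by (simp add: zz)
  qed
  also have "\<dots> = B * (LBINT z:rect l T. indicat_real {e..2*e} (snd z))
      + B * (LBINT z:rect l T. indicat_real {e..2*e} (fst z))"
    using ind by (subst set_integral_add(2)) (auto intro: set_integrable_mult_right)
  also have "\<dots> \<le> B * (e * l) + B * (e * T)"
    using strip_integral[of e "2*e" l T] e \<open>0 \<le> l\<close> \<open>0 \<le> T\<close> B0
    by (intro add_mono mult_left_mono) auto
  also have "\<dots> = \<eta> * (C * (2 * C2 + 4 * C1)) * (T + l)"
    using e by (simp add: B_def field_simps)
  finally show ?thesis .
qed

lemma set_integral_dominated_convergence_rect: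
  fixes f :: "real \<times> real \<Rightarrow> real"
  assumes "set_integrable lborel (rect l T) f" "\<And>n. s n \<in> borel_measurable borel"
    "\<And>n z. \<bar>s n z\<bar> \<le> 1" "\<And>z. z \<in> rect l T \<Longrightarrow> (\<lambda>n. s n z) \<longlonglongrightarrow> s' z"
    "s' \<in> borel_measurable borel"
  shows "(\<lambda>n. LBINT z:rect l T. f z * s n z) \<longlonglongrightarrow> (LBINT z:rect l T. f z * s' z)"
  unfolding set_lebesgue_integral_def
proof (rule integral_dominated_convergence)
  have f: "(\<lambda>z. indicat_real (rect l T) z *\<^sub>R f z) \<in> borel_measurable borel"
    using assms(1) by (auto simp: set_integrable_def dest: borel_measurable_integrable)
  have "(\<lambda>z. indicat_real (rect l T) z *\<^sub>R (f z * s' z)) = (\<lambda>z. (indicat_real (rect l T) z *\<^sub>R f z) * s' z)"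
    "\<And>n. (\<lambda>z. indicat_real (rect l T) z *\<^sub>R (f z * s n z)) = (\<lambda>z. (indicat_real (rect l T) z *\<^sub>R f z) * s n z)"
    by (auto simp: mult.assoc)
  then show "(\<lambda>z. indicat_real (rect l T) z *\<^sub>R (f z * s' z)) \<in> borel_measurable lborel"
    "\<And>n. (\<lambda>z. indicat_real (rect l T) z *\<^sub>R (f z * s n z)) \<in> borel_measurable lborel"
    using f assms(2,5) by simp_all
  show "integrable lborel (\<lambda>z. \<bar>indicat_real (rect l T) z *\<^sub>R f z\<bar>)"
    using assms(1) by (simp add: set_integrable_def)
  show "AE z in lborel. (\<lambda>n. indicat_real (rect l T) z *\<^sub>R (f z * s n z)) \<longlonglongrightarrow> indicat_real (rect l T) z *\<^sub>R (f z * s' z)"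
    using assms(4) by (auto intro!: AE_I2 tendsto_intros simp: indicator_def)
  show "AE z in lborel. norm (indicat_real (rect l T) z *\<^sub>R (f z * s n z)) \<le> \<bar>indicat_real (rect l T) z *\<^sub>R f z\<bar>" for n
    using assms(3) by (auto simp: abs_mult indicator_def intro!: mult_left_le)
qed

text \<open>Removing the cutoffs at \<open>x = 0\<close> and \<open>t = 0\<close> costs nothing, as \<open>y = o(x)\<close> and \<open>y = o(t)\<close> there:
  the extension of \<open>y\<close> by zero still solves the wave equation.\<close>

lemma weak_wave_characteristic:
  assumes "0 < l" "0 < T" "0 < d"
    and cont: "continuous_on (crect l T) y"
    and G: "set_integrable lborel (rect l T) G"
    and wave: "weak_wave l T y G"
    and y1: "\<And>\<eta>. \<eta> > 0 \<Longrightarrow> \<exists>\<delta>>0. \<forall>(x, t) \<in> rect l T. x \<le> \<delta> \<longrightarrow> \<bar>y (x, t)\<bar> \<le> \<eta> * x"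
    and y2: "\<And>\<eta>. \<eta> > 0 \<Longrightarrow> \<exists>\<delta>>0. \<forall>(x, t) \<in> rect l T. t \<le> \<delta> \<longrightarrow> \<bar>y (x, t)\<bar> \<le> \<eta> * t"
    and ab: "a \<le> T" "a - b \<le> 2 * l"
  shows "4 * (LBINT z:rect l T. y z * (cutoff d 1 (a - (fst z + snd z)) * cutoff d 1 (snd z - fst z - b)))
    = (LBINT z:rect l T. G z * (cutoff d 0 (a - (fst z + snd z)) * cutoff d 0 (snd z - fst z - b)))"
proof -
  \<comment> \<open>The sign \<open>(-1) ^ n\<close> comes from the argument \<open>a - z\<close>;
    in the end it turns \<open>4 y f' g'\<close> into minus four times \<open>y\<close> and a
    product of nonnegative kernels.\<close>
  define f where "f n z = (-1) ^ n * cutoff d n (a - z)" for n z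
  define g where "g n z = cutoff d n (z - b)" for n z
  have smooth: "smooth1 f" "smooth1 g"
    using smooth1_affine[OF smooth1_cutoff, of "-1" d a] smooth1_affine[OF smooth1_cutoff, of 1 d "-b"]
    by (simp_all add: f_def[abs_def] g_def[abs_def])
  define A0 where "A0 z = f 0 (fst z + snd z) * g 0 (snd z - fst z)" for z
  define A1 where "A1 z = f 1 (fst z + snd z) * g 1 (snd z - fst z)" for z
  define B1 where "B1 z = f 1 (fst z + snd z) * g 0 (snd z - fst z)" for z
  define B2 where "B2 z = f 0 (fst z + snd z) * g 1 (snd z - fst z)" for z
  have contA: "continuous_on UNIV A0" "continuous_on UNIV A1" "continuous_on UNIV B1" "continuous_on UNIV B2"
    unfolding A0_def[abs_def] A1_def[abs_def] B1_def[abs_def] B2_def[abs_def] f_def g_def by (intro continuous_intros)+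
  obtain C1 C2 where C: "C1 > 0" "\<And>e z. e > 0 \<Longrightarrow> \<bar>cutoff e 1 z\<bar> \<le> C1 / e"
    "C2 > 0" "\<And>e z. e > 0 \<Longrightarrow> \<bar>cutoff e 2 z\<bar> \<le> C2 / e ^ 2"
    using cutoff_bounded[of 1] cutoff_bounded[of 2] by auto
  have A0_bd: "\<bar>A0 z\<bar> \<le> 1" for z
    using mult_mono[OF cutoff_mem(3) cutoff_mem(3)] unfolding A0_def f_def g_def by (simp add: abs_mult)
  have B_bd: "\<bar>B1 z\<bar> \<le> C1 / d" "\<bar>B2 z\<bar> \<le> C1 / d" for z
    using mult_mono[OF C(2)[OF \<open>0 < d\<close>] cutoff_mem(3)] mult_mono[OF cutoff_mem(3) C(2)[OF \<open>0 < d\<close>]] \<open>0 < d\<close> \<open>C1 > 0\<close>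
    unfolding B1_def B2_def f_def g_def by (simp_all add: abs_mult)
  define CA where "CA = 1 + 2 * C1 / d"
  have CA: "CA \<ge> 0" using \<open>0 < d\<close> C by (simp add: CA_def)
  define c where "c e z = cutoff e 0 (fst z) * cutoff e 0 (snd z)" for e and z :: "real \<times> real"
  \<comment> \<open>All terms in which a derivative falls on one of the boundary cutoffs at scale
    \<open>e\<close>.\<close>
  define E where "E e z = cutoff e 0 (fst z) * (cutoff e 2 (snd z) * A0 z + 2 * cutoff e 1 (snd z) * (B1 z + B2 z))
    - cutoff e 0 (snd z) * (cutoff e 2 (fst z) * A0 z + 2 * cutoff e 1 (fst z) * (B1 z - B2 z))" for e z
  have contE: "continuous_on UNIV (E e)" for e
    unfolding E_def[abs_def] by (intro continuous_intros contA)
  have contc: "continuous_on A (c e)" for e A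
    unfolding c_def[abs_def] by (intro continuous_intros)
  have id: "(LBINT z:rect l T. 4 * y z * A1 z * c e z) + (LBINT z:rect l T. y z * E e z)
      = - (LBINT z:rect l T. G z * A0 z * c e z)" if "e > 0" for e
  proof -
    from ex_product_family[OF smooth1_cutoff smooth1_cutoff smooth, of e e]
    obtain D where D: "smooth_family D"
      and D0: "\<And>x t. D 0 0 (x, t) = cutoff e 0 x * cutoff e 0 t * f 0 (x + t) * g 0 (t - x)"
      and D2: "\<And>x t. D 2 0 (x, t) - D 0 2 (x, t) = 4 * cutoff e 0 x * cutoff e 0 t * f 1 (x + t) * g 1 (t - x)
       + cutoff e 0 x * (cutoff e 2 t * f 0 (x + t) * g 0 (t - x)
           + 2 * cutoff e 1 t * (f 1 (x + t) * g 0 (t - x) + f 0 (x + t) * g 1 (t - x)))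
       - cutoff e 0 t * (cutoff e 2 x * f 0 (x + t) * g 0 (t - x)
           + 2 * cutoff e 1 x * (f 1 (x + t) * g 0 (t - x) - f 0 (x + t) * g 1 (t - x)))"
      by blast
    have D0': "D 0 0 z = A0 z * c e z" for z
      using D0[of "fst z" "snd z"] by (simp add: A0_def c_def)
    have D2': "D 2 0 z - D 0 2 z = 4 * A1 z * c e z + E e z" for z
      using D2[of "fst z" "snd z"] by (simp add: A0_def A1_def B1_def B2_def c_def E_def algebra_simps)
    have "test_fun l T D"
    \<comment> \<open>From \<open>x + t < a - d\<close> and \<open>t - x > b + d\<close> follow
      \<open>x < (a - b) / 2 - d < l\<close> and, with \<open>x > e\<close>, also
      \<open>t < a - d - e < T\<close>: the characteristic cutoffs keep the support away from
      \<open>x = l\<close> and \<open>t = T\<close>.\<close>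
    proof (rule test_funI[OF D, of "{e..(a - b) / 2 - d} \<times> {e..a - d - e}"])
      show "{e..(a - b) / 2 - d} \<times> {e..a - d - e} \<subseteq> rect l T"
        using that ab \<open>0 < d\<close> by (auto simp: rect_def field_simps)
      fix z assume "D 0 0 z \<noteq> 0"
      then have "cutoff e 0 (fst z) \<noteq> 0" "cutoff e 0 (snd z) \<noteq> 0"
        "cutoff d 0 (a - (fst z + snd z)) \<noteq> 0" "cutoff d 0 (snd z - fst z - b) \<noteq> 0"
        by (auto simp: D0' c_def A0_def f_def g_def)
      then have "fst z > e" "snd z > e" "a - (fst z + snd z) > d" "snd z - fst z - b > d"
        using cutoff_left that \<open>0 < d\<close> by (meson not_le)+
      then show "z \<in> {e..(a - b) / 2 - d} \<times> {e..a - d - e}"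
        by (auto simp: mem_Times_iff field_simps)
    qed (auto intro: compact_Times)
    then have "(LBINT z:rect l T. y z * (4 * A1 z * c e z + E e z)) = - (LBINT z:rect l T. G z * (A0 z * c e z))"
      using wave[unfolded weak_wave_def, rule_format, of D] unfolding D0' D2' by simp
    moreover have "(LBINT z:rect l T. y z * (4 * A1 z * c e z + E e z)) =
        (LBINT z:rect l T. 4 * y z * A1 z * c e z) + (LBINT z:rect l T. y z * E e z)"
    proof -
      have "(\<lambda>z. y z * (4 * A1 z * c e z + E e z)) = (\<lambda>z. 4 * y z * A1 z * c e z + y z * E e z)"
        by (simp add: algebra_simps)
      moreover have "set_integrable lborel (rect l T) (\<lambda>z. 4 * y z * A1 z * c e z)"
        "set_integrable lborel (rect l T) (\<lambda>z. y z * E e z)"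
        by (intro set_integrable_rect_continuous continuous_intros cont contc
          continuous_on_subset[OF contE] continuous_on_subset[OF contA(2)]; simp)+
      ultimately show ?thesis by simp
    qed
    ultimately show ?thesis by (simp add: mult.assoc)
  qed
  define e where "e n = 1 / real (Suc n)" for n
  have e: "\<And>n. e n > 0" "e \<longlonglongrightarrow> 0" "\<And>n. e n \<le> 1"
    using LIMSEQ_Suc[OF lim_1_over_n] by (simp_all add: e_def[abs_def])
  have cl: "(\<lambda>n. c (e n) z) \<longlonglongrightarrow> 1" if "z \<in> rect l T" for z
    using tendsto_mult[OF cutoff_tendsto[OF e(1,2), of "fst z"] cutoff_tendsto[OF e(1,2), of "snd z"]] that
    unfolding c_def by (auto simp: rect_def)
  have c1: "\<bar>c e z\<bar> \<le> 1" for e z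
    using mult_mono[OF cutoff_mem(3) cutoff_mem(3)] unfolding c_def by (simp add: abs_mult)
  have cm: "c e \<in> borel_measurable borel" for e
    by (intro borel_measurable_continuous_onI contc)
  have L1: "(\<lambda>n. LBINT z:rect l T. 4 * y z * A1 z * c (e n) z) \<longlonglongrightarrow> (LBINT z:rect l T. 4 * y z * A1 z * 1)"
    by (intro set_integral_dominated_convergence_rect cm c1 cl set_integrable_rect_continuous continuous_intros cont
       continuous_on_subset[OF contA(2)]) auto
  have L2: "(\<lambda>n. LBINT z:rect l T. G z * A0 z * c (e n) z) \<longlonglongrightarrow> (LBINT z:rect l T. G z * A0 z * 1)"
    by (intro set_integral_dominated_convergence_rect cm c1 cl set_integrable_rect_times[OF G _ A0_bd]
      borel_measurable_continuous_onI contA) auto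
  have L3: "(\<lambda>n. LBINT z:rect l T. y z * E (e n) z) \<longlonglongrightarrow> 0"
  proof (rule LIMSEQ_I)
    fix \<epsilon> :: real assume "\<epsilon> > 0"
    \<comment> \<open>The summand 1 makes \<open>K\<close> positive and the final comparison with
      \<open>\<epsilon>\<close> strict.\<close>
    define K where "K = (CA * (2 * C2 + 4 * C1)) * (T + l) + 1"
    have K: "K > 0" using CA C \<open>0 < l\<close> \<open>0 < T\<close> unfolding K_def by (intro add_nonneg_pos mult_nonneg_nonneg) auto
    define \<eta> where "\<eta> = \<epsilon> / K"
    have \<eta>: "\<eta> > 0" using \<open>\<epsilon> > 0\<close> K by (simp add: \<eta>_def)
    from y1[OF \<eta>] y2[OF \<eta>] obtain d1 d2 where d: "d1 > 0" "d2 > 0"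
      "\<And>x t. (x, t) \<in> rect l T \<Longrightarrow> x \<le> d1 \<Longrightarrow> \<bar>y (x, t)\<bar> \<le> \<eta> * x"
      "\<And>x t. (x, t) \<in> rect l T \<Longrightarrow> t \<le> d2 \<Longrightarrow> \<bar>y (x, t)\<bar> \<le> \<eta> * t"
      by fast
    have "eventually (\<lambda>n. e n < min d1 d2 / 2) sequentially"
      using d by (intro order_tendstoD(2)[OF e(2)]) simp
    then obtain n0 where n0: "\<And>n. n \<ge> n0 \<Longrightarrow> e n < min d1 d2 / 2"
      by (auto simp: eventually_sequentially)
    have "\<bar>LBINT z:rect l T. y z * E (e n) z\<bar> < \<epsilon>" if "n \<ge> n0" for n
    proof -
      have "\<bar>LBINT z:rect l T. y z * E (e n) z\<bar> \<le> \<eta> * (CA * (2 * C2 + 4 * C1)) * (T + l)"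
      proof (rule cutoff_error[OF e(1) e(3) _ _ _ cont contE])
        fix x t
        have 1: "\<bar>p * (q * A0 (x, t) + 2 * r * s)\<bar> \<le> CA * (\<bar>q\<bar> + 2 * \<bar>r\<bar>)"
          if "\<bar>p\<bar> \<le> 1" "\<bar>s\<bar> \<le> CA" for p q r s
        proof -
          have "\<bar>A0 (x, t)\<bar> \<le> CA" using A0_bd[of "(x, t)"] \<open>0 < d\<close> C by (simp add: CA_def add_increasing2)
          then have "\<bar>q * A0 (x, t) + 2 * r * s\<bar> \<le> \<bar>q\<bar> * CA + 2 * \<bar>r\<bar> * CA"
            using that by (intro order_trans[OF abs_triangle_ineq] add_mono) (auto simp: abs_mult intro!: mult_mono)
          moreover have "\<bar>p * (q * A0 (x, t) + 2 * r * s)\<bar> \<le> 1 * \<bar>q * A0 (x, t) + 2 * r * s\<bar>"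
            unfolding abs_mult[of p] by (rule mult_right_mono[OF that(1) abs_ge_zero])
          ultimately show ?thesis by (simp add: algebra_simps)
        qed
        have 2: "\<bar>B1 (x, t) + B2 (x, t)\<bar> \<le> CA" "\<bar>B1 (x, t) - B2 (x, t)\<bar> \<le> CA"
          using B_bd[of "(x, t)"] unfolding CA_def by (simp_all add: abs_le_iff)
        show "\<bar>E (e n) (x, t)\<bar> \<le> CA * (\<bar>cutoff (e n) 2 t\<bar> + 2 * \<bar>cutoff (e n) 1 t\<bar>)
           + CA * (\<bar>cutoff (e n) 2 x\<bar> + 2 * \<bar>cutoff (e n) 1 x\<bar>)"
          unfolding E_def fst_conv snd_conv
          by (intro order_trans[OF abs_triangle_ineq4] add_mono 1 2 cutoff_mem)
      qed (use C e d n0[OF that] \<eta> CA \<open>0 < l\<close> \<open>0 < T\<close> in auto)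
      also have "\<dots> < \<eta> * K"
        unfolding K_def using \<eta> by (simp add: algebra_simps)
      also have "\<dots> = \<epsilon>" using K by (simp add: \<eta>_def)
      finally show ?thesis .
    qed
    then show "\<exists>n0. \<forall>n\<ge>n0. norm ((LBINT z:rect l T. y z * E (e n) z) - 0) < \<epsilon>" by auto
  qed
  have "(LBINT z:rect l T. 4 * y z * A1 z * 1) + 0 = - (LBINT z:rect l T. G z * A0 z * 1)"
    using tendsto_add[OF L1 L3] tendsto_minus[OF L2] by (simp add: id[OF e(1)] LIMSEQ_unique)
  moreover have "(\<lambda>z. 4 * y z * A1 z * 1) = (\<lambda>z. (-4) *
      (y z * (cutoff d 1 (a - (fst z + snd z)) * cutoff d 1 (snd z - fst z - b))))"
    by (simp add: A1_def f_def g_def fun_eq_iff)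
  moreover have "(\<lambda>z. G z * A0 z * 1) =
      (\<lambda>z. G z * (cutoff d 0 (a - (fst z + snd z)) * cutoff d 0 (snd z - fst z - b)))"
    by (simp add: A0_def f_def g_def fun_eq_iff)
  ultimately show ?thesis by (simp only: set_integral_mult_right)
qed

section \<open>D'Alembert's formula\<close>

lemma fst_borel [measurable]: "(fst :: real \<times> real \<Rightarrow> real) \<in> borel_measurable borel"
  and snd_borel [measurable]: "(snd :: real \<times> real \<Rightarrow> real) \<in> borel_measurable borel"
  by (intro borel_measurable_continuous_onI continuous_intros)+

lemma nn_integral_cutoff_deriv:
  assumes "d > 0"
  shows "(\<integral>\<^sup>+z. ennreal (cutoff d 1 z) \<partial>lborel) = 1"
proof -
  have "(\<integral>\<^sup>+z. ennreal (cutoff d 1 z) * indicator {d..2*d} z \<partial>lborel) = cutoff d 0 (2 * d) - cutoff d 0 d"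
    using assms cutoff_deriv_nonneg smooth1D[OF smooth1_cutoff, of d 0]
    by (intro nn_integral_FTC_Icc) (auto intro: DERIV_subset)
  moreover have "ennreal (cutoff d 1 z) * indicator {d..2*d} z = ennreal (cutoff d 1 z)" for z
    using cutoff_deriv_0[OF assms, of z 0] by (auto simp: indicator_def)
  ultimately show ?thesis using assms by (simp add: cutoff_left cutoff_right)
qed

text \<open>An approximate identity in characteristic coordinates: for small \<open>d\<close> it
  concentrates at the point where \<open>x + t = a\<close> and \<open>t - x = b\<close>. As the
  factor of \<open>y\<close> in \<open>weak_wave_characteristic\<close> it recovers the value of
  \<open>y\<close> at that point.\<close>

definition char_kernel :: "real \<Rightarrow> real \<Rightarrow> real \<Rightarrow> real \<times> real \<Rightarrow> real" where
  "char_kernel d a b z = cutoff d 1 (a - (fst z + snd z)) * cutoff d 1 (snd z - fst z - b)"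

lemma kernel_nonneg: "d > 0 \<Longrightarrow> char_kernel d a b z \<ge> 0"
  unfolding char_kernel_def by (intro mult_nonneg_nonneg cutoff_deriv_nonneg)

lemma kernel_support:
  assumes "d > 0" "char_kernel d a b (x, t) \<noteq> 0"
  shows "a - 2 * d < x + t" "x + t < a - d" "b + d < t - x" "t - x < b + 2 * d"
proof -
  have "d < a - (x + t) \<and> a - (x + t) < 2 * d \<and> d < t - x - b \<and> t - x - b < 2 * d"
    using assms cutoff_deriv_0[OF assms(1), of "a - (x + t)" 0] cutoff_deriv_0[OF assms(1), of "t - x - b" 0]
    by (fastforce simp: char_kernel_def)
  then show "a - 2 * d < x + t" "x + t < a - d" "b + d < t - x" "t - x < b + 2 * d" by auto
qed

lemma continuous_on_kernel: "continuous_on A (char_kernel d a b)"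
  unfolding char_kernel_def[abs_def] by (intro continuous_intros)

text \<open>The mass is 1/2 because \<open>(x, t) \<mapsto> (x + t, t - x)\<close> has Jacobian 2.
  The substitution is split into the shear of \<open>t\<close> by \<open>x\<close> and, after
  swapping the integrals, the affine map \<open>x \<mapsto> a - t - 2 x\<close>.\<close>

lemma nn_integral_kernel:
  assumes "d > 0"
  shows "(\<integral>\<^sup>+z. ennreal (char_kernel d a b z) \<partial>lborel) = ennreal (1/2)"
proof -
  define k where "k z = ennreal (cutoff d 1 z)" for z
  have k [measurable]: "k \<in> borel_measurable borel" unfolding k_def by measurable
  have "(\<integral>\<^sup>+z. ennreal (char_kernel d a b z) \<partial>lborel) = (\<integral>\<^sup>+z. k (a - (fst z + snd z)) * k (snd z - fst z - b) \<partial>(lborel \<Otimes>\<^sub>M lborel))"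
    unfolding lborel_prod char_kernel_def k_def using cutoff_deriv_nonneg[OF assms] by (simp add: ennreal_mult)
  also have "\<dots> = (\<integral>\<^sup>+x. \<integral>\<^sup>+t. k (a - (x + t)) * k (t - x - b) \<partial>lborel \<partial>lborel)"
    by (subst lborel.nn_integral_fst[symmetric]) auto
  also have "\<dots> = (\<integral>\<^sup>+x. \<integral>\<^sup>+t. k (a - (x + (x + t))) * k (t - b) \<partial>lborel \<partial>lborel)"
  proof (rule nn_integral_cong)
    fix x
    show "(\<integral>\<^sup>+t. k (a - (x + t)) * k (t - x - b) \<partial>lborel) = (\<integral>\<^sup>+t. k (a - (x + (x + t))) * k (t - b) \<partial>lborel)"
      by (subst nn_integral_real_affine[where c = 1 and t = x]) (auto simp: algebra_simps)
  qed
  also have "\<dots> = (\<integral>\<^sup>+t. \<integral>\<^sup>+x. k (a - (x + (x + t))) * k (t - b) \<partial>lborel \<partial>lborel)"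
    by (rule lborel_pair.Fubini'[symmetric]) measurable
  also have "\<dots> = (\<integral>\<^sup>+t. ennreal (1/2) * k (t - b) \<partial>lborel)"
  proof (rule nn_integral_cong)
    fix t
    have "(\<integral>\<^sup>+x. k (a - (x + (x + t))) * k (t - b) \<partial>lborel) = (\<integral>\<^sup>+x. k (a - (x + (x + t))) \<partial>lborel) * k (t - b)"
      by (rule nn_integral_multc) measurable
    moreover have "(\<integral>\<^sup>+x. k (a - (x + (x + t))) \<partial>lborel) = ennreal (1/2)"
    proof -
      have "1 = (\<integral>\<^sup>+x. k x \<partial>lborel)" using nn_integral_cutoff_deriv[OF assms] by (simp add: k_def)
      also have "\<dots> = ennreal 2 * (\<integral>\<^sup>+x. k (a - t + (-2) * x) \<partial>lborel)"
        by (subst nn_integral_real_affine[where c = "-2" and t = "a - t"]) auto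
      also have "(\<lambda>x. k (a - t + (-2) * x)) = (\<lambda>x. k (a - (x + (x + t))))"
        by (simp add: algebra_simps)
      finally have *: "1 = ennreal 2 * (\<integral>\<^sup>+x. k (a - (x + (x + t))) \<partial>lborel)" .
      have "ennreal (1/2) = ennreal (1/2) * (ennreal 2 * (\<integral>\<^sup>+x. k (a - (x + (x + t))) \<partial>lborel))"
        by (subst *[symmetric]) simp
      also have "\<dots> = (\<integral>\<^sup>+x. k (a - (x + (x + t))) \<partial>lborel)"
        by (subst mult.assoc[symmetric], subst ennreal_mult[symmetric]) auto
      finally show ?thesis ..
    qed
    ultimately show "(\<integral>\<^sup>+x. k (a - (x + (x + t))) * k (t - b) \<partial>lborel) = ennreal (1/2) * k (t - b)" by simp
  qed
  also have "\<dots> = ennreal (1/2) * (\<integral>\<^sup>+t. k (t - b) \<partial>lborel)"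
    by (rule nn_integral_cmult) measurable
  also have "(\<integral>\<^sup>+t. k (t - b) \<partial>lborel) = (\<integral>\<^sup>+t. k t \<partial>lborel)"
    by (subst nn_integral_real_affine[where c = 1 and t = b]) auto
  also have "\<dots> = 1" using nn_integral_cutoff_deriv[OF assms] by (simp add: k_def)
  finally show ?thesis by simp
qed

lemma kernel_integral:
  assumes "d > 0"
  shows "integrable lborel (char_kernel d a b)" "integral\<^sup>L lborel (char_kernel d a b) = 1/2"
proof -
  have m: "char_kernel d a b \<in> borel_measurable lborel"
    using borel_measurable_continuous_onI[OF continuous_on_kernel] by simp
  show "integrable lborel (char_kernel d a b)"
    using kernel_nonneg[OF assms] nn_integral_kernel[OF assms] m
    by (intro integrableI_bounded) (simp_all only: real_norm_def abs_of_nonneg ennreal_less_top infinity_ennreal_def)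
  show "integral\<^sup>L lborel (char_kernel d a b) = 1/2"
    using kernel_nonneg[OF assms]
    by (subst integral_eq_nn_integral[OF m AE_I2], simp, subst nn_integral_kernel[OF assms])
      (rule enn2real_ennreal, simp)
qed

text \<open>The supports may leave the rectangle when \<open>y z0 = 0\<close>, since the mass lost
  then does not affect the limit. This admits points on \<open>t = 0\<close>, near which the kernel
  spreads to negative times.\<close>

lemma approximate_identity:
  fixes y :: "real \<times> real \<Rightarrow> real" and k :: "nat \<Rightarrow> real \<times> real \<Rightarrow> real"
  assumes cont: "continuous_on (crect l T) y" and z0: "z0 \<in> crect l T"
    and k0: "\<And>n z. k n z \<ge> 0" and k_cont: "\<And>n. continuous_on UNIV (k n)"
    and k_int: "\<And>n. integrable lborel (k n)" "\<And>n. integral\<^sup>L lborel (k n) = I"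
    and supp: "\<And>\<delta>. \<delta> > 0 \<Longrightarrow> \<forall>\<^sub>F n in sequentially. \<forall>z. k n z \<noteq> 0 \<longrightarrow> dist z z0 < \<delta> \<and> (y z0 \<noteq> 0 \<longrightarrow> z \<in> rect l T)"
  shows "(\<lambda>n. LBINT z:rect l T. y z * k n z) \<longlonglongrightarrow> I * y z0"
proof (rule LIMSEQ_I)
  fix \<epsilon> :: real assume \<epsilon>: "\<epsilon> > 0"
  have I0: "I \<ge> 0" using integral_nonneg_AE[of "k 0" lborel] k0 k_int(2)[of 0] by simp
  define \<epsilon>' where "\<epsilon>' = \<epsilon> / (I + 1)"
  have \<epsilon>': "\<epsilon>' > 0" "\<epsilon>' * I < \<epsilon>"
  proof -
    show "\<epsilon>' > 0" using \<epsilon> I0 by (simp add: \<epsilon>'_def)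
    then have "\<epsilon>' * I < \<epsilon>' * (I + 1)" by simp
    also have "\<dots> = \<epsilon>" using I0 by (simp add: \<epsilon>'_def)
    finally show "\<epsilon>' * I < \<epsilon>" .
  qed
  obtain \<delta> where \<delta>: "\<delta> > 0" "\<And>z. z \<in> crect l T \<Longrightarrow> dist z z0 < \<delta> \<Longrightarrow> dist (y z) (y z0) < \<epsilon>'"
    using cont z0 \<epsilon>' unfolding continuous_on_iff by metis
  obtain n0 where n0: "\<And>n z. n \<ge> n0 \<Longrightarrow> k n z \<noteq> 0 \<Longrightarrow> dist z z0 < \<delta> \<and> (y z0 \<noteq> 0 \<longrightarrow> z \<in> rect l T)"
    using supp[OF \<delta>(1)] unfolding eventually_sequentially by blast
  have "\<bar>(LBINT z:rect l T. y z * k n z) - I * y z0\<bar> < \<epsilon>" if n: "n \<ge> n0" for n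
  proof -
    have kint: "set_integrable lborel (rect l T) (k n)"
      by (intro set_integrable_rect_continuous continuous_on_subset[OF k_cont]) auto
    have yint: "set_integrable lborel (rect l T) (\<lambda>z. y z * k n z)"
      by (intro set_integrable_rect_continuous continuous_intros cont continuous_on_subset[OF k_cont]) auto
    have kle: "(LBINT z:rect l T. k n z) \<le> I"
    proof -
      have "(LBINT z:rect l T. k n z) \<le> integral\<^sup>L lborel (k n)"
        unfolding set_lebesgue_integral_def
        using kint k_int(1) k0 by (intro integral_mono) (auto simp: set_integrable_def indicator_def)
      then show ?thesis using k_int(2) by simp
    qed
    have keq: "y z0 * (LBINT z:rect l T. k n z) = y z0 * I"
    proof (cases "y z0 = 0")
      case False
      have "(LBINT z:rect l T. k n z) = integral\<^sup>L lborel (k n)"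
        unfolding set_lebesgue_integral_def using n0[OF n] False
        by (intro Bochner_Integration.integral_cong) (auto simp: indicator_def)
      then show ?thesis using k_int(2) by simp
    qed simp
    have dint: "set_integrable lborel (rect l T) (\<lambda>z. y z * k n z - y z0 * k n z)"
      using yint kint by (intro set_integral_diff(1) set_integrable_mult_right) auto
    have diff: "(LBINT z:rect l T. y z * k n z) - I * y z0 = (LBINT z:rect l T. y z * k n z - y z0 * k n z)"
      using yint kint keq by (subst set_integral_diff(2)) (auto intro: set_integrable_mult_right)
    have "\<bar>(LBINT z:rect l T. y z * k n z) - I * y z0\<bar> \<le> (LBINT z:rect l T. \<bar>y z * k n z - y z0 * k n z\<bar>)"
      unfolding diff using set_integral_norm_bound[OF dint] by simp
    also have "\<dots> \<le> (LBINT z:rect l T. \<epsilon>' * k n z)"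
    proof (rule set_integral_mono)
      show "set_integrable lborel (rect l T) (\<lambda>z. \<bar>y z * k n z - y z0 * k n z\<bar>)" using set_integrable_abs[OF dint] .
      show "set_integrable lborel (rect l T) (\<lambda>z. \<epsilon>' * k n z)" using kint by (intro set_integrable_mult_right) auto
      fix z assume z: "z \<in> rect l T"
      have "\<bar>y z - y z0\<bar> * k n z \<le> \<epsilon>' * k n z"
      proof (cases "k n z = 0")
        case False
        then have "\<bar>y z - y z0\<bar> < \<epsilon>'"
          using \<delta>(2)[of z] n0[OF n False] z rect_subset_closed by (auto simp: dist_real_def)
        then show ?thesis using k0 by (intro mult_right_mono) auto
      qed simp
      then show "\<bar>y z * k n z - y z0 * k n z\<bar> \<le> \<epsilon>' * k n z"
        using k0[of n z] by (simp add: left_diff_distrib[symmetric] abs_mult)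
    qed
    also have "\<dots> \<le> \<epsilon>' * I" using kle \<epsilon>' by simp
    also have "\<dots> < \<epsilon>" by (rule \<epsilon>')
    finally show ?thesis .
  qed
  then show "\<exists>n0. \<forall>n\<ge>n0. norm ((LBINT z:rect l T. y z * k n z) - I * y z0) < \<epsilon>"
    by auto
qed

lemma dist_Pair_le: "dist (x, t) (x', t' :: real) \<le> \<bar>x - x'\<bar> + \<bar>t - t'\<bar>" for x x' :: real
  using sqrt_sum_squares_le_sum_abs[of "x - x'" "t - t'"] by (simp add: dist_Pair_Pair dist_real_def)

lemma kernel_limit:
  assumes cont: "continuous_on (crect l T) y"
    and X: "0 < X" "X \<le> l" and t0: "0 \<le> t0" "X + t0 \<le> T"
    and init: "t0 = 0 \<Longrightarrow> y (X, t0) = 0"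
    and e: "\<And>n. e n > 0" "e \<longlonglongrightarrow> 0"
  shows "(\<lambda>n. LBINT z:rect l T. y z * char_kernel (e n) (X + t0) (t0 - X) z) \<longlonglongrightarrow> 1 / 2 * y (X, t0)"
proof (rule approximate_identity[OF cont])
  fix \<delta> :: real assume \<delta>: "\<delta> > 0"
  \<comment> \<open>At scale \<open>d\<close> the support satisfies
    \<open>X - 2 d < x < X - d\<close> and \<open>|t - t0| < d / 2\<close>. So \<open>d < m\<close>
    keeps it within \<open>\<delta>\<close> of the apex and, if \<open>t0 > 0\<close>, inside the
    rectangle.\<close>
  define m where "m = Min {\<delta> / 3, X / 2, (if t0 = 0 then 1 else t0)}"
  have m: "m > 0" "3 * m \<le> \<delta>" "2 * m \<le> X" "t0 \<noteq> 0 \<Longrightarrow> m \<le> t0"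
    using \<delta> X t0 by (auto simp: m_def)
  show "\<forall>\<^sub>F n in sequentially. \<forall>z. char_kernel (e n) (X + t0) (t0 - X) z \<noteq> 0 \<longrightarrow>
      dist z (X, t0) < \<delta> \<and> (y (X, t0) \<noteq> 0 \<longrightarrow> z \<in> rect l T)"
    using order_tendstoD(2)[OF e(2) m(1)]
  proof eventually_elim
    case (elim n)
    have d: "0 < e n" "e n < m" using e elim by auto
    show ?case
    proof (intro allI impI)
      fix z assume k0: "char_kernel (e n) (X + t0) (t0 - X) z \<noteq> 0"
      obtain x t where z: "z = (x, t)" by force
      note b = kernel_support[OF d(1), of "X + t0" "t0 - X" x t, OF k0[unfolded z]]
      have "dist z (X, t0) \<le> \<bar>x - X\<bar> + \<bar>t - t0\<bar>" unfolding z by (rule dist_Pair_le)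
      also have "\<dots> < \<delta>" using b m d by (simp add: abs_if)
      finally have "dist z (X, t0) < \<delta>" .
      moreover have "z \<in> rect l T" if "t0 \<noteq> 0"
        using b m(1,3) m(4)[OF that] d X t0 by (auto simp: z rect_def)
      ultimately show "dist z (X, t0) < \<delta> \<and> (y (X, t0) \<noteq> 0 \<longrightarrow> z \<in> rect l T)" using init by auto
    qed
  qed
qed (use X t0 e in \<open>auto intro: kernel_nonneg continuous_on_kernel kernel_integral(1)
    simp del: One_nat_def simp: kernel_integral(2)\<close>)

text \<open>The set \<open>|\<tau> - t| < X - x\<close> of points \<open>(x, \<tau>)\<close>: the
  past of \<open>(X, t)\<close> when \<open>x\<close> plays the role of time, opening towards
  \<open>x = 0\<close>.\<close>

definition cone :: "real \<Rightarrow> real \<Rightarrow> (real \<times> real) set" where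
  "cone X t = {z. fst z + snd z < X + t \<and> t - X < snd z - fst z}"

lemma cone_borel [measurable]: "cone X t \<in> sets borel"
  unfolding cone_def by (intro borel_open open_Collect_conj open_Collect_less continuous_intros)

text \<open>As the scale of the characteristic cutoffs tends to 0, their product becomes the
  indicator of the cone and the product of their derivatives an approximate identity of mass 1/2;
  with the factor 4 this leaves \<open>2 * y (X, t)\<close>.\<close>

lemma dAlembert:
  assumes "0 < l" "0 < T"
    and cont: "continuous_on (crect l T) y"
    and G: "set_integrable lborel (rect l T) G"
    and wave: "weak_wave l T y G"
    and y1: "\<And>\<eta>. \<eta> > 0 \<Longrightarrow> \<exists>\<delta>>0. \<forall>(x, t) \<in> rect l T. x \<le> \<delta> \<longrightarrow> \<bar>y (x, t)\<bar> \<le> \<eta> * x"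
    and y2: "\<And>\<eta>. \<eta> > 0 \<Longrightarrow> \<exists>\<delta>>0. \<forall>(x, t) \<in> rect l T. t \<le> \<delta> \<longrightarrow> \<bar>y (x, t)\<bar> \<le> \<eta> * t"
    and init: "\<And>x. x \<in> {0..l} \<Longrightarrow> y (x, 0) = 0"
    and X: "0 < X" "X \<le> l" and t: "0 \<le> t" "X + t \<le> T"
  shows "y (X, t) = (LBINT z:rect l T. G z * indicat_real (cone X t) z) / 2"
proof -
  define e where "e n = 1 / real (Suc n)" for n
  have e: "\<And>n. e n > 0" "e \<longlonglongrightarrow> 0"
    using LIMSEQ_Suc[OF lim_1_over_n] by (simp_all add: e_def[abs_def])
  define s where "s d z = cutoff d 0 (X + t - (fst z + snd z)) * cutoff d 0 (snd z - fst z - (t - X))"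
    for d and z :: "real \<times> real"
  have L1: "(\<lambda>n. LBINT z:rect l T. y z * char_kernel (e n) (X + t) (t - X) z) \<longlonglongrightarrow> 1 / 2 * y (X, t)"
    using X t init by (intro kernel_limit cont e) auto
  have L2: "(\<lambda>n. LBINT z:rect l T. G z * s (e n) z) \<longlonglongrightarrow> (LBINT z:rect l T. G z * indicat_real (cone X t) z)"
  proof (rule set_integral_dominated_convergence_rect[OF G])
    show "s (e n) \<in> borel_measurable borel" for n
      unfolding s_def[abs_def] by (intro borel_measurable_continuous_onI continuous_intros)
    show "\<bar>s (e n) z\<bar> \<le> 1" for n z
      using mult_mono[OF cutoff_mem(3) cutoff_mem(3)] unfolding s_def by (simp add: abs_mult)
    show "(\<lambda>n. s (e n) z) \<longlonglongrightarrow> indicat_real (cone X t) z" for z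
      using tendsto_mult[OF cutoff_tendsto[OF e, of "X + t - (fst z + snd z)"] cutoff_tendsto[OF e, of "snd z - fst z - (t - X)"]]
      unfolding s_def by (auto simp: cone_def indicator_def split: if_splits)
  qed measurable
  have eq: "(LBINT z:rect l T. G z * s (e n) z) = 4 * (LBINT z:rect l T. y z * char_kernel (e n) (X + t) (t - X) z)" for n
    unfolding s_def char_kernel_def
    by (rule weak_wave_characteristic[symmetric, OF assms(1,2) e(1) cont G wave y1 y2]) (use X t in auto)
  have "(LBINT z:rect l T. G z * indicat_real (cone X t) z) = 4 * (1 / 2 * y (X, t))"
    using LIMSEQ_unique[OF L2] tendsto_mult_left[OF L1, of 4] unfolding eq by simp
  then show ?thesis by simp
qed

section \<open>Integration lemmas\<close>

text \<open>The integral of \<open>|h|\<close> is the total variation of the indefinite integral of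
  \<open>h\<close>. On a fine tagged division Henstock's lemma replaces \<open>|h x|\<close> times
  the length of \<open>k\<close> by \<open>|integral k h|\<close>, and the increments of
  \<open>V\<close> telescope. So \<open>f\<close> can be estimated without differentiating the
  integral equation that it satisfies.\<close>

lemma integral_abs_le_increments:
  fixes h V :: "real \<Rightarrow> real"
  assumes "a \<le> b" and h: "h integrable_on {a..b}" and ah: "(\<lambda>x. \<bar>h x\<bar>) integrable_on {a..b}"
    and V: "\<And>u v. a \<le> u \<Longrightarrow> u \<le> v \<Longrightarrow> v \<le> b \<Longrightarrow> \<bar>integral {u..v} h\<bar> \<le> V v - V u"
  shows "integral {a..b} (\<lambda>x. \<bar>h x\<bar>) \<le> V b - V a"
proof (rule field_le_epsilon)
  fix e :: real assume "e > 0"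
  then have e: "e / 2 > 0" by simp
  obtain g1 where g1: "gauge g1" "\<And>p. \<lbrakk>p tagged_partial_division_of (cbox a b); g1 fine p\<rbrakk> \<Longrightarrow>
      (\<Sum>(x,k)\<in>p. norm (measure lborel k *\<^sub>R h x - integral k h)) < e / 2"
    by (rule Henstock_lemma[OF h[folded box_real(2)] e]) (rule that, assumption+)
  from integrable_integral[OF ah[folded box_real(2)], unfolded has_integral, rule_format, OF e]
  obtain g2 where g2: "gauge g2 \<and> (\<forall>p. p tagged_division_of (cbox a b) \<and> g2 fine p \<longrightarrow>
      norm ((\<Sum>(x,k)\<in>p. measure lborel k *\<^sub>R \<bar>h x\<bar>) - integral (cbox a b) (\<lambda>x. \<bar>h x\<bar>)) < e / 2)"
    by (rule exE)
  obtain p where p: "p tagged_division_of (cbox a b)" "(\<lambda>x. g1 x \<inter> g2 x) fine p"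
    by (rule fine_division_exists[OF gauge_Int[OF g1(1) conjunct1[OF g2]]])
  have fin: "finite p" using p by blast
  have "integral {a..b} (\<lambda>x. \<bar>h x\<bar>) \<le> e / 2 + (\<Sum>(x,k)\<in>p. measure lborel k *\<^sub>R \<bar>h x\<bar>)"
    using conjunct2[OF g2, rule_format, of p] p unfolding fine_Int box_real(2) real_norm_def
    by (smt (verit, best))
  also have "(\<Sum>(x,k)\<in>p. measure lborel k *\<^sub>R \<bar>h x\<bar>) \<le>
      (\<Sum>(x,k)\<in>p. norm (measure lborel k *\<^sub>R h x - integral k h) + (V (Sup k) - V (Inf k)))"
  proof (rule sum_mono, clarify)
    fix x k assume xk: "(x, k) \<in> p"
    obtain u v where k: "k = cbox u v" using p(1) xk by blast
    then have k: "k = {u..v}" by simp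
    have "k \<subseteq> cbox a b" "x \<in> k" using p(1) xk by blast+
    then have uv: "u \<le> v" "a \<le> u" "v \<le> b" by (auto simp: k)
    have "measure lborel k *\<^sub>R \<bar>h x\<bar> = \<bar>measure lborel k *\<^sub>R h x\<bar>" by (simp add: abs_mult)
    also have "\<dots> \<le> \<bar>measure lborel k *\<^sub>R h x - integral k h\<bar> + \<bar>integral k h\<bar>" by simp
    also have "\<bar>integral k h\<bar> \<le> V (Sup k) - V (Inf k)"
      using V[OF uv(2,1,3)] uv by (simp add: k)
    finally show "measure lborel k *\<^sub>R \<bar>h x\<bar> \<le> norm (measure lborel k *\<^sub>R h x - integral k h) + (V (Sup k) - V (Inf k))"
      by simp
  qed
  also have "\<dots> = (\<Sum>(x,k)\<in>p. norm (measure lborel k *\<^sub>R h x - integral k h)) + (\<Sum>(x,k)\<in>p. V (Sup k) - V (Inf k))"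
    by (simp add: split_def sum.distrib)
  also have "(\<Sum>(x,k)\<in>p. V (Sup k) - V (Inf k)) = V b - V a"
    using additive_tagged_division_1[OF \<open>a \<le> b\<close>] p(1) by simp
  also have "(\<Sum>(x,k)\<in>p. norm (measure lborel k *\<^sub>R h x - integral k h)) \<le> e / 2"
    using g1(2)[of p] p by (simp add: fine_Int tagged_division_of_def less_imp_le)
  finally show "integral {a..b} (\<lambda>x. \<bar>h x\<bar>) \<le> V b - V a + e" by simp
qed

lemma bounded_borel_times_continuous:
  fixes f k :: "real \<Rightarrow> real"
  assumes "f \<in> borel_measurable borel" "\<And>x. \<bar>f x\<bar> \<le> C" "continuous_on {a..b} k"
  shows "set_integrable lborel {a..b} (\<lambda>x. f x * k x)"
proof -
  have k: "set_integrable lborel {a..b} k" by (rule borel_integrable_atLeastAtMost'[OF assms(3)])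
  have eq: "(\<lambda>x. indicat_real {a..b} x *\<^sub>R (f x * k x)) = (\<lambda>x. f x * (indicat_real {a..b} x *\<^sub>R k x))"
    by (auto simp: mult_ac)
  show ?thesis
    unfolding set_integrable_def eq
  proof (rule Bochner_Integration.integrable_bound[of _ "\<lambda>x. C * (indicat_real {a..b} x *\<^sub>R k x)"])
    show "integrable lborel (\<lambda>x. C * (indicat_real {a..b} x *\<^sub>R k x))"
      using k unfolding set_integrable_def by (intro integrable_mult_right)
    show "(\<lambda>x. f x * (indicat_real {a..b} x *\<^sub>R k x)) \<in> borel_measurable lborel"
      using k assms(1) unfolding set_integrable_def by (auto dest: borel_measurable_integrable)
    have "\<bar>f x\<bar> * \<bar>w\<bar> \<le> \<bar>C\<bar> * \<bar>w\<bar>" for x w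
      using assms(2)[of x] by (intro mult_right_mono) auto
    then have "\<bar>f x\<bar> * \<bar>indicat_real {a..b} x *\<^sub>R k x\<bar> \<le> \<bar>C\<bar> * \<bar>indicat_real {a..b} x *\<^sub>R k x\<bar>" for x .
    then show "AE x in lborel. norm (f x * (indicat_real {a..b} x *\<^sub>R k x)) \<le> norm (C * (indicat_real {a..b} x *\<^sub>R k x))"
      unfolding real_norm_def abs_mult[of "f _"] abs_mult[of C] by (rule AE_I2)
  qed
qed

lemma bounded_borel_times_continuous_integrable:
  fixes f k :: "real \<Rightarrow> real"
  assumes "f \<in> borel_measurable borel" "\<And>x. \<bar>f x\<bar> \<le> C" "continuous_on {a..b} k"
  shows "(\<lambda>x. f x * k x) integrable_on {a..b}" "(\<lambda>x. \<bar>f x\<bar> * k x) integrable_on {a..b}"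
    "(\<lambda>x. \<bar>f x * k x\<bar>) integrable_on {a..b}"
proof -
  show "(\<lambda>x. f x * k x) integrable_on {a..b}"
    using set_borel_integral_eq_integral(1)[OF bounded_borel_times_continuous[OF assms]] .
  have "(\<lambda>x. \<bar>f x\<bar>) \<in> borel_measurable borel" using assms(1) by simp
  from set_borel_integral_eq_integral(1)[OF bounded_borel_times_continuous[OF this _ assms(3)], of C]
  show "(\<lambda>x. \<bar>f x\<bar> * k x) integrable_on {a..b}" using assms(2) by simp
  show "(\<lambda>x. \<bar>f x * k x\<bar>) integrable_on {a..b}"
    using set_borel_integral_eq_integral(1)[OF set_integrable_abs[OF bounded_borel_times_continuous[OF assms]]] .
qed

lemma nonneg_integral_fst:
  fixes F :: "real \<times> real \<Rightarrow> real"
  assumes F: "F \<in> borel_measurable borel" "\<And>z. F z \<ge> 0" and k: "integrable lborel k" "\<And>x. k x \<ge> 0"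
    and inner: "\<And>x. (\<integral>\<^sup>+t. ennreal (F (x, t)) \<partial>lborel) = ennreal (k x)"
  shows "integrable lborel F" "(LBINT z. F z) = (LBINT x. k x)"
proof -
  have "(\<lambda>z. ennreal (F z)) \<in> borel_measurable (lborel \<Otimes>\<^sub>M lborel)"
    unfolding lborel_prod using F by simp
  from lborel.nn_integral_fst[OF this] have nn: "(\<integral>\<^sup>+z. ennreal (F z) \<partial>lborel) = ennreal (LBINT x. k x)"
    unfolding inner using k by (simp add: lborel_prod nn_integral_eq_integral)
  show "integrable lborel F" using F nn by (intro integrableI_nonneg) auto
  show "(LBINT z. F z) = (LBINT x. k x)"
    using F nn k by (subst integral_eq_nn_integral) (auto intro!: integral_nonneg_AE)
qed

text \<open>Fubini, integrating over the second variable first. Two cones with the same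
  \<open>X\<close> differ within two strips of this kind, with \<open>\<phi>\<close> affine of slope
  1 and -1.\<close>

lemma moving_strip_integral:
  fixes g \<phi> :: "real \<Rightarrow> real"
  assumes g: "integrable lborel g" "\<And>x. g x \<ge> 0" and \<phi>: "\<phi> \<in> borel_measurable borel" and "0 \<le> w"
  shows "integrable lborel (\<lambda>z. g (fst z) * indicat_real {\<phi> (fst z)..\<phi> (fst z) + w} (snd z))" (is "integrable lborel ?F")
    and "(LBINT z. g (fst z) * indicat_real {\<phi> (fst z)..\<phi> (fst z) + w} (snd z)) = w * (LBINT x. g x)"
proof -
  have [measurable]: "g \<in> borel_measurable borel" using g(1) by (auto dest: borel_measurable_integrable)
  have "?F = (\<lambda>z. g (fst z) * indicat_real {z. \<phi> (fst z) \<le> snd z \<and> snd z \<le> \<phi> (fst z) + w} z)"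
    by (auto simp: indicator_def)
  moreover have "\<dots> \<in> borel_measurable borel" using \<phi> by measurable
  ultimately have F: "?F \<in> borel_measurable borel" by simp
  have inner: "(\<integral>\<^sup>+t. ennreal (?F (x, t)) \<partial>lborel) = ennreal (w * g x)" for x
  proof -
    have "(\<integral>\<^sup>+t. ennreal (?F (x, t)) \<partial>lborel) = (\<integral>\<^sup>+t. ennreal (g x) * indicator {\<phi> x..\<phi> x + w} t \<partial>lborel)"
      by (intro nn_integral_cong) (auto simp: indicator_def)
    also have "\<dots> = ennreal (w * g x)"
      using \<open>0 \<le> w\<close> g(2) by (subst nn_integral_cmult_indicator) (auto simp: ennreal_mult mult.commute)
    finally show ?thesis .
  qed
  have k: "integrable lborel (\<lambda>x. w * g x)" "\<And>x. w * g x \<ge> 0" using g \<open>0 \<le> w\<close> by auto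
  have "?F z \<ge> 0" for z using g(2) by simp
  from nonneg_integral_fst[OF F this k inner]
  show "integrable lborel ?F" "(LBINT z. ?F z) = w * (LBINT x. g x)" by simp_all
qed

text \<open>The shear \<open>s = x + t\<close> has Jacobian 1. It exhibits the integral over the
  triangle as a primitive in \<open>c\<close>, ready to be differentiated.\<close>

lemma integral_characteristic_coordinates:
  assumes c: "0 < c" "c \<le> l" "c \<le> T"
    and G: "set_borel_measurable lborel (rect l T) G" and Gb: "\<And>z. z \<in> rect l T \<Longrightarrow> \<bar>G z\<bar> \<le> C"
  shows "(LBINT z:rect l T. G z * indicat_real {z. fst z + snd z < c} z) =
    (LBINT s:{0<..<c}. (LBINT x:{0<..<s}. G (x, s - x)))"
proof -
  \<comment> \<open>\<open>G\<close> is measurable on the rectangle only; \<open>H\<close>, its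
    restriction to the triangle extended by zero, is Borel on the plane, where Fubini
    applies.\<close>
  define H where "H z = indicat_real (rect l T) z * G z * indicat_real {z. fst z + snd z < c} z" for z
  have set: "{z :: real \<times> real. fst z + snd z < c} \<in> sets borel"
    by (intro borel_open open_Collect_less continuous_intros)
  have Hm: "H \<in> borel_measurable borel"
    using G set unfolding H_def[abs_def] set_borel_measurable_def by simp
  have Hb: "\<bar>H z\<bar> \<le> C" if "z \<in> rect l T" for z
    using Gb[OF that] by (auto simp: H_def indicator_def)
  have H0: "H z = 0" if "\<not> (0 < fst z \<and> 0 < snd z \<and> fst z + snd z < c)" for z
    using that by (auto simp: H_def indicator_def rect_def)
  have C: "C \<ge> 0" using order_trans[OF abs_ge_zero Gb[of "(l/2, T/2)"]] c by (auto simp: rect_def)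
  have Hb': "\<bar>H z\<bar> \<le> C" for z using Hb[of z] C by (cases "z \<in> rect l T") (auto simp: H_def)
  have int: "integrable lborel (\<lambda>z. H (f z))"
    if f: "f \<in> borel_measurable borel" and supp: "\<And>z. H (f z) \<noteq> 0 \<Longrightarrow> z \<in> {0..c} \<times> {0..c}" for f
  proof (rule integrableI_bounded_set[where A = "{0..c} \<times> {0..c}" and B = C])
    show "(\<lambda>z. H (f z)) \<in> borel_measurable lborel" using measurable_compose[OF f Hm] by simp
  qed (use supp Hb' emeasure_lborel_rectangle_finite in \<open>auto simp: borel_closed closed_Times\<close>)
  have int1: "integrable (lborel \<Otimes>\<^sub>M lborel) (\<lambda>(x, t). H (x, t))"
  proof -
    have "z \<in> {0..c} \<times> {0..c}" if "H z \<noteq> 0" for z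
    proof -
      have "0 < fst z \<and> 0 < snd z \<and> fst z + snd z < c" using H0 that by blast
      then show ?thesis by (auto simp: mem_Times_iff)
    qed
    then show ?thesis unfolding lborel_prod using int[of "\<lambda>z. z"] by simp
  qed
  have int2: "integrable (lborel \<Otimes>\<^sub>M lborel) (\<lambda>(x, s). H (x, s - x))"
  proof -
    have "(\<lambda>z :: real \<times> real. (fst z, snd z - fst z)) \<in> borel_measurable borel"
      by (intro borel_measurable_continuous_onI continuous_intros)
    moreover have "z \<in> {0..c} \<times> {0..c}" if "H (fst z, snd z - fst z) \<noteq> 0" for z
    proof -
      have "0 < fst z \<and> 0 < snd z - fst z \<and> snd z < c" using H0[of "(fst z, snd z - fst z)"] that by auto
      then show ?thesis by (auto simp: mem_Times_iff)
    qed
    ultimately show ?thesis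
      unfolding lborel_prod split_def by (rule int)
  qed
  have "(LBINT z:rect l T. G z * indicat_real {z. fst z + snd z < c} z) = (LBINT z. H z)"
    unfolding set_lebesgue_integral_def H_def by (simp add: mult.assoc)
  also have "\<dots> = (LBINT x. LBINT t. H (x, t))"
    using lborel_pair.integral_fst[OF int1] by (simp add: lborel_prod)
  also have "\<dots> = (LBINT x. LBINT s. H (x, s - x))"
  proof (rule Bochner_Integration.integral_cong[OF refl])
    fix x
    show "(LBINT t. H (x, t)) = (LBINT s. H (x, s - x))"
      by (subst lborel_integral_real_affine[where c = 1 and t = "-x"]) (auto simp: algebra_simps)
  qed
  also have "\<dots> = (LBINT s. LBINT x. H (x, s - x))"
    using lborel_pair.Fubini_integral[OF int2] by simp
  also have "\<dots> = (LBINT s:{0<..<c}. (LBINT x:{0<..<s}. G (x, s - x)))"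
    unfolding set_lebesgue_integral_def[of _ "{0<..<c}"]
  proof (rule Bochner_Integration.integral_cong[OF refl])
    fix s
    have "(LBINT x. H (x, s - x)) = indicat_real {0<..<c} s * (LBINT x:{0<..<s}. G (x, s - x))"
      unfolding set_lebesgue_integral_def
      using c by (subst integral_mult_right_zero[symmetric], intro Bochner_Integration.integral_cong)
        (auto simp: H_def indicator_def rect_def)
    then show "(LBINT x. H (x, s - x)) = indicat_real {0<..<c} s *\<^sub>R (LBINT x:{0<..<s}. G (x, s - x))"
      by simp
  qed
  finally show ?thesis .
qed

section \<open>The sideways Volterra equation\<close>

lemma zero_on_closed_interval:
  fixes h :: "real \<Rightarrow> real"
  assumes "0 < T" "continuous_on {0..T} h" "\<And>t. t \<in> {0<..<T} \<Longrightarrow> h t = 0" "t \<in> {0..T}"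
  shows "h t = 0"
  using continuous_constant_on_closure[of "{0<..<T}" h 0 t] assms by simp

text \<open>Mean value inequality from \<open>x = 0\<close>; uniform continuity of \<open>y'\<close>
  on the compact rectangle provides one \<open>\<delta>\<close> for all \<open>t\<close>.\<close>

lemma boundary_small:
  assumes "0 < l" and cont: "continuous_on (crect l T) y'"
    and der: "\<And>x t. x \<in> {0..l} \<Longrightarrow> t \<in> {0..T} \<Longrightarrow> ((\<lambda>x. y (x, t)) has_real_derivative y' (x, t)) (at x within {0..l})"
    and zero: "\<And>t. t \<in> {0..T} \<Longrightarrow> y (0, t) = 0" "\<And>t. t \<in> {0..T} \<Longrightarrow> y' (0, t) = 0"
    and "\<eta> > 0"
  shows "\<exists>\<delta>>0. \<forall>(x, t) \<in> rect l T. x \<le> \<delta> \<longrightarrow> \<bar>y (x, t)\<bar> \<le> \<eta> * x"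
proof -
  have "uniformly_continuous_on (crect l T) y'"
    by (intro compact_uniformly_continuous cont compact_Times) auto
  then obtain d where d: "d > 0" "\<And>z w. z \<in> crect l T \<Longrightarrow> w \<in> crect l T \<Longrightarrow> dist w z < d \<Longrightarrow> dist (y' w) (y' z) < \<eta>"
    using \<open>\<eta> > 0\<close> unfolding uniformly_continuous_on_def by meson
  have "\<bar>y (x, t)\<bar> \<le> \<eta> * x" if xt: "(x, t) \<in> rect l T" and xd: "x \<le> d / 2" for x t
  proof -
    have x: "0 < x" "x < l" "t \<in> {0..T}" using xt by (auto simp: rect_def)
    have "norm (y (x, t) - y (0, t)) \<le> \<eta> * norm (x - 0)"
    proof (rule field_differentiable_bound[where S = "{0..x}" and f' = "\<lambda>s. y' (s, t)"])
      fix s assume s: "s \<in> {0..x}"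
      show "((\<lambda>x. y (x, t)) has_real_derivative y' (s, t)) (at s within {0..x})"
        using der[of s t] s x by (auto intro: DERIV_subset)
      have "dist (y' (s, t)) (y' (0, t)) < \<eta>"
        using s x xd d(1) by (intro d(2)) (auto simp: dist_Pair_Pair)
      then show "norm (y' (s, t)) \<le> \<eta>" using zero(2)[of t] x by (simp add: dist_real_def)
    qed (use x in auto)
    then show ?thesis using zero(1)[of t] x by simp
  qed
  then show ?thesis using d(1) by (intro exI[of _ "d / 2"]) auto
qed

lemma source_measurable:
  fixes p f :: "real \<Rightarrow> real"
  assumes "p \<in> borel_measurable borel" "f \<in> borel_measurable borel"
    and "continuous_on (crect l T) y" "continuous_on (crect l T) R"
  shows "set_borel_measurable lborel (rect l T) (\<lambda>z. p (fst z) * y z + f (fst z) * R z)"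
proof -
  have pm: "(\<lambda>z :: real \<times> real. p (fst z)) \<in> borel_measurable borel" "(\<lambda>z :: real \<times> real. f (fst z)) \<in> borel_measurable borel"
    using assms(1,2) by measurable
  have "(\<lambda>z. indicat_real (rect l T) z *\<^sub>R (p (fst z) * y z + f (fst z) * R z)) =
    (\<lambda>z. p (fst z) * (indicat_real (rect l T) z *\<^sub>R y z) + f (fst z) * (indicat_real (rect l T) z *\<^sub>R R z))"
    by (auto simp: algebra_simps)
  then show ?thesis
    using pm set_borel_measurable_continuous_rect[OF assms(3)] set_borel_measurable_continuous_rect[OF assms(4)]
    unfolding set_borel_measurable_def by simp
qed

text \<open>The setting on one segment, oriented so that the Cauchy data sit at
  \<open>x = 0\<close>: \<open>y = u[p] - u[q]\<close>, \<open>f = p - q\<close>,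
  \<open>R = u[q]\<close>, with bounded Borel representatives of the coefficients.
  \<open>\<mu>\<close>, later the primitive of a square integrable bound for \<open>R_t\<close>,
  dominates the increments of \<open>R\<close> in time uniformly in \<open>x\<close>.\<close>

locale sideways =
  fixes l T K B r :: real and p f :: "real \<Rightarrow> real" and y y' R :: "real \<times> real \<Rightarrow> real" and \<mu> :: "real \<Rightarrow> real"
  assumes l: "0 < l" "l \<le> T" and r: "0 < r"
    and p: "p \<in> borel_measurable borel" "\<And>x. \<bar>p x\<bar> \<le> K"
    and f: "f \<in> borel_measurable borel" "\<And>x. \<bar>f x\<bar> \<le> K"
    and y_cont: "continuous_on (crect l T) y" and y'_cont: "continuous_on (crect l T) y'"
    and R_cont: "continuous_on (crect l T) R" and R_bound: "\<And>z. z \<in> crect l T \<Longrightarrow> \<bar>R z\<bar> \<le> B"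
    and der: "\<And>x t. x \<in> {0..l} \<Longrightarrow> t \<in> {0..T} \<Longrightarrow> ((\<lambda>x. y (x, t)) has_real_derivative y' (x, t)) (at x within {0..l})"
    and wave: "weak_wave l T y (\<lambda>z. p (fst z) * y z + f (fst z) * R z)"
    and lateral: "\<And>t. t \<in> {0<..<T} \<Longrightarrow> y (0, t) = 0" "\<And>t. t \<in> {0<..<T} \<Longrightarrow> y' (0, t) = 0"
    and y_init: "\<And>x. x \<in> {0..l} \<Longrightarrow> y (x, 0) = 0"
    and init_small: "\<And>\<eta>. \<eta> > 0 \<Longrightarrow> \<exists>\<delta>>0. \<forall>(x, t) \<in> rect l T. t \<le> \<delta> \<longrightarrow> \<bar>y (x, t)\<bar> \<le> \<eta> * t"
    and R_lower: "\<And>x. x \<in> {0..l} \<Longrightarrow> r \<le> \<bar>R (x, 0)\<bar>"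
    and \<mu>: "continuous_on {0..T} \<mu>" "\<mu> 0 = 0"
    and R_\<mu>: "\<And>x s t. x \<in> {0..l} \<Longrightarrow> 0 \<le> s \<Longrightarrow> s \<le> t \<Longrightarrow> t \<le> T \<Longrightarrow> \<bar>R (x, t) - R (x, s)\<bar> \<le> \<mu> t - \<mu> s"
begin

definition G where "G z = p (fst z) * y z + f (fst z) * R z"

text \<open>On \<open>x + t = s\<close> the source splits into \<open>f x * R (x, 0)\<close> and
  \<open>E x (s - x)\<close>: the first carries the unknown \<open>f\<close> with a factor bounded
  away from 0, the second vanishes at \<open>t = 0\<close>.\<close>

definition E where "E x t = p x * y (x, t) + f x * (R (x, t) - R (x, 0))"

definition H where "H s = integral {0..s} (\<lambda>x. f x * R (x, 0))"

text \<open>The integral of \<open>E\<close> along \<open>x + t = s\<close>. Clamping the time at 0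
  adds nothing for \<open>x > s\<close>, as \<open>E x 0 = 0\<close>, and gives all \<open>s\<close>
  the same domain of integration, so that increments in \<open>s\<close> are integrals of
  differences.\<close>

definition \<Psi> where "\<Psi> s = integral {0..l} (\<lambda>x. E x (max 0 (s - x)))"

lemma K_nonneg: "K \<ge> 0" using order_trans[OF abs_ge_zero p(2)] .

lemma B_nonneg: "B \<ge> 0"
  using order_trans[OF abs_ge_zero R_bound[of "(0, 0)"]] l by auto

lemma continuous_y: "continuous_on A k \<Longrightarrow> A \<subseteq> {0..l} \<Longrightarrow> (\<And>x. x \<in> A \<Longrightarrow> k x \<in> {0..T}) \<Longrightarrow>
    continuous_on A (\<lambda>x. y (x, k x))"
  by (rule continuous_on_compose2[OF y_cont]) (auto intro!: continuous_intros)

lemma continuous_R: "continuous_on A k \<Longrightarrow> A \<subseteq> {0..l} \<Longrightarrow> (\<And>x. x \<in> A \<Longrightarrow> k x \<in> {0..T}) \<Longrightarrow>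
    continuous_on A (\<lambda>x. R (x, k x))"
  by (rule continuous_on_compose2[OF R_cont]) (auto intro!: continuous_intros)

lemma fR_integrable: "0 \<le> a \<Longrightarrow> b \<le> l \<Longrightarrow> (\<lambda>x. f x * R (x, 0)) integrable_on {a..b}"
  "0 \<le> a \<Longrightarrow> b \<le> l \<Longrightarrow> (\<lambda>x. \<bar>f x * R (x, 0)\<bar>) integrable_on {a..b}"
  using l by (auto intro!: bounded_borel_times_continuous_integrable[OF f] continuous_R)

lemma f_integrable: "(\<lambda>x. \<bar>f x\<bar>) integrable_on {a..b}"
  using bounded_borel_times_continuous_integrable(3)[OF f continuous_on_const[of _ 1]] by simp

lemma E_integrable:
  assumes "0 \<le> a" "b \<le> l" "continuous_on {a..b} k" "\<And>x. x \<in> {a..b} \<Longrightarrow> k x \<in> {0..T}"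
  shows "(\<lambda>x. E x (k x)) integrable_on {a..b}"
  unfolding E_def using assms l
  by (intro integrable_add bounded_borel_times_continuous_integrable[OF p]
      bounded_borel_times_continuous_integrable[OF f] continuous_intros continuous_R continuous_y) auto

lemma E_integrable_max: "0 \<le> a \<Longrightarrow> b \<le> l \<Longrightarrow> s \<le> l \<Longrightarrow> (\<lambda>x. E x (max 0 (s - x))) integrable_on {a..b}"
  using l by (intro E_integrable) (auto intro!: continuous_intros)

lemma E_0: "x \<in> {0..l} \<Longrightarrow> E x 0 = 0"
  by (simp add: E_def y_init)

lemma G_measurable: "set_borel_measurable lborel (rect l T) G"
  unfolding G_def[abs_def] by (rule source_measurable[OF p(1) f(1) y_cont R_cont])

lemma G_bounded: "\<exists>C. \<forall>z \<in> crect l T. \<bar>G z\<bar> \<le> C"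
proof -
  obtain Y where Y: "Y > 0" "\<And>z. z \<in> crect l T \<Longrightarrow> \<bar>y z\<bar> \<le> Y"
    using continuous_rectangle_bounded[OF y_cont] by blast
  have "\<bar>G z\<bar> \<le> K * Y + K * B" if "z \<in> crect l T" for z
    unfolding G_def using Y R_bound[OF that] p f that K_nonneg
    by (intro order_trans[OF abs_triangle_ineq] add_mono) (auto simp: abs_mult intro!: mult_mono)
  then show ?thesis by blast
qed

lemma G_integrable: "set_integrable lborel (rect l T) G"
  using G_bounded rect_subset_closed set_integrable_rect[OF G_measurable] by (meson subsetD)

lemma y_left: "t \<in> {0..T} \<Longrightarrow> y (0, t) = 0" and y'_left: "t \<in> {0..T} \<Longrightarrow> y' (0, t) = 0"
proof -
  have slice: "continuous_on {0..T} (\<lambda>t. w (0, t))" if "continuous_on (crect l T) w" for w :: "real \<times> real \<Rightarrow> real"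
    using l by (intro continuous_on_compose2[OF that]) (auto intro!: continuous_intros)
  have T: "T > 0" using l by simp
  show "t \<in> {0..T} \<Longrightarrow> y (0, t) = 0" "t \<in> {0..T} \<Longrightarrow> y' (0, t) = 0"
    using zero_on_closed_interval[OF T slice[OF y_cont] lateral(1)]
      zero_on_closed_interval[OF T slice[OF y'_cont] lateral(2)] by auto
qed

lemma representation:
  assumes "0 < X" "X \<le> l" "0 \<le> t" "X + t \<le> T"
  shows "y (X, t) = (LBINT z:rect l T. G z * indicat_real (cone X t) z) / 2"
proof -
  have "T > 0" using l by simp
  from dAlembert[OF l(1) this y_cont G_integrable wave[folded G_def] boundary_small[OF l(1) y'_cont der y_left y'_left]
      init_small y_init assms]
  show ?thesis by simp
qed

text \<open>Allows the integral of \<open>H + \<Psi>\<close> to be differentiated at every point.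
  \<open>p\<close> and \<open>f\<close> are rough, but \<open>s\<close> enters \<open>\<Psi>\<close>
  only through the time arguments of the uniformly continuous \<open>y\<close> and
  \<open>R\<close>.\<close>

lemma H_\<Psi>_continuous: "continuous_on {0..l} (\<lambda>s. H s + \<Psi> s)"
proof (intro continuous_on_add)
  show "continuous_on {0..l} H"
    unfolding H_def using fR_integrable by (intro indefinite_integral_continuous_1) auto
  show "continuous_on {0..l} \<Psi>"
    unfolding continuous_on_iff
  proof (intro ballI allI impI)
    fix s e :: real assume s: "s \<in> {0..l}" and e: "e > 0"
    define e' where "e' = e / (2 * (2 * K * l + 1))"
    have e': "e' > 0" using e K_nonneg l by (auto simp: e'_def intro!: divide_pos_pos add_nonneg_pos)
    have comp: "compact (crect l T)" by (intro compact_Times) auto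
    obtain d1 where d1: "d1 > 0" "\<And>z w. z \<in> crect l T \<Longrightarrow> w \<in> crect l T \<Longrightarrow> dist w z < d1 \<Longrightarrow> dist (y w) (y z) < e'"
      using compact_uniformly_continuous[OF y_cont comp] e' unfolding uniformly_continuous_on_def by meson
    obtain d2 where d2: "d2 > 0" "\<And>z w. z \<in> crect l T \<Longrightarrow> w \<in> crect l T \<Longrightarrow> dist w z < d2 \<Longrightarrow> dist (R w) (R z) < e'"
      using compact_uniformly_continuous[OF R_cont comp] e' unfolding uniformly_continuous_on_def by meson
    have "dist (\<Psi> s') (\<Psi> s) < e" if s': "s' \<in> {0..l}" and d: "dist s' s < min d1 d2" for s'
    proof -
      have b: "norm (E x (max 0 (s' - x)) - E x (max 0 (s - x))) \<le> 2 * K * e'" if x: "x \<in> {0..l}" for x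
      proof -
        let ?w = "(x, max 0 (s' - x))" and ?z = "(x, max 0 (s - x))"
        have mem: "?w \<in> crect l T" "?z \<in> crect l T" using s s' x l by auto
        have dd: "dist ?w ?z < d1" "dist ?w ?z < d2"
          using d by (auto simp: dist_Pair_Pair dist_real_def)
        have 1: "\<bar>y ?w - y ?z\<bar> \<le> e'" using d1(2)[OF mem(2,1) dd(1)] by (simp add: dist_real_def)
        have 2: "\<bar>R ?w - R ?z\<bar> \<le> e'" using d2(2)[OF mem(2,1) dd(2)] by (simp add: dist_real_def)
        have "E x (max 0 (s' - x)) - E x (max 0 (s - x)) = p x * (y ?w - y ?z) + f x * (R ?w - R ?z)"
          by (simp add: E_def algebra_simps)
        also have "\<bar>\<dots>\<bar> \<le> K * e' + K * e'"
          using 1 2 p(2) f(2) K_nonneg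
          by (intro order_trans[OF abs_triangle_ineq] add_mono) (auto simp: abs_mult intro!: mult_mono)
        finally show ?thesis by simp
      qed
      have int: "(\<lambda>x. E x (max 0 (s' - x)) - E x (max 0 (s - x))) integrable_on {0..l}"
        using s s' by (intro integrable_diff E_integrable_max) auto
      have "norm (integral {0..l} (\<lambda>x. E x (max 0 (s' - x)) - E x (max 0 (s - x)))) \<le> 2 * K * e' * (l - 0)"
        using has_integral_bound_real[OF _ finite.emptyI integrable_integral[OF int], of "2 * K * e'"] l K_nonneg e' b
        by auto
      moreover have "\<Psi> s' - \<Psi> s = integral {0..l} (\<lambda>x. E x (max 0 (s' - x)) - E x (max 0 (s - x)))"
        unfolding \<Psi>_def using s s' by (intro Henstock_Kurzweil_Integration.integral_diff[symmetric] E_integrable_max) auto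
      moreover have "2 * K * e' * (l - 0) < e"
      proof -
        have "2 * K * e' * l \<le> (2 * K * l + 1) * e'" using e' by (simp add: algebra_simps)
        also have "\<dots> = e / 2"
        proof -
          have "2 * K * l + 1 > 0" using K_nonneg l by (intro add_nonneg_pos) auto
          then show ?thesis unfolding e'_def by (simp add: divide_simps)
        qed
        also have "\<dots> < e" using e by simp
        finally show ?thesis by simp
      qed
      ultimately show ?thesis by (simp add: dist_real_def)
    qed
    then show "\<exists>d>0. \<forall>s'\<in>{0..l}. dist s' s < d \<longrightarrow> dist (\<Psi> s') (\<Psi> s) < e"
      using d1 d2 by (intro exI[of _ "min d1 d2"]) auto
  qed
qed

text \<open>Differentiating \<open>y (c, 0) = 0\<close> in \<open>c\<close>, the source integrates to zero along the characteristic \<open>x + t = c\<close>.\<close>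

lemma characteristic_identity:
  assumes "s \<in> {0..l}"
  shows "H s + \<Psi> s = 0"
proof -
  have inner: "(LBINT x:{0<..<s}. G (x, s - x)) = H s + \<Psi> s" if s: "0 < s" "s \<le> l" for s
  proof -
    have "set_integrable lborel {0..s} (\<lambda>x. G (x, s - x))"
      unfolding G_def fst_conv using s l
      by (intro set_integral_add(1) bounded_borel_times_continuous[OF p] bounded_borel_times_continuous[OF f]
        continuous_y continuous_R continuous_intros) auto
    then have "set_integrable lborel {0<..<s} (\<lambda>x. G (x, s - x))"
      by (rule set_integrable_subset) auto
    then have "(LBINT x:{0<..<s}. G (x, s - x)) = integral {0..s} (\<lambda>x. G (x, s - x))"
      by (subst set_borel_integral_eq_integral(2)) (auto simp: integral_open_interval_real)
    also have "\<dots> = integral {0..s} (\<lambda>x. f x * R (x, 0) + E x (s - x))"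
      by (intro Henstock_Kurzweil_Integration.integral_cong) (simp add: G_def E_def algebra_simps)
    also have "\<dots> = H s + integral {0..s} (\<lambda>x. E x (s - x))"
      unfolding H_def using s l
      by (intro Henstock_Kurzweil_Integration.integral_add fR_integrable E_integrable continuous_intros) auto
    also have "integral {0..s} (\<lambda>x. E x (s - x)) = integral {0..s} (\<lambda>x. E x (max 0 (s - x)))"
      by (intro Henstock_Kurzweil_Integration.integral_cong) auto
    also have "\<dots> = \<Psi> s"
    proof -
      have "integral {s..l} (\<lambda>x. E x (max 0 (s - x))) = integral {s..l} (\<lambda>x. 0)"
        using s by (intro Henstock_Kurzweil_Integration.integral_cong) (auto simp: E_0)
      then show ?thesis
        unfolding \<Psi>_def
        using Henstock_Kurzweil_Integration.integral_combine[of 0 s l "\<lambda>x. E x (max 0 (s - x))"] s E_integrable_max[of 0 l s]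
        by simp
    qed
    finally show ?thesis .
  qed
  have zero: "integral {0..c} (\<lambda>s. H s + \<Psi> s) = 0" if c: "c \<in> {0..l}" for c
  proof (cases "c = 0")
    case False
    then have c': "0 < c" "c \<le> l" using c by auto
    have "0 = (LBINT z:rect l T. G z * indicat_real (cone c 0) z)"
      using representation[OF c', of 0] y_init[OF c] c' l by simp
    \<comment> \<open>For an apex at time 0 the second inequality of the cone,
      \<open>x - t < c\<close>, follows from the first inside the rectangle.\<close>
    also have "\<dots> = (LBINT z:rect l T. G z * indicat_real {z. fst z + snd z < c} z)"
      by (rule set_lebesgue_integral_cong) (simp, auto simp: rect_def cone_def indicator_def)
    also have "\<dots> = (LBINT s:{0<..<c}. (LBINT x:{0<..<s}. G (x, s - x)))"
    proof -
      obtain C where "\<And>z. z \<in> rect l T \<Longrightarrow> \<bar>G z\<bar> \<le> C"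
        using G_bounded rect_subset_closed by blast
      then show ?thesis using c' l G_measurable by (intro integral_characteristic_coordinates) auto
    qed
    also have "\<dots> = (LBINT s:{0<..<c}. H s + \<Psi> s)"
      using inner c' by (intro set_lebesgue_integral_cong) auto
    also have "\<dots> = integral {0<..<c} (\<lambda>s. H s + \<Psi> s)"
    proof (rule set_borel_integral_eq_integral(2))
      have "set_integrable lborel {0..c} (\<lambda>s. H s + \<Psi> s)"
        using c' by (intro borel_integrable_atLeastAtMost' continuous_on_subset[OF H_\<Psi>_continuous]) auto
      then show "set_integrable lborel {0<..<c} (\<lambda>s. H s + \<Psi> s)" by (rule set_integrable_subset) auto
    qed
    finally show ?thesis by (simp add: integral_open_interval_real)
  qed simp
  have "((\<lambda>u. integral {0..u} (\<lambda>s. H s + \<Psi> s)) has_vector_derivative H s + \<Psi> s) (at s within {0..l})"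
    by (rule integral_has_vector_derivative[OF H_\<Psi>_continuous assms])
  moreover have "((\<lambda>u. integral {0..u} (\<lambda>s. H s + \<Psi> s)) has_vector_derivative 0) (at s within {0..l})"
    using zero assms by (intro has_vector_derivative_transform[OF _ _ has_vector_derivative_const]) auto
  ultimately show ?thesis
    using vector_derivative_unique_within_closed_interval[of 0 l s] l assms by auto
qed

text \<open>The cones of \<open>(X, t)\<close> and \<open>(X, t')\<close> differ within two
  characteristic strips of width \<open>t' - t\<close>, where \<open>|G|\<close> is at most
  \<open>B |f|\<close> plus, for \<open>x \<ge> c0\<close>, \<open>K m\<close>. As \<open>y\<close>
  is already known to vanish for \<open>x \<le> c0\<close>, the term in \<open>m\<close> carries the
  factor \<open>c - c0\<close>, which can be made small.\<close>

lemma time_lipschitz: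
  assumes c: "0 \<le> c0" "c0 \<le> c" "c \<le> l"
    and zero: "\<And>x t. 0 \<le> x \<Longrightarrow> x \<le> c0 \<Longrightarrow> 0 \<le> t \<Longrightarrow> x + t \<le> T \<Longrightarrow> y (x, t) = 0"
    and m: "\<And>x t. 0 \<le> x \<Longrightarrow> x \<le> c \<Longrightarrow> 0 \<le> t \<Longrightarrow> x + t \<le> T \<Longrightarrow> \<bar>y (x, t)\<bar> \<le> m"
    and X: "0 \<le> X" "X \<le> c" and t: "0 \<le> t" "t \<le> t'" "X + t' \<le> T"
  shows "\<bar>y (X, t') - y (X, t)\<bar> \<le> (K * m * (c - c0) + B * integral {0..c} (\<lambda>x. \<bar>f x\<bar>)) * (t' - t)"
proof -
  let ?F = "integral {0..c} (\<lambda>x. \<bar>f x\<bar>)"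
  have m0: "m \<ge> 0" using m[of 0 0] c l by auto
  have F0: "?F \<ge> 0" by (intro integral_nonneg f_integrable) auto
  show ?thesis
  proof (cases "X = 0")
    case True
    have "K * m * (c - c0) + B * ?F \<ge> 0" using K_nonneg m0 B_nonneg F0 c by simp
    then show ?thesis using True t by (simp add: y_left)
  next
    case False
    then have X': "0 < X" "X \<le> l" using X c by auto
    \<comment> \<open>A majorant of \<open>|G|\<close> on the symmetric difference of the two cones
      that depends on \<open>x\<close> alone.\<close>
    define g where "g x = K * m * indicat_real {c0..c} x + B * (indicat_real {0..c} x * \<bar>f x\<bar>)" for x
    define w where "w = t' - t"
    define S1 where "S1 z = g (fst z) * indicat_real {X + t - fst z..X + t - fst z + w} (snd z)" for z
    define S2 where "S2 z = g (fst z) * indicat_real {t - X + fst z..t - X + fst z + w} (snd z)" for z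
    have fint: "set_integrable lborel {0..c} (\<lambda>x. \<bar>f x\<bar>)"
      using set_integrable_abs[OF bounded_borel_times_continuous[OF f continuous_on_const[of _ 1]]] by simp
    have g0: "g x \<ge> 0" for x
      unfolding g_def using K_nonneg B_nonneg m0 by (intro add_nonneg_nonneg mult_nonneg_nonneg) auto
    have i1: "integrable lborel (\<lambda>x. K * m * indicat_real {c0..c} x)"
      by (intro integrable_mult_right integrable_real_indicator) (auto simp: emeasure_lborel_Icc_eq)
    have i2: "integrable lborel (\<lambda>x. B * (indicat_real {0..c} x * \<bar>f x\<bar>))"
      using fint unfolding set_integrable_def by (intro integrable_mult_right) simp
    have gint: "integrable lborel g"
      unfolding g_def[abs_def] using i1 i2 by (rule Bochner_Integration.integrable_add)
    have gI: "(LBINT x. g x) = K * m * (c - c0) + B * ?F"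
    proof -
      have "(LBINT x. indicat_real {0..c} x * \<bar>f x\<bar>) = ?F"
        using set_borel_integral_eq_integral(2)[OF fint] by (simp add: set_lebesgue_integral_def)
      then show ?thesis unfolding g_def using c i1 i2 by (subst Bochner_Integration.integral_add) auto
    qed
    have S: "integrable lborel S1" "(LBINT z. S1 z) = w * (LBINT x. g x)"
      "integrable lborel S2" "(LBINT z. S2 z) = w * (LBINT x. g x)"
      unfolding S1_def[abs_def] S2_def[abs_def] using t
      by (intro moving_strip_integral gint g0; simp add: w_def)+
    have SS: "set_integrable lborel (rect l T) (\<lambda>z. S1 z + S2 z)"
      unfolding set_integrable_def using S(1,3)
      by (intro integrable_mult_indicator Bochner_Integration.integrable_add) auto
    have Gi: "set_integrable lborel (rect l T) (\<lambda>z. G z * indicat_real (cone X s) z)" for s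
      by (rule set_integrable_rect_times[OF G_integrable, of _ 1]) auto
    have dint: "set_integrable lborel (rect l T) (\<lambda>z. G z * indicat_real (cone X t') z - G z * indicat_real (cone X t) z)"
      using Gi by (intro set_integral_diff(1))
    have diff: "2 * (y (X, t') - y (X, t)) = (LBINT z:rect l T. G z * indicat_real (cone X t') z - G z * indicat_real (cone X t) z)"
      using representation[OF X', of t'] representation[OF X', of t] X' t unfolding set_integral_diff(2)[OF Gi Gi] by simp
    have "\<bar>2 * (y (X, t') - y (X, t))\<bar> \<le> (LBINT z:rect l T. \<bar>G z * indicat_real (cone X t') z - G z * indicat_real (cone X t) z\<bar>)"
      unfolding diff using set_integral_norm_bound[OF dint] by simp
    also have "\<dots> \<le> (LBINT z:rect l T. S1 z + S2 z)"
    proof (rule set_integral_mono)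
      fix z assume z: "z \<in> rect l T"
      obtain x \<tau> where xt: "z = (x, \<tau>)" by force
      show "\<bar>G z * indicat_real (cone X t') z - G z * indicat_real (cone X t) z\<bar> \<le> S1 z + S2 z"
      proof (cases "z \<in> cone X t \<longleftrightarrow> z \<in> cone X t'")
        case True
        then show ?thesis using g0 by (auto simp: S1_def S2_def indicator_def)
      next
        case False
        have x: "x \<ge> 0" "\<tau> \<ge> 0" "x < X" "x + \<tau> < X + t'" using False z t by (auto simp: xt rect_def cone_def)
        have mem: "z \<in> crect l T" using z rect_subset_closed by blast
        have yb: "K * \<bar>y z\<bar> \<le> K * m * indicat_real {c0..c} x"
        proof (cases "x < c0")
          case True
          then show ?thesis using zero[of x \<tau>] x t by (simp add: xt)
        next
          case False
          then show ?thesis using m[of x \<tau>] x t X K_nonneg by (auto simp: xt intro!: mult_left_mono)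
        qed
        have "\<bar>G z\<bar> \<le> \<bar>p x\<bar> * \<bar>y z\<bar> + \<bar>f x\<bar> * \<bar>R z\<bar>"
          unfolding G_def xt fst_conv by (metis abs_mult abs_triangle_ineq)
        also have "\<dots> \<le> K * \<bar>y z\<bar> + \<bar>f x\<bar> * B"
          using p(2) R_bound[OF mem] by (intro add_mono mult_right_mono mult_left_mono) auto
        also have "\<dots> \<le> g x" using yb x X by (simp add: g_def mult.commute)
        finally have "\<bar>G z\<bar> \<le> g x" .
        moreover have "\<tau> \<in> {X + t - x..X + t - x + w} \<or> \<tau> \<in> {t - X + x..t - X + x + w}"
          using False t by (auto simp: xt cone_def w_def)
        ultimately have "\<bar>G z\<bar> \<le> S1 z + S2 z"
          using g0[of x] by (auto simp: S1_def S2_def xt indicator_def)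
        moreover have "\<bar>G z * indicat_real (cone X t') z - G z * indicat_real (cone X t) z\<bar> = \<bar>G z\<bar>"
          using False by (auto simp: indicator_def)
        ultimately show ?thesis by simp
      qed
    qed (use set_integrable_abs[OF dint] SS in auto)
    also have "\<dots> \<le> (LBINT z. S1 z + S2 z)"
      unfolding set_lebesgue_integral_def
    proof (rule integral_mono)
      show "integrable lborel (\<lambda>z. indicat_real (rect l T) z *\<^sub>R (S1 z + S2 z))"
        using SS by (simp add: set_integrable_def)
      show "integrable lborel (\<lambda>z. S1 z + S2 z)" using S by simp
      show "indicat_real (rect l T) z *\<^sub>R (S1 z + S2 z) \<le> S1 z + S2 z" for z
        using g0 by (auto simp: indicator_def S1_def S2_def)
    qed
    also have "\<dots> = 2 * (w * (LBINT x. g x))" using S by simp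
    finally show ?thesis by (simp add: gI w_def abs_mult mult.commute)
  qed
qed

text \<open>The induction hypothesis for advancing in \<open>x\<close>. The condition
  \<open>x + t \<le> T\<close> says that the cone of \<open>(x, t)\<close>, cut off at
  \<open>x = 0\<close>, stays below \<open>t = T\<close>.\<close>

definition vanishing :: "real \<Rightarrow> bool" where
  "vanishing c \<longleftrightarrow> integral {0..c} (\<lambda>x. \<bar>f x\<bar>) = 0 \<and>
     (\<forall>x t. 0 \<le> x \<longrightarrow> x \<le> c \<longrightarrow> 0 \<le> t \<longrightarrow> x + t \<le> T \<longrightarrow> y (x, t) = 0)"

lemma \<mu>_mono: "0 \<le> s \<Longrightarrow> s \<le> t \<Longrightarrow> t \<le> T \<Longrightarrow> \<mu> s \<le> \<mu> t"
  using R_\<mu>[of 0 s t] l by auto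

text \<open>By \<open>characteristic_identity\<close> the increments of \<open>H\<close> are those
  of \<open>- \<Psi>\<close>, and the latter are controlled by the Lipschitz constant of
  \<open>y\<close> and the modulus of \<open>R\<close>. This bounds the total variation of
  \<open>H\<close>, which is the integral on the left.\<close>

lemma source_variation:
  assumes c: "0 \<le> c0" "c0 \<le> c" "c \<le> l" and L: "L \<ge> 0"
    and zero: "\<And>x t. 0 \<le> x \<Longrightarrow> x \<le> c0 \<Longrightarrow> 0 \<le> t \<Longrightarrow> x + t \<le> T \<Longrightarrow> y (x, t) = 0"
    and lip: "\<And>X t t'. 0 \<le> X \<Longrightarrow> X \<le> c \<Longrightarrow> 0 \<le> t \<Longrightarrow> t \<le> t' \<Longrightarrow> X + t' \<le> T \<Longrightarrow>
      \<bar>y (X, t') - y (X, t)\<bar> \<le> L * (t' - t)"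
  shows "integral {0..c} (\<lambda>x. \<bar>f x * R (x, 0)\<bar>) \<le>
    K * L * (c - c0) * c + integral {0..c} (\<lambda>x. \<bar>f x\<bar> * \<mu> (c - x))"
proof -
  \<comment> \<open>The majorant for \<open>integral_abs_le_increments\<close>. The contribution of
    \<open>y\<close> counts only on \<open>{c0..c}\<close>, whence the factor
    \<open>c - c0\<close>.\<close>
  define V where "V w = K * L * (c - c0) * w + integral {0..c} (\<lambda>x. \<bar>f x\<bar> * \<mu> (max 0 (w - x)))" for w
  have \<mu>int: "(\<lambda>x. \<bar>f x\<bar> * \<mu> (max 0 (w - x))) integrable_on {0..c}" if "w \<le> l" for w
    using that c l
    by (intro bounded_borel_times_continuous_integrable(2)[OF f] continuous_on_compose2[OF \<mu>(1)])
      (auto intro!: continuous_intros)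
  have "integral {0..c} (\<lambda>x. \<bar>f x * R (x, 0)\<bar>) \<le> V c - V 0"
  proof (rule integral_abs_le_increments)
    fix u v assume uv: "0 \<le> u" "u \<le> v" "v \<le> c"
    define D where "D x = E x (max 0 (v - x)) - E x (max 0 (u - x))" for x
    have Dint: "D integrable_on {a..b}" if "0 \<le> a" "b \<le> l" for a b
      unfolding D_def[abs_def] using that uv c by (intro integrable_diff E_integrable_max) auto
    define q where "q x = (if x \<in> {c0..c} then K * L * (v - u) else 0)
       + (\<bar>f x\<bar> * \<mu> (max 0 (v - x)) - \<bar>f x\<bar> * \<mu> (max 0 (u - x)))" for x
    have q1: "(\<lambda>x. if x \<in> {c0..c} then K * L * (v - u) else 0) integrable_on {0..c}"
      using c by (subst integrable_restrict_Int) (auto simp: Int_absorb1)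
    have q2: "(\<lambda>x. \<bar>f x\<bar> * \<mu> (max 0 (v - x)) - \<bar>f x\<bar> * \<mu> (max 0 (u - x))) integrable_on {0..c}"
      using uv c by (intro integrable_diff \<mu>int) auto
    have qint: "q integrable_on {0..c}"
      unfolding q_def[abs_def] using q1 q2 by (rule integrable_add)
    have qI: "integral {0..c} q = V v - V u"
    proof -
      have "integral {0..c} q = integral {0..c} (\<lambda>x. if x \<in> {c0..c} then K * L * (v - u) else 0)
        + integral {0..c} (\<lambda>x. \<bar>f x\<bar> * \<mu> (max 0 (v - x)) - \<bar>f x\<bar> * \<mu> (max 0 (u - x)))"
        unfolding q_def[abs_def] by (rule Henstock_Kurzweil_Integration.integral_add[OF q1 q2])
      also have "integral {0..c} (\<lambda>x. if x \<in> {c0..c} then K * L * (v - u) else 0) = K * L * (v - u) * (c - c0)"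
        using c by (subst integral_restrict_Int) (auto simp: Int_absorb1)
      also have "integral {0..c} (\<lambda>x. \<bar>f x\<bar> * \<mu> (max 0 (v - x)) - \<bar>f x\<bar> * \<mu> (max 0 (u - x))) =
        integral {0..c} (\<lambda>x. \<bar>f x\<bar> * \<mu> (max 0 (v - x))) - integral {0..c} (\<lambda>x. \<bar>f x\<bar> * \<mu> (max 0 (u - x)))"
        using uv c by (intro Henstock_Kurzweil_Integration.integral_diff \<mu>int) auto
      finally show ?thesis by (simp add: V_def algebra_simps)
    qed
    have Dq: "norm (D x) \<le> q x" if x: "x \<in> {0..c}" for x
    proof -
      let ?v = "max 0 (v - x)" and ?u = "max 0 (u - x)"
      have le: "0 \<le> ?u" "?u \<le> ?v" "?v \<le> T" "x + ?v \<le> T" "?v - ?u \<le> v - u"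
        using uv x c l by auto
      have y1: "\<bar>y (x, ?v) - y (x, ?u)\<bar> \<le> L * (v - u)"
        using lip[of x ?u ?v] x le mult_left_mono[OF le(5) L] by auto
      have y2: "\<bar>p x\<bar> * \<bar>y (x, ?v) - y (x, ?u)\<bar> \<le> (if x \<in> {c0..c} then K * L * (v - u) else 0)"
      proof (cases "x < c0")
        case True
        then show ?thesis using zero[of x ?v] zero[of x ?u] x le by simp
      next
        case False
        then show ?thesis using mult_mono[OF p(2) y1 K_nonneg] x by (auto simp: mult.assoc)
      qed
      have R1: "\<bar>R (x, ?v) - R (x, ?u)\<bar> \<le> \<mu> ?v - \<mu> ?u"
        using x c le by (intro R_\<mu>) auto
      have "D x = p x * (y (x, ?v) - y (x, ?u)) + f x * (R (x, ?v) - R (x, ?u))"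
        by (simp add: D_def E_def algebra_simps)
      then have "\<bar>D x\<bar> \<le> \<bar>p x\<bar> * \<bar>y (x, ?v) - y (x, ?u)\<bar> + \<bar>f x\<bar> * \<bar>R (x, ?v) - R (x, ?u)\<bar>"
        by (metis abs_mult abs_triangle_ineq)
      also have "\<dots> \<le> q x"
        unfolding q_def right_diff_distrib[symmetric]
        by (intro add_mono y2 mult_left_mono R1) auto
      finally show ?thesis by simp
    qed
    have "integral {0..u} (\<lambda>x. f x * R (x, 0)) + integral {u..v} (\<lambda>x. f x * R (x, 0)) = integral {0..v} (\<lambda>x. f x * R (x, 0))"
      using uv c by (intro Henstock_Kurzweil_Integration.integral_combine fR_integrable) auto
    then have "integral {u..v} (\<lambda>x. f x * R (x, 0)) = H v - H u" by (simp add: H_def)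
    also have "\<dots> = - (\<Psi> v - \<Psi> u)"
      using characteristic_identity[of v] characteristic_identity[of u] uv c by auto
    also have "\<Psi> v - \<Psi> u = integral {0..l} D"
      unfolding \<Psi>_def D_def[abs_def] using uv c
      by (intro Henstock_Kurzweil_Integration.integral_diff[symmetric] E_integrable_max) auto
    \<comment> \<open>Since \<open>u\<close> and \<open>v\<close> are at most \<open>c\<close>, both
      clamped times are 0 for \<open>x \<ge> c\<close>.\<close>
    also have "integral {0..l} D = integral {0..c} D"
    proof -
      have "integral {c..l} D = integral {c..l} (\<lambda>x. 0)"
        using uv by (intro Henstock_Kurzweil_Integration.integral_cong) (auto simp: D_def)
      then show ?thesis
        using Henstock_Kurzweil_Integration.integral_combine[of 0 c l D] c Dint by simp
    qed
    finally have "\<bar>integral {u..v} (\<lambda>x. f x * R (x, 0))\<bar> = norm (integral {0..c} D)" by simp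
    also have "\<dots> \<le> integral {0..c} q"
      using Dint qint Dq c by (intro integral_norm_bound_integral) auto
    finally show "\<bar>integral {u..v} (\<lambda>x. f x * R (x, 0))\<bar> \<le> V v - V u" using qI by simp
  qed (use c fR_integrable in auto)
  moreover have "V 0 = 0"
  proof -
    have "integral {0..c} (\<lambda>x. \<bar>f x\<bar> * \<mu> (max 0 (0 - x))) = integral {0..c} (\<lambda>x. 0)"
      by (intro Henstock_Kurzweil_Integration.integral_cong) (auto simp: \<mu>)
    then show ?thesis by (simp add: V_def)
  qed
  moreover have "integral {0..c} (\<lambda>x. \<bar>f x\<bar> * \<mu> (max 0 (c - x))) = integral {0..c} (\<lambda>x. \<bar>f x\<bar> * \<mu> (c - x))"
    by (intro Henstock_Kurzweil_Integration.integral_cong) auto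
  ultimately show ?thesis by (simp add: V_def)
qed

text \<open>Let \<open>F\<close> be the integral of \<open>|f|\<close>, \<open>m\<close> the maximum
  of \<open>|y|\<close> and \<open>L\<close> its Lipschitz constant in time. Then
  \<open>m \<le> L T\<close> from \<open>y (x, 0) = 0\<close>, and
  \<open>L \<le> K m \<delta> + B F\<close>. The first smallness condition absorbs \<open>m\<close>
  and leaves \<open>L \<le> 2 B F\<close>. Now the variation estimate reads
  \<open>r F \<le> (2 K B \<delta> l + \<mu> \<delta>) F\<close>, and the second condition forces
  \<open>F = 0\<close>. Neither condition mentions \<open>c0\<close>, so the step can be
  repeated.\<close>

lemma vanishing_step:
  assumes c: "0 \<le> c0" "c0 \<le> c" "c \<le> l" "c - c0 \<le> \<delta>" "\<delta> \<le> T"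
    and small: "T * K * \<delta> \<le> 1 / 2" "2 * K * B * \<delta> * l + \<mu> \<delta> < r"
    and van: "vanishing c0"
  shows "vanishing c"
proof -
  define F where "F = integral {0..c} (\<lambda>x. \<bar>f x\<bar>)"
  have F0: "F \<ge> 0" unfolding F_def by (intro integral_nonneg f_integrable) auto
  have zero: "y (x, t) = 0" if "0 \<le> x" "x \<le> c0" "0 \<le> t" "x + t \<le> T" for x t
    using van that by (simp add: vanishing_def)
  have f0: "integral {0..c0} (\<lambda>x. \<bar>f x\<bar>) = 0" using van by (simp add: vanishing_def)
  let ?D = "{0..c} \<times> {0..T} \<inter> {z. fst z + snd z \<le> T}"
  have "compact ?D"
    by (intro compact_Int_closed compact_Times closed_Collect_le continuous_intros) auto
  moreover have "(0, 0) \<in> ?D" using c l by auto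
  moreover have "continuous_on ?D (\<lambda>z. \<bar>y z\<bar>)"
    using c by (intro continuous_intros continuous_on_subset[OF y_cont]) auto
  ultimately obtain zm where zm: "zm \<in> ?D" "\<And>z. z \<in> ?D \<Longrightarrow> \<bar>y z\<bar> \<le> \<bar>y zm\<bar>"
    using continuous_attains_sup[of ?D "\<lambda>z. \<bar>y z\<bar>"] by blast
  define m where "m = \<bar>y zm\<bar>"
  have m0: "m \<ge> 0" by (simp add: m_def)
  have m: "\<bar>y (x, t)\<bar> \<le> m" if "0 \<le> x" "x \<le> c" "0 \<le> t" "x + t \<le> T" for x t
    using zm(2)[of "(x, t)"] that by (auto simp: m_def)
  define L where "L = K * m * (c - c0) + B * F"
  have L0: "L \<ge> 0" unfolding L_def using K_nonneg m0 B_nonneg F0 c by simp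
  have lip: "\<bar>y (X, t') - y (X, t)\<bar> \<le> L * (t' - t)"
    if "0 \<le> X" "X \<le> c" "0 \<le> t" "t \<le> t'" "X + t' \<le> T" for X t t'
    unfolding L_def F_def using time_lipschitz[OF c(1-3) zero m] that by blast
  have Lle: "L \<le> K * m * \<delta> + B * F"
    unfolding L_def using K_nonneg m0 c by (intro add_right_mono mult_left_mono) auto
  have mT: "m \<le> L * T"
  proof -
    obtain x t where xt: "zm = (x, t)" by force
    have "m \<le> L * t"
      using lip[of x 0 t] zm(1) y_init[of x] c by (auto simp: m_def xt)
    also have "\<dots> \<le> L * T" using L0 zm(1) by (intro mult_left_mono) (auto simp: xt)
    finally show ?thesis .
  qed
  have T: "T > 0" using l by simp
  have "m \<le> (K * m * \<delta> + B * F) * T" using mT mult_right_mono[OF Lle, of T] T by linarith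
  also have "\<dots> = m * (T * K * \<delta>) + B * F * T" by (simp add: algebra_simps)
  also have "\<dots> \<le> m * (1 / 2) + B * F * T" using small m0 by (intro add_right_mono mult_left_mono)
  finally have m2: "m \<le> 2 * B * F * T" by simp
  have \<delta>0: "\<delta> \<ge> 0" using c by simp
  have "K * m * \<delta> \<le> K * (2 * B * F * T) * \<delta>"
    using m2 K_nonneg \<delta>0 by (intro mult_right_mono mult_left_mono) auto
  also have "\<dots> = (2 * B * F) * (T * K * \<delta>)" by simp
  also have "\<dots> \<le> (2 * B * F) * (1 / 2)" using small B_nonneg F0 by (intro mult_left_mono) auto
  finally have L2: "L \<le> 2 * B * F" using Lle by simp
  have "r * F = integral {0..c} (\<lambda>x. r * \<bar>f x\<bar>)" by (simp add: F_def)
  also have "\<dots> \<le> integral {0..c} (\<lambda>x. \<bar>f x * R (x, 0)\<bar>)"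
  proof (rule integral_le)
    show "(\<lambda>x. r * \<bar>f x\<bar>) integrable_on {0..c}" using integrable_cmul[OF f_integrable, of r] by simp
    show "(\<lambda>x. \<bar>f x * R (x, 0)\<bar>) integrable_on {0..c}" using c by (intro fR_integrable) auto
    show "r * \<bar>f x\<bar> \<le> \<bar>f x * R (x, 0)\<bar>" if "x \<in> {0..c}" for x
      using mult_right_mono[OF R_lower[of x], of "\<bar>f x\<bar>"] that c by (simp add: abs_mult mult.commute)
  qed
  also have "\<dots> \<le> K * L * (c - c0) * c + integral {0..c} (\<lambda>x. \<bar>f x\<bar> * \<mu> (c - x))"
    by (rule source_variation[OF c(1-3) L0 zero lip])
  also have "K * L * (c - c0) * c \<le> K * (2 * B * F) * \<delta> * l"
    using K_nonneg L2 L0 c \<delta>0 B_nonneg F0 by (intro mult_mono) auto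
  also have "integral {0..c} (\<lambda>x. \<bar>f x\<bar> * \<mu> (c - x)) \<le> \<mu> \<delta> * F"
  proof -
    have int: "(\<lambda>x. \<bar>f x\<bar> * \<mu> (c - x)) integrable_on {a..b}" if "0 \<le> a" "b \<le> c" for a b
      using that c l by (intro bounded_borel_times_continuous_integrable(2)[OF f] continuous_on_compose2[OF \<mu>(1)])
        (auto intro!: continuous_intros)
    \<comment> \<open>On \<open>{0..c0}\<close> the argument \<open>c - x\<close> may be large, but
      \<open>f\<close> has no mass; on \<open>{c0..c}\<close> it is at most
      \<open>\<delta>\<close>.\<close>
    have "integral {0..c0} (\<lambda>x. \<bar>f x\<bar> * \<mu> (c - x)) \<le> integral {0..c0} (\<lambda>x. \<bar>f x\<bar> * \<mu> T)"
      using c l f_integrable by (intro integral_le int integrable_on_mult_left mult_left_mono \<mu>_mono) auto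
    also have "\<dots> = 0" using f0 by simp
    finally have 1: "integral {0..c0} (\<lambda>x. \<bar>f x\<bar> * \<mu> (c - x)) \<le> 0" .
    have 2: "integral {c0..c} (\<lambda>x. \<bar>f x\<bar> * \<mu> (c - x)) \<le> integral {c0..c} (\<lambda>x. \<bar>f x\<bar> * \<mu> \<delta>)"
      using c l f_integrable by (intro integral_le int integrable_on_mult_left mult_left_mono \<mu>_mono) auto
    have 3: "integral {c0..c} (\<lambda>x. \<bar>f x\<bar>) = F"
      using Henstock_Kurzweil_Integration.integral_combine[OF c(1,2) f_integrable] f0 by (simp add: F_def)
    have "integral {0..c0} (\<lambda>x. \<bar>f x\<bar> * \<mu> (c - x)) + integral {c0..c} (\<lambda>x. \<bar>f x\<bar> * \<mu> (c - x)) = integral {0..c} (\<lambda>x. \<bar>f x\<bar> * \<mu> (c - x))"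
      using c by (intro Henstock_Kurzweil_Integration.integral_combine int) auto
    then show ?thesis using 1 2 3 by (simp add: mult.commute)
  qed
  finally have "r * F \<le> (2 * K * B * \<delta> * l + \<mu> \<delta>) * F" by (simp add: algebra_simps)
  then have "F = 0"
    using small(2) F0 mult_strict_right_mono[OF small(2), of F] by (cases "F = 0") auto
  then have "m = 0" using m2 m0 by simp
  then have "y (x, t) = 0" if "0 \<le> x" "x \<le> c" "0 \<le> t" "x + t \<le> T" for x t
    using m[OF that] by simp
  then show ?thesis using \<open>F = 0\<close> by (simp add: vanishing_def F_def)
qed

lemma vanishing_all: "vanishing l"
proof -
  have T: "T > 0" using l by simp
  obtain \<eta> where \<eta>: "\<eta> > 0" "\<And>s. s \<in> {0..T} \<Longrightarrow> dist s 0 < \<eta> \<Longrightarrow> dist (\<mu> s) (\<mu> 0) < r / 2"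
    using \<mu>(1) T r unfolding continuous_on_iff by (metis atLeastAtMost_iff half_gt_zero less_imp_le order_refl)
  \<comment> \<open>\<open>q1\<close> yields \<open>T K \<delta> \<le> 1/2\<close>,
    \<open>q2\<close> yields \<open>2 K B \<delta> l \<le> r/2\<close>, and \<open>\<eta>\<close>
    leaves \<open>\<mu> \<delta> < r/2\<close>. The added 1 keeps the denominators positive if
    \<open>K\<close> or \<open>B\<close> is 0.\<close>
  define q1 where "q1 = 1 / (2 * (T * K + 1))"
  define q2 where "q2 = r / (4 * (K * B * l + 1))"
  define \<delta> where "\<delta> = Min {\<eta> / 2, T, q1, q2}"
  have pos: "T * K + 1 > 0" "K * B * l + 1 > 0"
    using T K_nonneg B_nonneg l by (auto intro!: add_nonneg_pos)
  have q: "q1 > 0" "q2 > 0" using pos r by (auto simp: q1_def q2_def)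
  have \<delta>: "\<delta> > 0" "\<delta> \<le> \<eta> / 2" "\<delta> \<le> T" "\<delta> \<le> q1" "\<delta> \<le> q2"
    using \<eta> T q by (auto simp: \<delta>_def)
  have s1: "T * K * \<delta> \<le> 1 / 2"
  proof -
    have "T * K * \<delta> \<le> (T * K + 1) * \<delta>" using \<delta> by (simp add: algebra_simps)
    also have "\<dots> \<le> (T * K + 1) * q1" using \<delta> pos by (intro mult_left_mono) auto
    also have "\<dots> = 1 / 2" using pos unfolding q1_def by (simp add: divide_simps)
    finally show ?thesis .
  qed
  have s2: "2 * K * B * \<delta> * l + \<mu> \<delta> < r"
  proof -
    have "2 * K * B * \<delta> * l \<le> 2 * ((K * B * l + 1) * \<delta>)" using \<delta> by (simp add: algebra_simps)
    also have "\<dots> \<le> 2 * ((K * B * l + 1) * q2)" using \<delta> pos by (intro mult_left_mono) auto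
    also have "\<dots> = r / 2" using pos unfolding q2_def by (simp add: divide_simps)
    finally show ?thesis using \<eta>(2)[of \<delta>] \<eta>(1) \<delta> \<mu> by (simp add: dist_real_def)
  qed
  have step: "vanishing (min (real n * \<delta>) l)" for n
  proof (induction n)
    case 0
    show ?case using l y_left by (simp add: vanishing_def)
  next
    case (Suc n)
    show ?case
      by (rule vanishing_step[OF _ _ _ _ \<delta>(3) s1 s2 Suc.IH]) (use \<delta> l in \<open>auto simp: min_def algebra_simps\<close>)
  qed
  obtain n where "l < real n * \<delta>" using reals_Archimedean3[OF \<delta>(1)] by blast
  then show ?thesis using step[of n] by (simp add: min_def)
qed

lemma solution_zero: "0 \<le> x \<Longrightarrow> x \<le> l \<Longrightarrow> 0 \<le> t \<Longrightarrow> x + t \<le> T \<Longrightarrow> y (x, t) = 0"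
  using vanishing_all by (simp add: vanishing_def)

lemma source_zero: "AE x\<in>{0<..<l} in lborel. f x = 0"
proof -
  have fi: "set_integrable lborel {0..l} (\<lambda>x. \<bar>f x\<bar>)"
    using set_integrable_abs[OF bounded_borel_times_continuous[OF f continuous_on_const[of _ 1]]] by simp
  have "(LBINT x. indicat_real {0..l} x * \<bar>f x\<bar>) = 0"
    using set_borel_integral_eq_integral(2)[OF fi] vanishing_all by (simp add: vanishing_def set_lebesgue_integral_def)
  moreover have "integrable lborel (\<lambda>x. indicat_real {0..l} x * \<bar>f x\<bar>)"
    using fi by (simp add: set_integrable_def)
  ultimately have "AE x in lborel. indicat_real {0..l} x * \<bar>f x\<bar> = 0"
    by (subst (asm) integral_nonneg_eq_0_iff_AE) auto
  then show ?thesis by eventually_elim (auto simp: indicator_def)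
qed

end

section \<open>Manipulation of weak solutions\<close>

lemma integrable_times_bounded:
  fixes h \<phi> :: "'a \<Rightarrow> real"
  assumes "integrable M h" "\<phi> \<in> borel_measurable M" "\<And>x. \<bar>\<phi> x\<bar> \<le> C"
  shows "integrable M (\<lambda>x. h x * \<phi> x)"
proof (rule Bochner_Integration.integrable_bound[of _ "\<lambda>x. C * h x"])
  show "(\<lambda>x. h x * \<phi> x) \<in> borel_measurable M" using assms by simp
  have "\<bar>h x\<bar> * \<bar>\<phi> x\<bar> \<le> \<bar>C * h x\<bar>" for x
    using mult_left_mono[OF assms(3)[of x], of "\<bar>h x\<bar>"] order_trans[OF abs_ge_zero assms(3)[of x]]
    by (simp add: abs_mult mult.commute)
  then show "AE x in M. norm (h x * \<phi> x) \<le> norm (C * h x)" by (simp add: abs_mult)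
qed (use assms in auto)

lemma AE_lborel_fst:
  assumes "AE x in lborel. P x"
  shows "AE z in (lborel :: (real \<times> real) measure). P (fst z)"
proof -
  obtain N where N: "{x \<in> space lborel. \<not> P x} \<subseteq> N" "N \<in> null_sets lborel"
    using assms by (auto simp: eventually_ae_filter)
  have "emeasure (lborel \<Otimes>\<^sub>M lborel) (N \<times> (UNIV :: real set)) = emeasure lborel N * emeasure lborel (UNIV :: real set)"
    using N(2) by (intro lborel.emeasure_pair_measure_Times) auto
  moreover have "N \<times> (UNIV :: real set) \<in> sets (lborel \<Otimes>\<^sub>M lborel)" using N(2) by auto
  ultimately have "N \<times> (UNIV :: real set) \<in> null_sets lborel"
    using N(2) unfolding null_sets_def lborel_prod by auto
  then show ?thesis by (rule AE_I') (use N(1) in auto)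
qed

text \<open>The estimates use pointwise bounds; changing a potential on a null set is invisible to
  the weak equation.\<close>

lemma Linf_representative:
  assumes "Linf_on l p"
  obtains p' K where "p' \<in> borel_measurable borel" "\<And>x. \<bar>p' x\<bar> \<le> K"
    "AE x\<in>{0<..<l} in lborel. p x = p' x"
proof -
  obtain C where C: "AE x\<in>{0<..<l} in lborel. \<bar>p x\<bar> \<le> C" using assms by (auto simp: Linf_on_def)
  define q where "q x = indicat_real {0<..<l} x * p x" for x
  have q [measurable]: "q \<in> borel_measurable borel"
    using assms unfolding q_def[abs_def] Linf_on_def set_borel_measurable_def by simp
  define p' where "p' x = (if \<bar>q x\<bar> \<le> max C 0 then q x else 0)" for x
  show thesis
  proof (rule that)
    show "p' \<in> borel_measurable borel" unfolding p'_def[abs_def] by measurable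
    show "\<bar>p' x\<bar> \<le> max C 0" for x by (simp add: p'_def)
    show "AE x\<in>{0<..<l} in lborel. p x = p' x"
      using C by eventually_elim (auto simp: p'_def q_def)
  qed
qed

section \<open>Test functions and the weak wave equation\<close>

lemma smooth_family_continuous: "smooth_family D \<Longrightarrow> continuous_on A (D a b)"
  by (auto simp: smooth_family_def intro: continuous_on_subset)

lemma smooth_family_zero:
  assumes D: "smooth_family D" and U: "open U" and zero: "\<And>z. z \<in> U \<Longrightarrow> D 0 0 z = 0"
  shows "z \<in> U \<Longrightarrow> D a b z = 0"
proof -
  have t: "D (Suc a) b z = 0" if "\<And>w. w \<in> U \<Longrightarrow> D a b w = 0" "z \<in> U" for a b z
  proof -
    obtain x s where z: "z = (x, s)" by force
    let ?V = "(\<lambda>s. (x, s)) -` U"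
    have "open ?V" by (intro open_vimage U continuous_intros)
    moreover have "((\<lambda>s. D a b (x, s)) has_real_derivative D (Suc a) b (x, s)) (at s)"
      using D by (simp add: smooth_family_def)
    ultimately have "((\<lambda>_. 0) has_real_derivative D (Suc a) b (x, s)) (at s)"
      using that z by (elim has_field_derivative_transform_within_open) auto
    then show ?thesis using DERIV_unique DERIV_const z by blast
  qed
  have x: "D a (Suc b) z = 0" if "\<And>w. w \<in> U \<Longrightarrow> D a b w = 0" "z \<in> U" for a b z
  proof -
    obtain x s where z: "z = (x, s)" by force
    let ?V = "(\<lambda>x. (x, s)) -` U"
    have "open ?V" by (intro open_vimage U continuous_intros)
    moreover have "((\<lambda>x. D a b (x, s)) has_real_derivative D a (Suc b) (x, s)) (at x)"
      using D by (simp add: smooth_family_def)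
    ultimately have "((\<lambda>_. 0) has_real_derivative D a (Suc b) (x, s)) (at x)"
      using that z by (elim has_field_derivative_transform_within_open) auto
    then show ?thesis using DERIV_unique DERIV_const z by blast
  qed
  have b: "\<And>z. z \<in> U \<Longrightarrow> D 0 b z = 0" for b
    by (induction b) (use zero x in auto)
  have "\<And>z. z \<in> U \<Longrightarrow> D a b z = 0" for a b
    by (induction a) (use b t in auto)
  then show "z \<in> U \<Longrightarrow> D a b z = 0" .
qed

lemma test_fun_zero:
  assumes "test_fun l T D" "z \<notin> rect l T"
  shows "D a b z = 0"
proof (rule smooth_family_zero)
  show "smooth_family D" using assms by (simp add: test_fun_def)
  show "open (- closure {z. D 0 0 z \<noteq> 0})" by (simp add: open_Compl)
  show "D 0 0 w = 0" if "w \<in> - closure {z. D 0 0 z \<noteq> 0}" for w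
    using that closure_subset[of "{z. D 0 0 z \<noteq> 0}"] by auto
  show "z \<in> - closure {z. D 0 0 z \<noteq> 0}" using assms by (auto simp: test_fun_def)
qed

lemma test_fun_mono:
  assumes "test_fun l T' D" "T' \<le> T"
  shows "test_fun l T D"
  using assms unfolding test_fun_def rect_def by force

lemma test_fun_integral_restrict:
  assumes "test_fun l T' D" "T' \<le> T" "\<And>z. z \<notin> rect l T' \<Longrightarrow> k z = 0"
  shows "(LBINT z:rect l T. w z * k z) = (LBINT z:rect l T'. w z * k z :: real)"
  unfolding set_lebesgue_integral_def
  by (intro Bochner_Integration.integral_cong) (use assms in \<open>auto simp: indicator_def rect_def\<close>)

text \<open>A test function on the shorter rectangle vanishes outside it together with its
  derivatives. This serves the peeling, where the available time shrinks from segment to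
  segment.\<close>

lemma weak_wave_restrict:
  assumes "weak_wave l T y G" "T' \<le> T"
  shows "weak_wave l T' y G"
  unfolding weak_wave_def
proof (intro allI impI)
  fix D assume D: "test_fun l T' D"
  show "(LBINT z:rect l T'. y z * (D 2 0 z - D 0 2 z)) = - (LBINT z:rect l T'. G z * D 0 0 z)"
    using assms(1)[unfolded weak_wave_def, rule_format, OF test_fun_mono[OF D assms(2)]]
      test_fun_integral_restrict[OF D assms(2), of "\<lambda>z. D 2 0 z - D 0 2 z"]
      test_fun_integral_restrict[OF D assms(2), of "D 0 0"] test_fun_zero[OF D] by simp
qed

lemma test_fun_integrable:
  assumes D: "test_fun l T D" and g: "\<And>K. compact K \<and> K \<subseteq> rect l T \<Longrightarrow> set_integrable lborel K g"
  shows "set_integrable lborel (rect l T) (\<lambda>z. g z * D 0 0 z)"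
proof -
  define S where "S = closure {z. D 0 0 z \<noteq> 0}"
  have S: "compact S" "S \<subseteq> rect l T" "smooth_family D" using D by (auto simp: test_fun_def S_def)
  have D0: "D 0 0 z = 0" if "z \<notin> S" for z
    using that closure_subset[of "{z. D 0 0 z \<noteq> 0}"] by (auto simp: S_def)
  have "bounded (D 0 0 ` S)"
    by (intro compact_imp_bounded compact_continuous_image smooth_family_continuous S)
  then obtain C where C: "C > 0" "\<And>v. v \<in> D 0 0 ` S \<Longrightarrow> \<bar>v\<bar> \<le> C"
    unfolding bounded_pos real_norm_def by blast
  have Cb: "\<bar>D 0 0 z\<bar> \<le> C" for z using C D0[of z] by (cases "z \<in> S") auto
  have eq: "indicat_real (rect l T) z *\<^sub>R (g z * D 0 0 z) = (indicat_real S z *\<^sub>R g z) * D 0 0 z" for z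
    using D0[of z] S(2) by (auto simp: indicator_def)
  show ?thesis
    unfolding set_integrable_def eq
    using g[of S] S Cb borel_measurable_continuous_onI[OF smooth_family_continuous[OF S(3)]]
    by (intro integrable_times_bounded[of _ _ _ C]) (auto simp: set_integrable_def)
qed

text \<open>Both derivatives are of even order, so no sign appears when they move to the test
  function. \<open>gtt\<close> and \<open>gxx\<close> are known to be integrable on compact sets
  only; the compact support of \<open>D 0 0\<close> makes the products integrable.\<close>

lemma weak_wave_of_pde:
  assumes cont: "continuous_on (crect l T) u"
    and wt: "weak_pderiv l T 2 0 u gtt" and wx: "weak_pderiv l T 0 2 u gxx"
    and p: "p \<in> borel_measurable borel"
    and pde: "AE z\<in>rect l T in lborel. gtt z - gxx z + p (fst z) * u z = 0"
  shows "weak_wave l T u (\<lambda>z. p (fst z) * u z)"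
  unfolding weak_wave_def
proof (intro allI impI)
  fix D assume D: "test_fun l T D"
  then have sm: "smooth_family D" by (simp add: test_fun_def)
  have i: "set_integrable lborel (rect l T) (\<lambda>z. gtt z * D 0 0 z)" "set_integrable lborel (rect l T) (\<lambda>z. gxx z * D 0 0 z)"
    using wt wx by (auto intro!: test_fun_integrable[OF D] simp: weak_pderiv_def)
  have j: "set_integrable lborel (rect l T) (\<lambda>z. u z * D a b z)" for a b
    by (intro set_integrable_rect_continuous continuous_intros cont smooth_family_continuous[OF sm])
  have "(LBINT z:rect l T. u z * (D 2 0 z - D 0 2 z)) = (LBINT z:rect l T. u z * D 2 0 z) - (LBINT z:rect l T. u z * D 0 2 z)"
    unfolding right_diff_distrib by (rule set_integral_diff(2)[OF j j])
  also have "\<dots> = (LBINT z:rect l T. gtt z * D 0 0 z) - (LBINT z:rect l T. gxx z * D 0 0 z)"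
    using wt wx D unfolding weak_pderiv_def by simp
  also have "\<dots> = (LBINT z:rect l T. gtt z * D 0 0 z - gxx z * D 0 0 z)"
    by (rule set_integral_diff(2)[OF i, symmetric])
  also have "\<dots> = (LBINT z:rect l T. - (p (fst z) * u z * D 0 0 z))"
    unfolding set_lebesgue_integral_def
  proof (rule integral_cong_AE)
    show "(\<lambda>z. indicat_real (rect l T) z *\<^sub>R (gtt z * D 0 0 z - gxx z * D 0 0 z)) \<in> borel_measurable lborel"
      using set_integral_diff(1)[OF i] unfolding set_integrable_def by (rule borel_measurable_integrable)
    have "(\<lambda>z. indicat_real (rect l T) z *\<^sub>R - (p (fst z) * u z * D 0 0 z)) =
      (\<lambda>z. p (fst z) * (indicat_real (rect l T) z *\<^sub>R (u z * - D 0 0 z)))" by auto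
    moreover have "(\<lambda>z. indicat_real (rect l T) z *\<^sub>R (u z * - D 0 0 z)) \<in> borel_measurable borel"
      using set_borel_measurable_continuous_rect[of l T "\<lambda>z. u z * - D 0 0 z"]
      unfolding set_borel_measurable_def
      by (simp add: continuous_on_mult[OF cont continuous_on_minus] smooth_family_continuous[OF sm] cont continuous_intros)
    moreover have "(\<lambda>z :: real \<times> real. p (fst z)) \<in> borel_measurable borel" using p by measurable
    ultimately show "(\<lambda>z. indicat_real (rect l T) z *\<^sub>R - (p (fst z) * u z * D 0 0 z)) \<in> borel_measurable lborel"
      by simp
    show "AE z in lborel. indicat_real (rect l T) z *\<^sub>R (gtt z * D 0 0 z - gxx z * D 0 0 z) =
      indicat_real (rect l T) z *\<^sub>R - (p (fst z) * u z * D 0 0 z)"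
      using pde
    proof eventually_elim
      case (elim z)
      show ?case
      proof (cases "z \<in> rect l T")
        case True
        then have "gtt z - gxx z = - (p (fst z) * u z)" using elim by simp
        then show ?thesis by (simp add: left_diff_distrib[symmetric])
      qed simp
    qed
  qed
  finally show "(LBINT z:rect l T. u z * (D 2 0 z - D 0 2 z)) = - (LBINT z:rect l T. p (fst z) * u z * D 0 0 z)"
    by (simp add: set_lebesgue_integral_def)
qed

lemma weak_wave_diff:
  assumes cont: "continuous_on (crect l T) u" "continuous_on (crect l T) v"
    and int: "set_integrable lborel (rect l T) F" "set_integrable lborel (rect l T) G"
    and w: "weak_wave l T u F" "weak_wave l T v G"
  shows "weak_wave l T (\<lambda>z. u z - v z) (\<lambda>z. F z - G z)"
  unfolding weak_wave_def
proof (intro allI impI)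
  fix D assume D: "test_fun l T D"
  then have sm: "smooth_family D" by (simp add: test_fun_def)
  have i: "set_integrable lborel (rect l T) (\<lambda>z. w z * (D 2 0 z - D 0 2 z))"
    if "continuous_on (crect l T) w" for w
    by (intro set_integrable_rect_continuous continuous_intros that smooth_family_continuous[OF sm])
  have "set_integrable lborel K F" "set_integrable lborel K G" if "compact K \<and> K \<subseteq> rect l T" for K
    using that set_integrable_subset[OF int(1), of K] set_integrable_subset[OF int(2), of K]
    by (auto simp: borel_compact)
  note j = this[THEN test_fun_integrable[OF D]]
  have "(LBINT z:rect l T. (u z - v z) * (D 2 0 z - D 0 2 z)) =
    (LBINT z:rect l T. u z * (D 2 0 z - D 0 2 z)) - (LBINT z:rect l T. v z * (D 2 0 z - D 0 2 z))"
    unfolding left_diff_distrib[of "u _"] by (rule set_integral_diff(2)[OF i i]) (rule cont)+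
  also have "\<dots> = - ((LBINT z:rect l T. F z * D 0 0 z) - (LBINT z:rect l T. G z * D 0 0 z))"
    using w D by (simp add: weak_wave_def)
  also have "\<dots> = - (LBINT z:rect l T. (F z - G z) * D 0 0 z)"
    unfolding left_diff_distrib by (subst set_integral_diff(2)) (use j in auto)
  finally show "(LBINT z:rect l T. (u z - v z) * (D 2 0 z - D 0 2 z)) = - (LBINT z:rect l T. (F z - G z) * D 0 0 z)" .
qed

section \<open>Reversing the orientation of a segment\<close>

definition reflect :: "real \<Rightarrow> real \<times> real \<Rightarrow> real \<times> real" where
  "reflect l z = (l - fst z, snd z)"

lemma reflect_reflect [simp]: "reflect l (reflect l z) = z"
  by (simp add: reflect_def)

lemma reflect_rect [simp]: "reflect l z \<in> rect l T \<longleftrightarrow> z \<in> rect l T"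
  by (auto simp: reflect_def rect_def mem_Times_iff)

lemma continuous_on_reflect: "continuous_on A (reflect l)"
  unfolding reflect_def[abs_def] by (intro continuous_intros)

lemma distr_lborel_minus: "distr lborel borel (\<lambda>x. l - x) = (lborel :: real measure)"
proof -
  have "distr lborel borel (\<lambda>x. l - x) = distr (distr lborel borel uminus) borel ((+) l)"
    by (subst distr_distr) (auto simp: comp_def)
  then show ?thesis by (simp add: lborel_distr_uminus lborel_distr_plus)
qed

lemma distr_lborel_reflect: "distr lborel borel (reflect l) = lborel"
proof -
  note 1 = distr_lborel_minus[of l]
  have 2: "distr lborel borel (\<lambda>x. x) = (lborel :: real measure)"
    by (rule measure_eqI) (auto simp: emeasure_distr)
  interpret sigma_finite_measure "distr lborel borel (\<lambda>x. x) :: real measure"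
    unfolding 2 by (rule lborel.sigma_finite_measure_axioms)
  have "lborel \<Otimes>\<^sub>M lborel = distr lborel borel (\<lambda>x. l - x) \<Otimes>\<^sub>M distr lborel borel (\<lambda>x. x :: real)"
    unfolding 1 2 ..
  also have "\<dots> = distr (lborel \<Otimes>\<^sub>M lborel) (borel \<Otimes>\<^sub>M borel) (\<lambda>(x, t). (l - x, t))"
    by (rule pair_measure_distr) (auto intro: sigma_finite_measure_axioms)
  finally show ?thesis by (simp add: lborel_prod borel_prod reflect_def[abs_def] split_def)
qed

lemma integral_reflect:
  "(LBINT z:rect l T. g (reflect l z)) = (LBINT z:rect l T. g z :: real)"
proof -
  have m: "reflect l \<in> measurable lborel borel"
    using borel_measurable_continuous_onI[OF continuous_on_reflect] by simp
  have *: "(LBINT z. h (reflect l z)) = (LBINT z. h z)" for h :: "real \<times> real \<Rightarrow> real"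
  proof (cases "h \<in> borel_measurable borel")
    case True
    then show ?thesis using integral_distr[OF m, of h] by (simp add: distr_lborel_reflect)
  next
    \<comment> \<open>Reflection is an involution, so measurability fails on both sides at once, and
      both integrals take the default value 0.\<close>
    case False
    have "(\<lambda>z. h (reflect l z)) \<notin> borel_measurable borel"
    proof
      assume "(\<lambda>z. h (reflect l z)) \<in> borel_measurable borel"
      from measurable_compose[OF _ this, of "reflect l" borel] m
      show False using False by simp
    qed
    then have "\<not> integrable lborel (\<lambda>z. h (reflect l z))" "\<not> integrable lborel h"
      using False by (auto dest: borel_measurable_integrable)
    then show ?thesis by (simp add: not_integrable_integral_eq)
  qed
  have "indicat_real (rect l T) (reflect l z) = indicat_real (rect l T) z" for z by (simp add: indicator_def)
  then show ?thesis
    using *[of "\<lambda>z. indicat_real (rect l T) z *\<^sub>R g z"] by (simp add: set_lebesgue_integral_def)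
qed

text \<open>The test functions are reflected along; the chain rule contributes
  \<open>(-1) ^ b\<close>, which is 1 in second order, so the wave operator is unchanged.\<close>

lemma weak_wave_reflect:
  assumes "weak_wave l T y G"
  shows "weak_wave l T (\<lambda>z. y (reflect l z)) (\<lambda>z. G (reflect l z))"
  unfolding weak_wave_def
proof (intro allI impI)
  fix D assume D: "test_fun l T D"
  define D' where "D' a b z = (-1) ^ b * D a b (reflect l z)" for a b z
  have sm: "smooth_family D" using D by (simp add: test_fun_def)
  have sm': "smooth_family D'"
    unfolding smooth_family_def
  proof (intro allI conjI)
    fix a b x t
    show "continuous_on UNIV (D' a b)"
      unfolding D'_def[abs_def]
      by (intro continuous_intros continuous_on_compose2[OF smooth_family_continuous[OF sm, of UNIV] continuous_on_reflect]) auto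
    have "((\<lambda>x. D a b (x, t)) has_real_derivative D a (Suc b) (l - x, t)) (at (l - x))"
      "((\<lambda>s. D a b (l - x, s)) has_real_derivative D (Suc a) b (l - x, t)) (at t)"
      using sm by (simp_all add: smooth_family_def)
    then show "((\<lambda>y. D' a b (y, t)) has_real_derivative D' a (Suc b) (x, t)) (at x)"
      "((\<lambda>s. D' a b (x, s)) has_real_derivative D' (Suc a) b (x, t)) (at t)"
      unfolding D'_def reflect_def
      by (auto intro!: derivative_eq_intros DERIV_chain2[of "\<lambda>x. D a b (x, t)"])
  qed
  have "test_fun l T D'"
  proof (rule test_funI[OF sm'])
    let ?S = "closure {z. D 0 0 z \<noteq> 0}"
    show "compact (reflect l ` ?S)"
      using D by (intro compact_continuous_image continuous_on_reflect) (simp add: test_fun_def)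
    show "reflect l ` ?S \<subseteq> rect l T" using D by (auto simp: test_fun_def)
    show "z \<in> reflect l ` ?S" if "D' 0 0 z \<noteq> 0" for z
      using that closure_subset[of "{z. D 0 0 z \<noteq> 0}"]
      by (intro image_eqI[of _ _ "reflect l z"]) (auto simp: D'_def)
  qed
  then have "(LBINT z:rect l T. y z * (D' 2 0 z - D' 0 2 z)) = - (LBINT z:rect l T. G z * D' 0 0 z)"
    using assms by (simp add: weak_wave_def)
  then show "(LBINT z:rect l T. y (reflect l z) * (D 2 0 z - D 0 2 z)) = - (LBINT z:rect l T. G (reflect l z) * D 0 0 z)"
    using integral_reflect[of l T "\<lambda>z. y z * (D' 2 0 z - D' 0 2 z)"] integral_reflect[of l T "\<lambda>z. G z * D' 0 0 z"]
    by (simp add: D'_def)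
qed

section \<open>Time regularity\<close>

lemma product_integral:
  fixes f g :: "real \<Rightarrow> real"
  assumes f: "integrable lborel f" "\<And>x. f x \<ge> 0" and g: "integrable lborel g" "\<And>x. g x \<ge> 0"
  shows "integrable lborel (\<lambda>z. f (fst z) * g (snd z))"
    and "(LBINT z. f (fst z) * g (snd z)) = (LBINT x. f x) * (LBINT x. g x)"
proof -
  have [measurable]: "f \<in> borel_measurable borel" "g \<in> borel_measurable borel"
    using f(1) g(1) by (auto dest: borel_measurable_integrable)
  have F: "(\<lambda>z :: real \<times> real. f (fst z) * g (snd z)) \<in> borel_measurable borel" by measurable
  have I: "(LBINT x. g x) \<ge> 0" using g by (auto intro!: integral_nonneg_AE)
  have inner: "(\<integral>\<^sup>+t. ennreal (f (fst (x, t)) * g (snd (x, t))) \<partial>lborel) = ennreal (f x * (LBINT x. g x))" for x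
    using f(2) g I by (simp add: ennreal_mult nn_integral_cmult nn_integral_eq_integral)
  have k: "integrable lborel (\<lambda>x. f x * (LBINT x. g x))" "\<And>x. f x * (LBINT x. g x) \<ge> 0" using f I by auto
  have "f (fst z) * g (snd z) \<ge> 0" for z :: "real \<times> real" using f g by simp
  from nonneg_integral_fst[OF F this k inner]
  show "integrable lborel (\<lambda>z. f (fst z) * g (snd z))"
    "(LBINT z. f (fst z) * g (snd z)) = (LBINT x. f x) * (LBINT x. g x)" by simp_all
qed

lemma cutoff_deriv_integral:
  assumes "d > 0"
  shows "integrable lborel (\<lambda>z. cutoff d 1 (z - a))" "(LBINT z. cutoff d 1 (z - a)) = 1"
    "integrable lborel (\<lambda>z. cutoff d 1 (a - z))" "(LBINT z. cutoff d 1 (a - z)) = 1"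
proof -
  have i: "integrable lborel (cutoff d 1)"
    using cutoff_deriv_nonneg[OF assms] nn_integral_cutoff_deriv[OF assms] by (intro integrableI_nonneg) auto
  have I: "(LBINT z. cutoff d 1 z) = 1"
    using cutoff_deriv_nonneg[OF assms] nn_integral_cutoff_deriv[OF assms] by (subst integral_eq_nn_integral) auto
  show "integrable lborel (\<lambda>z. cutoff d 1 (z - a))" "integrable lborel (\<lambda>z. cutoff d 1 (a - z))"
    using lborel_integrable_real_affine[OF i, of 1 "-a"] lborel_integrable_real_affine[OF i, of "-1" a] by simp_all
  show "(LBINT z. cutoff d 1 (z - a)) = 1" "(LBINT z. cutoff d 1 (a - z)) = 1"
    using lborel_integral_real_affine[of 1 "cutoff d 1" "-a"] lborel_integral_real_affine[of "-1" "cutoff d 1" a] I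
    by simp_all
qed

text \<open>The weak time derivative is tested with \<open>b x * d \<tau>\<close>, where
  \<open>b\<close> has mass 1 and concentrates at \<open>x0\<close>, and \<open>d\<close> is a
  smoothed indicator of \<open>{s..t}\<close>, whose derivative is a difference of approximate
  identities at \<open>s\<close> and \<open>t\<close>. As the bound \<open>N\<close> does not depend
  on \<open>x\<close>, the estimate survives the concentration.\<close>

lemma time_variation_interior:
  assumes cont: "continuous_on (crect l T) u" and w: "weak_pderiv l T 1 0 u g"
    and N: "integrable lborel N" "\<And>t. N t \<ge> 0"
    and gN: "AE z\<in>rect l T in lborel. \<bar>g z\<bar> \<le> N (snd z)"
    and x0: "0 < x0" "x0 < l" and st: "0 < s" "s < t" "t < T"
  shows "\<bar>u (x0, t) - u (x0, s)\<bar> \<le> (LINT \<tau>:{s..t}|lborel. N \<tau>)"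
proof -
  \<comment> \<open>With \<open>e \<le> m\<close> the kernels, reaching \<open>2 e\<close> from
    their centres, stay inside the rectangle, and those at \<open>s\<close> and \<open>t\<close> do
    not meet.\<close>
  define m where "m = Min {l - x0, t - s, s, T - t} / 4"
  have m: "m > 0" "4 * m \<le> l - x0" "4 * m \<le> t - s" "4 * m \<le> s" "4 * m \<le> T - t"
    using x0 st by (auto simp: m_def)
  define e where "e n = m / real (Suc n)" for n
  have e: "\<And>n. e n > 0" "e \<longlonglongrightarrow> 0" "\<And>n. e n \<le> m"
  proof -
    have "(\<lambda>n. m * (1 / real (Suc n))) \<longlonglongrightarrow> m * 0"
      by (intro tendsto_mult_left LIMSEQ_Suc[OF lim_1_over_n])
    then show "e \<longlonglongrightarrow> 0" by (simp add: e_def[abs_def])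
    show "e n > 0" "e n \<le> m" for n using m(1) by (auto simp: e_def divide_le_eq)
  qed
  define k1 where "k1 n z = cutoff (e n) 1 (fst z - x0) * cutoff (e n) 1 (snd z - s)" for n z
  define k2 where "k2 n z = cutoff (e n) 1 (fst z - x0) * cutoff (e n) 1 (t - snd z)" for n z
  have supp: "d < z \<and> z < 2 * d" if "d > 0" "cutoff d 1 z \<noteq> 0" for d z
    using cutoff_deriv_0[OF that(1), of z 0] that by fastforce
  have near: "dist z (x0, t0) < \<delta> \<and> (u (x0, t0) \<noteq> 0 \<longrightarrow> z \<in> rect l T)"
    if en: "4 * e n < \<delta>" and z: "e n < fst z - x0" "fst z - x0 < 2 * e n" "\<bar>snd z - t0\<bar> < 2 * e n"
      and t0: "t0 \<in> {s, t}" for n \<delta> z t0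
  proof -
    have "dist z (x0, t0) \<le> \<bar>fst z - x0\<bar> + \<bar>snd z - t0\<bar>"
      using dist_Pair_le[of "fst z" "snd z" x0 t0] by simp
    also have "\<dots> < \<delta>" using z en e(1)[of n] by auto
    moreover have "z \<in> rect l T"
      using z t0 m e(1)[of n] e(3)[of n] x0 st by (auto simp: rect_def mem_Times_iff abs_less_iff)
    ultimately show ?thesis by auto
  qed
  have evn: "\<forall>\<^sub>F n in sequentially. 4 * e n < \<delta>" if "\<delta> > 0" for \<delta>
    using order_tendstoD(2)[OF e(2), of "\<delta> / 4"] that by (auto elim: eventually_mono)
  have lim: "(\<lambda>n. LBINT z:rect l T. u z * (cutoff (e n) 1 (fst z - x0) * \<kappa> n (snd z))) \<longlonglongrightarrow> 1 * u (x0, t0)"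
    if t0: "t0 \<in> {s, t}" and \<kappa>: "\<And>n v. \<kappa> n v = cutoff (e n) 1 (v - t0) \<or> \<kappa> n v = cutoff (e n) 1 (t0 - v)"
      "\<And>n. continuous_on UNIV (\<kappa> n)" "\<And>n. integrable lborel (\<kappa> n)" "\<And>n. integral\<^sup>L lborel (\<kappa> n) = 1" for t0 \<kappa>
  proof (rule approximate_identity[OF cont])
    have \<kappa>0: "\<kappa> n v \<ge> 0" for n v using \<kappa>(1)[of n v] cutoff_deriv_nonneg[OF e(1)] by metis
    show "\<forall>\<^sub>F n in sequentially. \<forall>z. cutoff (e n) 1 (fst z - x0) * \<kappa> n (snd z) \<noteq> 0 \<longrightarrow>
        dist z (x0, t0) < \<delta> \<and> (u (x0, t0) \<noteq> 0 \<longrightarrow> z \<in> rect l T)" if "\<delta> > 0" for \<delta>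
      using evn[OF that]
    proof eventually_elim
      case (elim n)
      show ?case
      proof (intro allI impI)
        fix z assume z: "cutoff (e n) 1 (fst z - x0) * \<kappa> n (snd z) \<noteq> 0"
        then have "\<bar>snd z - t0\<bar> < 2 * e n"
          using supp[OF e(1), of n "snd z - t0"] supp[OF e(1), of n "t0 - snd z"] \<kappa>(1)[of n "snd z"] e(1)[of n] by auto
        then show "dist z (x0, t0) < \<delta> \<and> (u (x0, t0) \<noteq> 0 \<longrightarrow> z \<in> rect l T)"
          using z supp[OF e(1), of n "fst z - x0"] by (intro near[OF elim _ _ _ t0]) auto
      qed
    qed
    show "cutoff (e n) 1 (fst z - x0) * \<kappa> n (snd z) \<ge> 0" for n z
      by (intro mult_nonneg_nonneg cutoff_deriv_nonneg e \<kappa>0)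
    show "continuous_on UNIV (\<lambda>z. cutoff (e n) 1 (fst z - x0) * \<kappa> n (snd z))" for n
      by (intro continuous_intros continuous_on_compose2[OF \<kappa>(2)]) auto
    show "integrable lborel (\<lambda>z. cutoff (e n) 1 (fst z - x0) * \<kappa> n (snd z))"
      "(LBINT z. cutoff (e n) 1 (fst z - x0) * \<kappa> n (snd z)) = 1" for n
      using product_integral[OF cutoff_deriv_integral(1)[OF e(1)[of n], of x0] _ \<kappa>(3)[of n] \<kappa>0]
        cutoff_deriv_nonneg[OF e(1)[of n]] cutoff_deriv_integral(2)[OF e(1)[of n]] \<kappa>(4)[of n] by auto
  qed (use x0 st t0 in auto)
  have L1: "(\<lambda>n. LBINT z:rect l T. u z * k1 n z) \<longlonglongrightarrow> 1 * u (x0, s)"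
    unfolding k1_def by (intro lim cutoff_deriv_integral e continuous_intros) auto
  have L2: "(\<lambda>n. LBINT z:rect l T. u z * k2 n z) \<longlonglongrightarrow> 1 * u (x0, t)"
    unfolding k2_def by (intro lim cutoff_deriv_integral e continuous_intros) auto
  define I where "I = (LINT \<tau>:{s..t}|lborel. N \<tau>)"
  have bound: "\<bar>(LBINT z:rect l T. u z * k2 n z) - (LBINT z:rect l T. u z * k1 n z)\<bar> \<le> I" for n
  proof -
    let ?e = "e n"
    have e0: "?e > 0" by (rule e)
    have e4: "4 * ?e \<le> l - x0" "4 * ?e \<le> t - s" using m e(3)[of n] by auto
    \<comment> \<open>The index is shifted: \<open>b 0\<close> is already the derivative of a
      cutoff, hence of mass 1.\<close>
    define b where "b k z = cutoff ?e (Suc k) (z - x0)" for k z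
    have "smooth1 b"
      using smooth1_affine[OF smooth1_cutoff, of 1 ?e "-x0"] by (simp add: b_def[abs_def] smooth1_def)
    define d1 where "d1 k z = cutoff ?e k (z - s)" for k z
    define d2 where "d2 k z = (-1) ^ k * cutoff ?e k (t - z)" for k z
    have "smooth1 d1" "smooth1 d2"
      using smooth1_affine[OF smooth1_cutoff, of 1 ?e "-s"] smooth1_affine[OF smooth1_cutoff, of "-1" ?e t]
      by (simp_all add: d1_def[abs_def] d2_def[abs_def])
    then obtain d where d: "smooth1 d" "d 0 = (\<lambda>z. d1 0 z * d2 0 z)" "d 1 = (\<lambda>z. d1 1 z * d2 0 z + d1 0 z * d2 1 z)"
      using smooth1_mult by blast
    \<comment> \<open>The two ramps of \<open>d\<close> are disjoint because
      \<open>t - s \<ge> 4 e\<close>: each factor equals 1 where the other one varies.\<close>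
    have d1eq: "d 1 \<tau> = cutoff ?e 1 (\<tau> - s) - cutoff ?e 1 (t - \<tau>)" for \<tau>
    proof -
      have "cutoff ?e 1 (\<tau> - s) * cutoff ?e 0 (t - \<tau>) = cutoff ?e 1 (\<tau> - s)"
        using supp[OF e0, of "\<tau> - s"] cutoff_right[OF e0, of "t - \<tau>"] e4 by (cases "cutoff ?e 1 (\<tau> - s) = 0") auto
      moreover have "cutoff ?e 0 (\<tau> - s) * cutoff ?e 1 (t - \<tau>) = cutoff ?e 1 (t - \<tau>)"
        using supp[OF e0, of "t - \<tau>"] cutoff_right[OF e0, of "\<tau> - s"] e4 by (cases "cutoff ?e 1 (t - \<tau>) = 0") auto
      ultimately show ?thesis unfolding d(3) d1_def d2_def by auto
    qed
    obtain D where D: "smooth_family D" "\<And>x \<tau>. D 0 0 (x, \<tau>) = b 0 x * d 0 \<tau>" "\<And>x \<tau>. D 1 0 (x, \<tau>) = b 0 x * d 1 \<tau>"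
      using ex_product_family[OF \<open>smooth1 b\<close> d(1) smooth1_const[of 1] smooth1_const[of 1]] by auto
    have b0: "b 0 z \<ge> 0" for z using cutoff_deriv_nonneg[OF e0] by (simp add: b_def)
    have d0: "0 \<le> d 0 z" "d 0 z \<le> indicat_real {s..t} z" for z
      using cutoff_mem[of ?e "z - s"] cutoff_mem[of ?e "t - z"] cutoff_left[OF e0, of "z - s"] cutoff_left[OF e0, of "t - z"] e0
      by (auto simp: d(2) d1_def d2_def indicator_def mult_le_one)
    have test: "test_fun l T D"
    proof (rule test_funI[OF D(1), of "{x0 + ?e..x0 + 2 * ?e} \<times> {s + ?e..t - ?e}"])
      show "{x0 + ?e..x0 + 2 * ?e} \<times> {s + ?e..t - ?e} \<subseteq> rect l T"
        using e0 e4 x0 st by (auto simp: rect_def)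
      fix z assume "D 0 0 z \<noteq> 0"
      then have "cutoff ?e 1 (fst z - x0) \<noteq> 0" "cutoff ?e 0 (snd z - s) \<noteq> 0" "cutoff ?e 0 (t - snd z) \<noteq> 0"
        using D(2)[of "fst z" "snd z"] by (auto simp: b_def d(2) d1_def d2_def)
      then have "?e < fst z - x0" "fst z - x0 < 2 * ?e" "?e < snd z - s" "?e < t - snd z"
        using supp[OF e0] cutoff_left[OF e0] by (auto simp: not_le[symmetric])
      then show "z \<in> {x0 + ?e..x0 + 2 * ?e} \<times> {s + ?e..t - ?e}"
        by (auto simp: mem_Times_iff)
    qed (auto intro: compact_Times)
    have gi: "set_integrable lborel (rect l T) (\<lambda>z. g z * D 0 0 z)"
      using w by (intro test_fun_integrable[OF test]) (auto simp: weak_pderiv_def)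
    have ki: "set_integrable lborel (rect l T) (\<lambda>z. u z * k1 n z)" "set_integrable lborel (rect l T) (\<lambda>z. u z * k2 n z)"
      unfolding k1_def k2_def by (intro set_integrable_rect_continuous continuous_intros cont)+
    have D10: "u z * D 1 0 z = u z * k1 n z - u z * k2 n z" for z
    proof -
      have "D 1 0 z = k1 n z - k2 n z"
        using D(3)[of "fst z" "snd z"] d1eq[of "snd z"] by (simp add: b_def k1_def k2_def right_diff_distrib)
      then show ?thesis by (simp add: right_diff_distrib)
    qed
    have eq: "(LBINT z:rect l T. u z * k2 n z) - (LBINT z:rect l T. u z * k1 n z) = (LBINT z:rect l T. g z * D 0 0 z)"
      using w[unfolded weak_pderiv_def, THEN conjunct2, rule_format, OF test] set_integral_diff(2)[OF ki]
      unfolding D10 by simp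
    define h where "h z = b 0 (fst z) * (indicat_real {s..t} (snd z) * N (snd z))" for z
    have Ni: "integrable lborel (\<lambda>\<tau>. indicat_real {s..t} \<tau> * N \<tau>)"
      using integrable_mult_indicator[OF _ N(1), of "{s..t}"] by simp
    have bi: "integrable lborel (b 0)" "(LBINT x. b 0 x) = 1"
      using cutoff_deriv_integral(1,2)[OF e0, of x0] by (simp_all add: b_def[abs_def])
    have h: "integrable lborel h" "integral\<^sup>L lborel h = I"
      unfolding h_def[abs_def] I_def set_lebesgue_integral_def
      using product_integral[OF bi(1) b0 Ni] N(2) bi(2) by auto
    have h0: "h z \<ge> 0" for z using b0 N(2) by (simp add: h_def)
    have "\<bar>LBINT z:rect l T. g z * D 0 0 z\<bar> \<le> (LBINT z:rect l T. \<bar>g z * D 0 0 z\<bar>)"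
      using set_integral_norm_bound[OF gi] by simp
    also have "\<dots> \<le> integral\<^sup>L lborel h"
      unfolding set_lebesgue_integral_def
    proof (rule integral_mono_AE)
      show "integrable lborel (\<lambda>z. indicat_real (rect l T) z *\<^sub>R \<bar>g z * D 0 0 z\<bar>)"
        using set_integrable_abs[OF gi] by (simp add: set_integrable_def)
      show "AE z in lborel. indicat_real (rect l T) z *\<^sub>R \<bar>g z * D 0 0 z\<bar> \<le> h z"
        using gN
      proof eventually_elim
        case (elim z)
        show ?case
        proof (cases "z \<in> rect l T")
          case True
          have D0z: "D 0 0 z = b 0 (fst z) * d 0 (snd z)" using D(2)[of "fst z" "snd z"] by simp
          have "\<bar>g z * D 0 0 z\<bar> = \<bar>g z\<bar> * (b 0 (fst z) * d 0 (snd z))"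
            using b0 d0(1) by (simp add: D0z abs_mult)
          also have "\<dots> \<le> N (snd z) * (b 0 (fst z) * indicat_real {s..t} (snd z))"
            using elim True b0 d0 by (intro mult_mono mult_left_mono mult_nonneg_nonneg) auto
          finally show ?thesis using True by (simp add: h_def mult_ac)
        qed (use h0 in simp)
      qed
    qed (rule h)
    finally show ?thesis by (simp add: eq h)
  qed
  have "\<bar>1 * u (x0, t) - 1 * u (x0, s)\<bar> \<le> I"
    by (rule LIMSEQ_le_const2[OF tendsto_rabs[OF tendsto_diff[OF L2 L1]]]) (use bound in auto)
  then show ?thesis by (simp add: I_def)
qed

text \<open>\<open>\<mu>\<close> is the primitive of \<open>|M|\<close>, which is integrable on the
  bounded interval since \<open>|a| \<le> 1 + a^2\<close>. The interior estimate extends to the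
  closed rectangle by continuity.\<close>

lemma time_variation:
  assumes "0 < l" "0 < T" and cont: "continuous_on (crect l T) u" and w: "weak_pderiv l T 1 0 u g"
    and M: "set_borel_measurable lborel {0<..<T} M" "set_integrable lborel {0<..<T} (\<lambda>t. (M t)\<^sup>2)"
    and gM: "AE z\<in>rect l T in lborel. \<bar>g z\<bar> \<le> M (snd z)"
  obtains \<mu> where "continuous_on {0..T} \<mu>" "\<mu> 0 = 0"
    "\<And>x s t. x \<in> {0..l} \<Longrightarrow> 0 \<le> s \<Longrightarrow> s \<le> t \<Longrightarrow> t \<le> T \<Longrightarrow> \<bar>u (x, t) - u (x, s)\<bar> \<le> \<mu> t - \<mu> s"
proof -
  define N where "N t = \<bar>indicat_real {0<..<T} t * M t\<bar>" for t
  have Nm: "N \<in> borel_measurable borel"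
    using M(1) unfolding N_def[abs_def] set_borel_measurable_def by simp
  have N0: "N t \<ge> 0" for t by (simp add: N_def)
  have N: "integrable lborel N"
  proof (rule Bochner_Integration.integrable_bound[of _ "\<lambda>t. indicat_real {0<..<T} t + indicat_real {0<..<T} t *\<^sub>R (M t)\<^sup>2"])
    show "integrable lborel (\<lambda>t. indicat_real {0<..<T} t + indicat_real {0<..<T} t *\<^sub>R (M t)\<^sup>2)"
      using M(2) unfolding set_integrable_def
      by (intro Bochner_Integration.integrable_add integrable_real_indicator) (use \<open>0 < T\<close> in auto)
    have "\<bar>a\<bar> \<le> 1 + a\<^sup>2" for a :: real
      using sum_squares_bound[of 1 "\<bar>a\<bar>"] by (simp add: power2_eq_square)
    then show "AE t in lborel. norm (N t) \<le> norm (indicat_real {0<..<T} t + indicat_real {0<..<T} t *\<^sub>R (M t)\<^sup>2)"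
      by (intro AE_I2) (auto simp: N_def indicator_def)
  qed (use Nm in simp)
  have gN: "AE z\<in>rect l T in lborel. \<bar>g z\<bar> \<le> N (snd z)"
    using gM by eventually_elim (auto simp: N_def rect_def)
  have Nint: "N integrable_on {a..b}" for a b
    using set_borel_integral_eq_integral(1)[of "{a..b}" N] integrable_mult_indicator[OF _ N, of "{a..b}"]
    by (simp add: set_integrable_def)
  define \<mu> where "\<mu> t = integral {0..t} N" for t
  have \<mu>_cont: "continuous_on {0..T} \<mu>"
    unfolding \<mu>_def by (intro indefinite_integral_continuous_1 Nint)
  have int: "\<bar>u (x, t) - u (x, s)\<bar> \<le> \<mu> t - \<mu> s" if "0 < x" "x < l" "0 < s" "s < t" "t < T" for x s t
  proof -
    have "(LINT \<tau>:{s..t}|lborel. N \<tau>) = integral {s..t} N"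
      using set_borel_integral_eq_integral(2)[of "{s..t}" N] integrable_mult_indicator[OF _ N, of "{s..t}"]
      by (simp add: set_integrable_def)
    also have "\<dots> = \<mu> t - \<mu> s"
      unfolding \<mu>_def using Henstock_Kurzweil_Integration.integral_combine[of 0 s t N] Nint that by simp
    finally show ?thesis using time_variation_interior[OF cont w N N0 gN that] by simp
  qed
  have "\<bar>u (x, t) - u (x, s)\<bar> \<le> \<mu> t - \<mu> s" if x: "x \<in> {0..l}" and st: "0 \<le> s" "s \<le> t" "t \<le> T" for x s t
  proof (cases "s = t")
    case False
    define i where "i n = 1 / real (Suc (Suc n))" for n
    have i: "i \<longlonglongrightarrow> 0" "\<And>n. 0 < i n" "\<And>n. i n < 1"
      using LIMSEQ_Suc[OF LIMSEQ_Suc[OF lim_1_over_n]] by (simp_all add: i_def[abs_def])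
    \<comment> \<open>A convex combination of \<open>v\<close> with the midpoint
      \<open>L / 2\<close>: it tends to \<open>v\<close> from inside the open interval and preserves
      the order of \<open>s\<close> and \<open>t\<close>.\<close>
    define c where "c L v n = v + (L / 2 - v) * i n" for L v n
    have cl: "c L v \<longlonglongrightarrow> v" for L v
      unfolding c_def[abs_def] using tendsto_add[OF tendsto_const tendsto_mult_left[OF i(1), of "L / 2 - v"], of v] by simp
    have ceq: "c L v n = (1 - i n) * v + i n * (L / 2)" for L v n by (simp add: c_def algebra_simps)
    have cmem: "0 < c L v n" "c L v n < L" if "0 < L" "0 \<le> v" "v \<le> L" for L v n
    proof -
      show "0 < c L v n" unfolding ceq using that i(2,3)[of n] by (intro add_nonneg_pos mult_nonneg_nonneg mult_pos_pos) (auto simp: less_imp_le)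
      have "c L v n \<le> (1 - i n) * L + i n * (L / 2)"
        unfolding ceq using that i(3)[of n] by (intro add_right_mono mult_left_mono) auto
      also have "\<dots> < L" using i(2)[of n] that by (simp add: algebra_simps)
      finally show "c L v n < L" .
    qed
    have lt: "c T s n < c T t n" for n
      unfolding ceq using i(3)[of n] st False by (intro add_strict_right_mono mult_strict_left_mono) auto
    have ul: "(\<lambda>n. u (c l x n, c T v n)) \<longlonglongrightarrow> u (x, v)" if "0 \<le> v" "v \<le> T" for v
    proof (rule continuous_on_tendsto_compose[OF cont])
      show "(\<lambda>n. (c l x n, c T v n)) \<longlonglongrightarrow> (x, v)" by (intro tendsto_Pair cl)
      show "(x, v) \<in> crect l T" using x that by auto
      show "\<forall>\<^sub>F n in sequentially. (c l x n, c T v n) \<in> crect l T"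
        using cmem[of l x] cmem[of T v] x that \<open>0 < l\<close> \<open>0 < T\<close> by (auto simp: less_imp_le)
    qed
    have \<mu>l: "(\<lambda>n. \<mu> (c T v n)) \<longlonglongrightarrow> \<mu> v" if "0 \<le> v" "v \<le> T" for v
      by (rule continuous_on_tendsto_compose[OF \<mu>_cont cl])
        (use cmem[of T v] that \<open>0 < T\<close> in \<open>auto simp: less_imp_le\<close>)
    show ?thesis
    proof (rule LIMSEQ_le[OF tendsto_rabs[OF tendsto_diff[OF ul ul]] tendsto_diff[OF \<mu>l \<mu>l]])
      show "\<exists>n0. \<forall>n\<ge>n0. \<bar>u (c l x n, c T t n) - u (c l x n, c T s n)\<bar> \<le> \<mu> (c T t n) - \<mu> (c T s n)"
        using int lt cmem[of l x] cmem[of T s] cmem[of T t] x st \<open>0 < l\<close> \<open>0 < T\<close> by auto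
    qed (use st in auto)
  qed simp
  then show thesis using that \<mu>_cont by (simp add: \<mu>_def)
qed

section \<open>Uniqueness on a segment\<close>

text \<open>The exceptional set in the open interval is open and null, hence empty; continuity
  reaches the end-points. This turns initial conditions given almost everywhere into pointwise
  ones.\<close>

lemma AE_continuous_le:
  fixes h :: "real \<Rightarrow> real"
  assumes "0 < l" "continuous_on {0..l} h" "AE x\<in>{0<..<l} in lborel. h x \<le> c" "x \<in> {0..l}"
  shows "h x \<le> c"
proof -
  let ?S = "{x \<in> {0<..<l}. c < h x}"
  have op: "open ?S"
  proof -
    have "continuous_on {0<..<l} h" using assms(2) by (rule continuous_on_subset) auto
    then have "open (h -` {c<..} \<inter> {0<..<l})" by (rule continuous_on_open_vimage[THEN iffD1, rule_format, rotated]) auto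
    moreover have "h -` {c<..} \<inter> {0<..<l} = ?S" by auto
    ultimately show ?thesis by simp
  qed
  have "negligible ?S"
  proof -
    have "AE x in lborel. x \<notin> ?S" using assms(3) by eventually_elim auto
    then have "?S \<in> null_sets lborel" using op by (subst AE_iff_null_sets) auto
    then show ?thesis unfolding negligible_iff_null_sets by (rule null_sets_completionI)
  qed
  then have "?S = {}" using open_not_negligible[OF op] by blast
  then have le: "h x \<le> c" if "x \<in> {0<..<l}" for x using that by force
  have "closure {0<..<l} = {0..l}" using assms(1) by simp
  then show ?thesis
    using continuous_le_on_closure[of "{0<..<l}" h x c] assms le by auto
qed

text \<open>Of the trapezoid where \<open>y\<close> vanishes only the rectangle
  \<open>t \<le> T - l\<close> is kept: it is the same for both orientations, and it gives both
  nodes of the segment the same time interval.\<close>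

lemma edge_uniqueness:
  assumes l: "0 < l" "l \<le> T" and r: "0 < r" and e: "e = 0 \<or> e = l"
    and p: "p \<in> borel_measurable borel" "\<And>x. \<bar>p x\<bar> \<le> K"
    and f: "f \<in> borel_measurable borel" "\<And>x. \<bar>f x\<bar> \<le> K"
    and y_cont: "continuous_on (crect l T) y" and y'_cont: "continuous_on (crect l T) y'"
    and R_cont: "continuous_on (crect l T) R"
    and der: "\<And>x t. x \<in> {0..l} \<Longrightarrow> t \<in> {0..T} \<Longrightarrow> ((\<lambda>x. y (x, t)) has_real_derivative y' (x, t)) (at x within {0..l})"
    and wave: "weak_wave l T y (\<lambda>z. p (fst z) * y z + f (fst z) * R z)"
    and bdry: "\<And>t. t \<in> {0<..<T} \<Longrightarrow> y (e, t) = 0" "\<And>t. t \<in> {0<..<T} \<Longrightarrow> y' (e, t) = 0"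
    and init: "\<And>x. x \<in> {0..l} \<Longrightarrow> y (x, 0) = 0"
    and init_small: "\<And>\<eta>. \<eta> > 0 \<Longrightarrow> \<exists>\<delta>>0. \<forall>(x, t) \<in> rect l T. t \<le> \<delta> \<longrightarrow> \<bar>y (x, t)\<bar> \<le> \<eta> * t"
    and R_lower: "\<And>x. x \<in> {0..l} \<Longrightarrow> r \<le> \<bar>R (x, 0)\<bar>"
    and \<mu>: "continuous_on {0..T} \<mu>" "\<mu> 0 = 0"
    and R_\<mu>: "\<And>x s t. x \<in> {0..l} \<Longrightarrow> 0 \<le> s \<Longrightarrow> s \<le> t \<Longrightarrow> t \<le> T \<Longrightarrow> \<bar>R (x, t) - R (x, s)\<bar> \<le> \<mu> t - \<mu> s"
  shows "(AE x\<in>{0<..<l} in lborel. f x = 0) \<and> (\<forall>x\<in>{0..l}. \<forall>t\<in>{0..T - l}. y (x, t) = 0)"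
proof -
  obtain B where B: "\<And>z. z \<in> crect l T \<Longrightarrow> \<bar>R z\<bar> \<le> B"
    using continuous_rectangle_bounded[OF R_cont] by blast
  show ?thesis
    using e
  proof
    assume "e = 0"
    interpret sideways l T K B r p f y y' R \<mu>
      using l r p f y_cont y'_cont R_cont B der wave bdry init init_small R_lower \<mu> R_\<mu>
      unfolding \<open>e = 0\<close> by unfold_locales
    show ?thesis using source_zero solution_zero by auto
  next
    assume e: "e = l"
    have cont: "continuous_on (crect l T) (\<lambda>z. w (reflect l z))"
      if "continuous_on (crect l T) w" for w :: "real \<times> real \<Rightarrow> real"
      by (rule continuous_on_compose2[OF that continuous_on_reflect]) (auto simp: reflect_def)
    have fm: "(\<lambda>x. p (l - x)) \<in> borel_measurable borel" "(\<lambda>x. f (l - x)) \<in> borel_measurable borel"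
      using p(1) f(1) by measurable
    have der': "((\<lambda>x. y (reflect l (x, t))) has_real_derivative - y' (reflect l (x, t))) (at x within {0..l})"
      if "x \<in> {0..l}" "t \<in> {0..T}" for x t
    proof -
      have "(((\<lambda>x. y (x, t)) \<circ> (\<lambda>x. l - x)) has_real_derivative y' (l - x, t) * (-1)) (at x within {0..l})"
      proof (rule DERIV_image_chain)
        show "((\<lambda>x. y (x, t)) has_real_derivative y' (l - x, t)) (at (l - x) within (\<lambda>x. l - x) ` {0..l})"
          using der[of "l - x" t] that by (auto intro: DERIV_subset)
        show "((\<lambda>x. l - x) has_real_derivative -1) (at x within {0..l})"
          by (auto intro!: derivative_eq_intros)
      qed
      then show ?thesis by (simp add: reflect_def comp_def)
    qed
    have wave': "weak_wave l T (\<lambda>z. y (reflect l z)) (\<lambda>z. p (l - fst z) * y (reflect l z) + f (l - fst z) * R (reflect l z))"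
      using weak_wave_reflect[OF wave] by (simp add: reflect_def)
    have small': "\<exists>\<delta>>0. \<forall>(x, t) \<in> rect l T. t \<le> \<delta> \<longrightarrow> \<bar>y (reflect l (x, t))\<bar> \<le> \<eta> * t" if "\<eta> > 0" for \<eta>
    proof -
      obtain \<delta> where \<delta>: "\<delta> > 0" "\<And>x t. (x, t) \<in> rect l T \<Longrightarrow> t \<le> \<delta> \<Longrightarrow> \<bar>y (x, t)\<bar> \<le> \<eta> * t"
        using init_small[OF \<open>\<eta> > 0\<close>] by fast
      have "\<bar>y (reflect l (x, t))\<bar> \<le> \<eta> * t" if "(x, t) \<in> rect l T" "t \<le> \<delta>" for x t
        using \<delta>(2)[of "l - x" t] that reflect_rect[of l "(x, t)" T] by (simp add: reflect_def)
      then show ?thesis using \<delta>(1) by blast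
    qed
    \<comment> \<open>Reflection moves the data from \<open>x = l\<close> to \<open>x = 0\<close>;
      the space derivative changes sign.\<close>
    interpret refl: sideways l T K B r "\<lambda>x. p (l - x)" "\<lambda>x. f (l - x)" "\<lambda>z. y (reflect l z)"
      "\<lambda>z. - y' (reflect l z)" "\<lambda>z. R (reflect l z)" \<mu>
    proof
      show "\<bar>R (reflect l z)\<bar> \<le> B" if "z \<in> crect l T" for z
        by (rule B) (use that in \<open>auto simp: reflect_def\<close>)
      show "y (reflect l (0, t)) = 0" "- y' (reflect l (0, t)) = 0" if "t \<in> {0<..<T}" for t
        using bdry that e by (simp_all add: reflect_def)
      show "y (reflect l (x, 0)) = 0" "r \<le> \<bar>R (reflect l (x, 0))\<bar>" if "x \<in> {0..l}" for x
        using init[of "l - x"] R_lower[of "l - x"] that by (auto simp: reflect_def)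
      show "\<bar>R (reflect l (x, t)) - R (reflect l (x, s))\<bar> \<le> \<mu> t - \<mu> s"
        if "x \<in> {0..l}" "0 \<le> s" "s \<le> t" "t \<le> T" for x s t
        using R_\<mu>[of "l - x" s t] that by (simp add: reflect_def)
    qed (fact l r fm p(2) f(2) cont[OF y_cont] continuous_on_minus[OF cont[OF y'_cont]] cont[OF R_cont] der' wave' small' \<mu>)+
    have U1: "AE x\<in>{0<..<l} in lborel. f (l - x) = 0" by (rule refl.source_zero)
    have U2: "y (l - x, t) = 0" if "0 \<le> x" "x \<le> l" "0 \<le> t" "x + t \<le> T" for x t
      using refl.solution_zero[OF that] by (simp add: reflect_def)
    have "AE x\<in>{0<..<l} in lborel. f x = 0"
    proof -
      have "AE x in distr lborel borel (\<lambda>x. l - x). x \<in> {0<..<l} \<longrightarrow> f x = 0"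
      proof (subst AE_distr_iff)
        show "{x \<in> space borel. x \<in> {0<..<l} \<longrightarrow> f x = 0} \<in> sets borel" using f(1) by measurable
        show "AE x in lborel. l - x \<in> {0<..<l} \<longrightarrow> f (l - x) = 0"
          using U1 by eventually_elim auto
      qed simp
      then show ?thesis unfolding distr_lborel_minus .
    qed
    moreover have "y (x, t) = 0" if "x \<in> {0..l}" "t \<in> {0..T - l}" for x t
      using U2[of "l - x" t] that by auto
    ultimately show ?thesis by blast
  qed
qed

lemma wave_solution_segment:
  assumes "wave_solution N l im tm p u0 u1 h T u" "j \<le> N"
  shows "continuous_on (crect (l j) T) (\<lambda>z. u j (fst z) (snd z))" (is ?thesis1)
    and "\<And>x t. x \<in> {0..l j} \<Longrightarrow> t \<in> {0..T} \<Longrightarrow>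
      ((\<lambda>x. u j x t) has_real_derivative dx u l j x t) (at x within {0..l j})"
    and "continuous_on (crect (l j) T) (\<lambda>z. dx u l j (fst z) (snd z))" (is ?thesis3)
    and "\<exists>gtt gxx. weak_pderiv (l j) T 2 0 (\<lambda>z. u j (fst z) (snd z)) gtt \<and>
      weak_pderiv (l j) T 0 2 (\<lambda>z. u j (fst z) (snd z)) gxx \<and>
      (AE z\<in>rect (l j) T in lborel. gtt z - gxx z + p j (fst z) * u j (fst z) (snd z) = 0)" (is ?thesis4)
    and "AE x\<in>{0<..<l j} in lborel. u j x 0 = u0 j x" (is ?thesis5)
    and "\<And>\<epsilon>. \<epsilon> > 0 \<Longrightarrow> \<exists>\<delta>>0. \<forall>t. 0 < t \<and> t < \<delta> \<longrightarrow>
      (AE x\<in>{0<..<l j} in lborel. \<bar>(u j x t - u j x 0) / t - u1 j x\<bar> \<le> \<epsilon>)"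
      (is "\<And>\<epsilon>. _ \<Longrightarrow> ?thesis6 \<epsilon>")
proof -
  note W = assms(1)[unfolded wave_solution_def, THEN conjunct1, rule_format, OF assms(2)]
  show ?thesis1 using W by (elim conjE)
  show "((\<lambda>x. u j x t) has_real_derivative dx u l j x t) (at x within {0..l j})"
    if "x \<in> {0..l j}" "t \<in> {0..T}" for x t
  proof -
    have "(\<lambda>x. u j x t) differentiable (at x within {0..l j})" using W that by (elim conjE) blast
    then show ?thesis
      by (simp add: dx_def has_real_derivative_iff_has_vector_derivative vector_derivative_works)
  qed
  show ?thesis3 using W by (elim conjE)
  show ?thesis4 using W by (elim conjE)
  show ?thesis5 using W by (elim conjE)
  show "?thesis6 \<epsilon>" if "\<epsilon> > 0" for \<epsilon> using W that by (elim conjE) blast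
qed

lemma wave_solution_weak_wave:
  assumes "wave_solution N l im tm p u0 u1 h T u" "j \<le> N"
    and q: "q \<in> borel_measurable borel" "AE x\<in>{0<..<l j} in lborel. p j x = q x"
  shows "weak_wave (l j) T (\<lambda>z. u j (fst z) (snd z)) (\<lambda>z. q (fst z) * u j (fst z) (snd z))"
proof -
  note W = wave_solution_segment[OF assms(1,2)]
  obtain gtt gxx where g: "weak_pderiv (l j) T 2 0 (\<lambda>z. u j (fst z) (snd z)) gtt"
    "weak_pderiv (l j) T 0 2 (\<lambda>z. u j (fst z) (snd z)) gxx"
    "AE z\<in>rect (l j) T in lborel. gtt z - gxx z + p j (fst z) * u j (fst z) (snd z) = 0"
    using W(4) by blast
  show ?thesis
  proof (rule weak_wave_of_pde[OF W(1) g(1,2) q(1)])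
    show "AE z\<in>rect (l j) T in lborel. gtt z - gxx z + q (fst z) * u j (fst z) (snd z) = 0"
      using g(3) AE_lborel_fst[OF q(2)] by eventually_elim (auto simp: rect_def)
  qed
qed

text \<open>The solutions live up to time \<open>T\<close>, but at the end \<open>e\<close> their
  Cauchy data are known to agree only up to the time \<open>T'\<close> left over by the segments
  peeled before.\<close>

lemma segment_uniqueness:
  assumes up: "wave_solution N l im tm p u0 u1 h T up" and uq: "wave_solution N l im tm q u0 u1 h T uq"
    and H3: "H3_Linf N l T uq" and j: "j \<le> N"
    and T: "0 < l j" "l j \<le> T'" "T' \<le> T" and r: "r > 0"
    and p: "Linf_on (l j) (p j)" and q: "Linf_on (l j) (q j)"
    and u0: "AE x\<in>{0<..<l j} in lborel. \<bar>u0 j x\<bar> \<ge> r"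
    and e: "e = 0 \<or> e = l j"
    and bdry: "\<And>t. t \<in> {0<..<T'} \<Longrightarrow> up j e t = uq j e t" "\<And>t. t \<in> {0<..<T'} \<Longrightarrow> dx up l j e t = dx uq l j e t"
  shows "(AE x\<in>{0<..<l j} in lborel. p j x = q j x) \<and>
    (\<forall>x\<in>{0..l j}. \<forall>t\<in>{0..T' - l j}. up j x t = uq j x t)"
proof -
  let ?l = "l j"
  have T0: "T > 0" using T by simp
  note P = wave_solution_segment[OF up j] and Q = wave_solution_segment[OF uq j]
  obtain p1 K1 where p1: "p1 \<in> borel_measurable borel" "\<And>x. \<bar>p1 x\<bar> \<le> K1"
    "AE x\<in>{0<..<?l} in lborel. p j x = p1 x" using Linf_representative[OF p] by blast
  obtain q1 K2 where q1: "q1 \<in> borel_measurable borel" "\<And>x. \<bar>q1 x\<bar> \<le> K2"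
    "AE x\<in>{0<..<?l} in lborel. q j x = q1 x" using Linf_representative[OF q] by blast
  define f where "f x = p1 x - q1 x" for x
  have f: "f \<in> borel_measurable borel" "\<And>x. \<bar>f x\<bar> \<le> K1 + K2"
  proof -
    show "f \<in> borel_measurable borel" unfolding f_def[abs_def] using p1(1) q1(1) by simp
    show "\<bar>f x\<bar> \<le> K1 + K2" for x unfolding f_def using p1(2)[of x] q1(2)[of x] by linarith
  qed
  \<comment> \<open>\<open>edge_uniqueness\<close> takes one bound for both \<open>p\<close> and
    \<open>f\<close>.\<close>
  have p1K: "\<bar>p1 x\<bar> \<le> K1 + K2" for x using p1(2)[of x] q1(2)[of x] by linarith
  define U where "U z = up j (fst z) (snd z)" for z
  define V where "V z = uq j (fst z) (snd z)" for z
  define y where "y z = U z - V z" for z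
  define y' where "y' z = dx up l j (fst z) (snd z) - dx uq l j (fst z) (snd z)" for z
  have Uc: "continuous_on (crect ?l T) U" using P(1) by (simp add: U_def[abs_def])
  have Vc: "continuous_on (crect ?l T) V" using Q(1) by (simp add: V_def[abs_def])
  have yc: "continuous_on (crect ?l T) y" unfolding y_def[abs_def] by (intro continuous_intros Uc Vc)
  have y'c: "continuous_on (crect ?l T) y'" unfolding y'_def[abs_def] by (intro continuous_intros P(3) Q(3))
  have sub: "crect ?l T' \<subseteq> crect ?l T" using T by auto
  have slice: "continuous_on {0..?l} (\<lambda>x. w (x, t))" if "continuous_on (crect ?l T) w" "t \<in> {0..T}"
    for w :: "real \<times> real \<Rightarrow> real" and t
    using that by (intro continuous_on_compose2[OF that(1)]) (auto intro!: continuous_intros)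
  have int: "set_integrable lborel (rect ?l T) (\<lambda>z. k (fst z) * w z)"
    if "continuous_on (crect ?l T) w" "k \<in> borel_measurable borel" "\<And>x. \<bar>k x\<bar> \<le> C" for w :: "real \<times> real \<Rightarrow> real" and k C
  proof -
    have "(\<lambda>z :: real \<times> real. k (fst z)) \<in> borel_measurable borel" using that(2) by measurable
    from set_integrable_rect_times[OF set_integrable_rect_continuous[OF that(1)] this that(3)]
    show ?thesis by (simp add: mult.commute)
  qed
  have "weak_wave ?l T U (\<lambda>z. p1 (fst z) * U z)"
    using wave_solution_weak_wave[OF up j p1(1,3)] by (simp add: U_def[abs_def])
  moreover have "weak_wave ?l T V (\<lambda>z. q1 (fst z) * V z)"
    using wave_solution_weak_wave[OF uq j q1(1,3)] by (simp add: V_def[abs_def])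
  ultimately have "weak_wave ?l T (\<lambda>z. U z - V z) (\<lambda>z. p1 (fst z) * U z - q1 (fst z) * V z)"
    by (intro weak_wave_diff[OF Uc Vc] int[OF Uc p1(1,2)] int[OF Vc q1(1,2)])
  moreover have "(\<lambda>z. p1 (fst z) * U z - q1 (fst z) * V z) = (\<lambda>z. p1 (fst z) * y z + f (fst z) * V z)"
    by (simp add: y_def f_def algebra_simps)
  ultimately have wave: "weak_wave ?l T' y (\<lambda>z. p1 (fst z) * y z + f (fst z) * V z)"
    using weak_wave_restrict T(3) by (simp add: y_def[abs_def])
  have der: "((\<lambda>x. y (x, t)) has_real_derivative y' (x, t)) (at x within {0..?l})"
    if "x \<in> {0..?l}" "t \<in> {0..T'}" for x t
    unfolding y_def y'_def U_def V_def fst_conv snd_conv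
    using that T by (intro DERIV_diff P(2) Q(2)) auto
  have init: "y (x, 0) = 0" if x: "x \<in> {0..?l}" for x
  proof -
    have "y (x, 0) \<le> 0"
    proof (rule AE_continuous_le[OF T(1) _ _ x])
      show "AE x\<in>{0<..<?l} in lborel. y (x, 0) \<le> 0"
        using P(5) Q(5) by eventually_elim (auto simp: y_def U_def V_def)
    qed (use slice[OF yc, of 0] T0 in auto)
    moreover have "- y (x, 0) \<le> 0"
    proof (rule AE_continuous_le[OF T(1) _ _ x])
      show "AE x\<in>{0<..<?l} in lborel. - y (x, 0) \<le> 0"
        using P(5) Q(5) by eventually_elim (auto simp: y_def U_def V_def)
    qed (use continuous_on_minus[OF slice[OF yc, of 0]] T0 in auto)
    ultimately show ?thesis by simp
  qed
  have lower: "r \<le> \<bar>V (x, 0)\<bar>" if x: "x \<in> {0..?l}" for x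
  proof -
    have "- \<bar>V (x, 0)\<bar> \<le> - r"
    proof (rule AE_continuous_le[OF T(1) _ _ x])
      show "AE x\<in>{0<..<?l} in lborel. - \<bar>V (x, 0)\<bar> \<le> - r"
        using u0 Q(5) by eventually_elim (auto simp: V_def)
      show "continuous_on {0..?l} (\<lambda>x. - \<bar>V (x, 0)\<bar>)"
        using T0 by (intro continuous_intros slice[OF Vc]) auto
    qed
    then show ?thesis by simp
  qed
  \<comment> \<open>Both difference quotients at \<open>t = 0\<close> are close to the same
    \<open>u1\<close>, and they differ by \<open>y (x, t) / t\<close>. So \<open>y = o(t)\<close>
    uniformly in \<open>x\<close>, which is what the extension by zero across \<open>t = 0\<close>
    requires.\<close>
  have small: "\<exists>\<delta>>0. \<forall>(x, t) \<in> rect ?l T'. t \<le> \<delta> \<longrightarrow> \<bar>y (x, t)\<bar> \<le> \<eta> * t" if "\<eta> > 0" for \<eta>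
  proof -
    have \<eta>: "\<eta> / 2 > 0" using that by simp
    obtain d1 where d1: "d1 > 0" "\<And>t. 0 < t \<Longrightarrow> t < d1 \<Longrightarrow>
      (AE x\<in>{0<..<?l} in lborel. \<bar>(up j x t - up j x 0) / t - u1 j x\<bar> \<le> \<eta> / 2)" using P(6)[OF \<eta>] by blast
    obtain d2 where d2: "d2 > 0" "\<And>t. 0 < t \<Longrightarrow> t < d2 \<Longrightarrow>
      (AE x\<in>{0<..<?l} in lborel. \<bar>(uq j x t - uq j x 0) / t - u1 j x\<bar> \<le> \<eta> / 2)" using Q(6)[OF \<eta>] by blast
    have "\<bar>y (x, t)\<bar> \<le> \<eta> * t" if xt: "(x, t) \<in> rect ?l T'" "t \<le> min d1 d2 / 2" for x t
    proof (rule AE_continuous_le[OF T(1), where h = "\<lambda>x. \<bar>y (x, t)\<bar>"])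
      have t: "0 < t" "t < d1" "t < d2" "t \<in> {0..T}" using xt d1(1) d2(1) T by (auto simp: rect_def)
      show "x \<in> {0..?l}" using xt by (auto simp: rect_def)
      show "continuous_on {0..?l} (\<lambda>x. \<bar>y (x, t)\<bar>)" by (intro continuous_intros slice[OF yc] t)
      show "AE x\<in>{0<..<?l} in lborel. \<bar>y (x, t)\<bar> \<le> \<eta> * t"
        using d1(2)[OF t(1,2)] d2(2)[OF t(1,3)]
      proof eventually_elim
        case (elim x)
        show ?case
        proof
          assume x: "x \<in> {0<..<?l}"
          let ?a = "(up j x t - up j x 0) / t" and ?b = "(uq j x t - uq j x 0) / t"
          have "\<bar>?a - u1 j x\<bar> \<le> \<eta> / 2" "\<bar>?b - u1 j x\<bar> \<le> \<eta> / 2" using elim x by blast+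
          then have "\<bar>?a - ?b\<bar> \<le> \<eta>" by linarith
          moreover have "?a - ?b = y (x, t) / t"
            using init[of x] x t by (simp add: y_def U_def V_def diff_divide_distrib[symmetric])
          ultimately show "\<bar>y (x, t)\<bar> \<le> \<eta> * t" using t by (simp add: abs_divide pos_divide_le_eq)
        qed
      qed
    qed
    then show ?thesis using d1(1) d2(1) by (intro exI[of _ "min d1 d2 / 2"]) auto
  qed
  \<comment> \<open>The case \<open>a = 1\<close> of the regularity assumption: a weak time
    derivative bounded by a function of \<open>t\<close> alone.\<close>
  obtain g M where gM: "weak_pderiv ?l T 1 0 V g" "set_borel_measurable lborel {0<..<T} M"
    "set_integrable lborel {0<..<T} (\<lambda>t. (M t)\<^sup>2)" "AE z\<in>rect ?l T in lborel. \<bar>g z\<bar> \<le> M (snd z)"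
    using H3[unfolded H3_Linf_def, rule_format, OF j, of 1] by (auto simp: V_def[abs_def])
  obtain \<mu> where \<mu>: "continuous_on {0..T} \<mu>" "\<mu> 0 = 0"
    "\<And>x s t. x \<in> {0..?l} \<Longrightarrow> 0 \<le> s \<Longrightarrow> s \<le> t \<Longrightarrow> t \<le> T \<Longrightarrow> \<bar>V (x, t) - V (x, s)\<bar> \<le> \<mu> t - \<mu> s"
    using time_variation[OF T(1) T0 Vc gM] by blast
  have "(AE x\<in>{0<..<?l} in lborel. f x = 0) \<and> (\<forall>x\<in>{0..?l}. \<forall>t\<in>{0..T' - ?l}. y (x, t) = 0)"
  proof (rule edge_uniqueness[OF T(1,2) r e p1(1) p1K f, where y = y and y' = y' and R = V and \<mu> = \<mu>])
    show "continuous_on (crect ?l T') y" "continuous_on (crect ?l T') y'"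
      "continuous_on (crect ?l T') V"
      using continuous_on_subset[OF _ sub] yc y'c Vc by blast+
    show "continuous_on {0..T'} \<mu>" using \<mu>(1) by (rule continuous_on_subset) (use T in auto)
    show "y (e, t) = 0" "y' (e, t) = 0" if "t \<in> {0<..<T'}" for t
      using bdry that by (auto simp: y_def y'_def U_def V_def)
    show "\<bar>V (x, t) - V (x, s)\<bar> \<le> \<mu> t - \<mu> s" if "x \<in> {0..?l}" "0 \<le> s" "s \<le> t" "t \<le> T'" for x s t
      using \<mu>(3) that T by simp
  qed (fact der wave init small lower \<mu>(2))+
  moreover from this have "AE x\<in>{0<..<?l} in lborel. f x = 0" by blast
  then have "AE x\<in>{0<..<?l} in lborel. p j x = q j x"
    using p1(3) q1(3) by eventually_elim (auto simp: f_def)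
  ultimately show ?thesis by (auto simp: y_def U_def V_def)
qed

section \<open>Peeling the tree\<close>

text \<open>As long as nodes are missing from \<open>W\<close>, connectedness yields an edge leaving
  it; adding the far end to \<open>W\<close> brings at least that edge inside. So every missing node
  accounts for an edge of its own.\<close>

lemma edges_not_inside:
  assumes conn: "\<And>P Q. P \<in> net_nodes N im tm \<Longrightarrow> Q \<in> net_nodes N im tm \<Longrightarrow> (P, Q) \<in> (net_adj N im tm)\<^sup>*"
    and W: "W \<subseteq> net_nodes N im tm" "W \<noteq> {}"
  shows "card (net_nodes N im tm - W) \<le> card {j. j \<le> N \<and> \<not> (im j \<in> W \<and> tm j \<in> W)}"
  using W
proof (induction "card (net_nodes N im tm - W)" arbitrary: W)
  case 0
  then show ?case by simp
next
  case (Suc n)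
  let ?V = "net_nodes N im tm"
  have fin: "finite ?V" by (simp add: net_nodes_def)
  have "?V - W \<noteq> {}" using Suc.hyps(2) by (metis card.empty nat.distinct(1))
  then obtain a b where a: "a \<in> W" and b: "b \<in> ?V - W" using Suc.prems by blast
  have "\<exists>c d. (c, d) \<in> net_adj N im tm \<and> c \<in> W \<and> d \<notin> W"
  proof (rule ccontr)
    assume no: "\<nexists>c d. (c, d) \<in> net_adj N im tm \<and> c \<in> W \<and> d \<notin> W"
    have "(a, b) \<in> (net_adj N im tm)\<^sup>*" using conn a b Suc.prems by blast
    then have "b \<in> W" by (induction rule: rtrancl_induct) (use a no in auto)
    then show False using b by simp
  qed
  then obtain j d where j: "j \<le> N" "d \<notin> W" "(im j \<in> W \<and> tm j = d) \<or> (tm j \<in> W \<and> im j = d)"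
    by (auto simp: net_adj_def)
  have d: "d \<in> ?V" using j by (auto simp: net_nodes_def)
  let ?out = "\<lambda>W. {j. j \<le> N \<and> \<not> (im j \<in> W \<and> tm j \<in> W)}"
  have card: "card (?V - W) = Suc (card (?V - insert d W))"
  proof -
    have "?V - W = insert d (?V - insert d W)" using d j by auto
    then have "card (?V - W) = card (insert d (?V - insert d W))" by (rule arg_cong)
    also have "\<dots> = Suc (card (?V - insert d W))" using fin by (intro card_insert_disjoint) auto
    finally show ?thesis .
  qed
  have "card (?V - insert d W) \<le> card (?out (insert d W))"
    by (rule Suc.hyps(1)) (use card Suc.hyps(2) Suc.prems d in auto)
  moreover have "Suc (card (?out (insert d W))) \<le> card (?out W)"
  proof -
    have "insert j (?out (insert d W)) \<subseteq> ?out W" "j \<notin> ?out (insert d W)" using j by auto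
    then show ?thesis
      using card_mono[of "?out W" "insert j (?out (insert d W))"] finite_subset[of "?out (insert d W)" "{..N}"] by auto
  qed
  ultimately show ?case using card by simp
qed

lemma card_filter_eq_sum: "finite A \<Longrightarrow> card {x \<in> A. R x} = (\<Sum>x\<in>A. if R x then 1 else 0)"
  by (simp add: sum.If_cases Int_def)

text \<open>If the unsolved edges \<open>U\<close>, spanning the nodes \<open>W\<close>, had no leaf besides \<open>Q\<close>, counting degrees
  would give \<open>2 * card U \<ge> 2 * card W - 1\<close>, one edge too many for a tree.\<close>

lemma tree_network_peel:
  assumes tree: "tree_network N l im tm" and S: "S \<subseteq> {..N}" "S \<noteq> {..N}"
  obtains j P where "j \<le> N" "j \<notin> S" "incident im tm j P" "P \<noteq> Q"
    "\<And>k. k \<le> N \<Longrightarrow> incident im tm k P \<Longrightarrow> k = j \<or> k \<in> S"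
proof (rule ccontr)
  assume neg: "\<not> thesis"
  note witness = that
  define U where "U = {..N} - S"
  define W where "W = im ` U \<union> tm ` U"
  let ?V = "net_nodes N im tm"
  have ne: "\<And>j. j \<le> N \<Longrightarrow> im j \<noteq> tm j" using tree by (simp add: tree_network_def)
  have U: "finite U" "U \<noteq> {}" "U \<subseteq> {..N}" using S by (auto simp: U_def)
  have W: "finite W" "W \<noteq> {}" "W \<subseteq> ?V" using U by (auto simp: W_def net_nodes_def)
  define deg where "deg P = card {j \<in> U. incident im tm j P}" for P
  have deg1: "deg P \<ge> 1" if "P \<in> W" for P
  proof -
    have "{j \<in> U. incident im tm j P} \<noteq> {}" using that by (auto simp: W_def incident_def)
    then show ?thesis using U(1) by (simp add: deg_def Suc_le_eq card_gt_0_iff)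
  qed
  \<comment> \<open>A node of \<open>W\<close> other than \<open>Q\<close> on a single unsolved edge
    would be the wanted witness.\<close>
  have deg2: "deg P \<ge> 2" if "P \<in> W" "P \<noteq> Q" for P
  proof (rule ccontr)
    assume "\<not> deg P \<ge> 2"
    then have "deg P = 1" using deg1[OF that(1)] by simp
    then obtain j where j: "{j \<in> U. incident im tm j P} = {j}" unfolding deg_def by (rule card_1_singletonE)
    then have "j \<in> U" "incident im tm j P" by auto
    moreover have "k = j \<or> k \<in> S" if "k \<le> N" "incident im tm k P" for k
      using that j by (auto simp: U_def)
    ultimately have thesis
      using \<open>P \<noteq> Q\<close> by (intro witness[of j P]) (auto simp: U_def)
    then show False using neg by blast
  qed
  have sum: "(\<Sum>P\<in>W. deg P) = 2 * card U"
  proof -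
    have "(\<Sum>P\<in>W. deg P) = (\<Sum>P\<in>W. \<Sum>j\<in>U. if incident im tm j P then 1 else 0)"
      unfolding deg_def card_filter_eq_sum[OF U(1)] ..
    also have "\<dots> = (\<Sum>j\<in>U. \<Sum>P\<in>W. if incident im tm j P then 1 else 0)" by (rule sum.swap)
    also have "\<dots> = (\<Sum>j\<in>U. 2)"
    proof (rule sum.cong[OF refl])
      fix j assume j: "j \<in> U"
      \<comment> \<open>Both ends of an unsolved edge lie in \<open>W\<close>, and they are distinct
        as loops are excluded.\<close>
      have "{P \<in> W. incident im tm j P} = {im j, tm j}" using j by (auto simp: W_def incident_def)
      then have "card {P \<in> W. incident im tm j P} = 2" using ne[of j] j U(3) by auto
      then show "(\<Sum>P\<in>W. if incident im tm j P then 1 else 0) = (2 :: nat)"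
        by (rule trans[OF card_filter_eq_sum[OF W(1), symmetric]])
    qed
    finally show ?thesis by simp
  qed
  have "(\<Sum>P\<in>W. if P = Q then 1 else 2) \<le> (\<Sum>P\<in>W. deg P)"
    using deg1 deg2 by (intro sum_mono) auto
  moreover have "2 * card W \<le> (\<Sum>P\<in>W. if P = Q then 1 else 2) + 1"
  proof -
    have "2 * card W = (\<Sum>P\<in>W. 2)" by simp
    also have "\<dots> = (\<Sum>P\<in>W. (if P = Q then 1 else 2) + (if P = Q then 1 else 0))"
      by (rule sum.cong) auto
    also have "\<dots> = (\<Sum>P\<in>W. if P = Q then 1 else 2) + (\<Sum>P\<in>W. if P = Q then 1 else 0)" by (rule sum.distrib)
    also have "(\<Sum>P\<in>W. if P = Q then 1 else 0) \<le> (1 :: nat)" using W(1) by simp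
    finally show ?thesis by simp
  qed
  \<comment> \<open>The exceptional node costs only 1:
    \<open>2 * card U \<ge> 2 * card W - 1\<close> gives \<open>card U \<ge> card W\<close> by
    parity.\<close>
  ultimately have le: "card W \<le> card U" using sum by linarith
  \<comment> \<open>All edges of \<open>U\<close> have both ends in \<open>W\<close>, so the
    \<open>N + 2 - card W\<close> other nodes require as many of the \<open>N + 1 - card U\<close>
    other edges, against \<open>le\<close>.\<close>
  have "card (?V - W) \<le> card {j. j \<le> N \<and> \<not> (im j \<in> W \<and> tm j \<in> W)}"
    by (rule edges_not_inside) (use tree W in \<open>auto simp: tree_network_def\<close>)
  also have "\<dots> \<le> card ({..N} - U)"
    by (rule card_mono) (auto simp: W_def)
  also have "\<dots> = Suc N - card U" using U by (simp add: card_Diff_subset)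
  finally have "card ?V - card W \<le> Suc N - card U"
    using W by (simp add: card_Diff_subset)
  moreover have "card ?V = N + 2" using tree by (simp add: tree_network_def)
  moreover have "card W \<le> card ?V" using W by (intro card_mono) (auto simp: net_nodes_def)
  moreover have "card U \<le> Suc N" using card_mono[OF _ U(3)] by simp
  ultimately show False using le by linarith
qed

lemma dx_cong:
  assumes "\<And>x. x \<in> {0..l j} \<Longrightarrow> u j x t = v j x t" "x \<in> {0..l j}"
  shows "dx u l j x t = dx v l j x t"
  unfolding dx_def using assms by (intro vector_derivative_cong_eq) (auto simp: eventually_at_filter)

lemma wave_solution_exterior:
  assumes "wave_solution N l im tm p u0 u1 h T u" "Q \<in> exterior_nodes N im tm" "j \<le> N" "incident im tm j Q" "t \<in> {0<..<T}"
  shows "nodeval u l im j Q t = h t"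
  using assms(1)[unfolded wave_solution_def, THEN conjunct2, THEN conjunct1, rule_format, OF assms(2-5)] .

lemma wave_solution_continuity:
  assumes "wave_solution N l im tm p u0 u1 h T u" "P \<in> interior_nodes N im tm" "i \<le> N" "j \<le> N"
    "incident im tm i P" "incident im tm j P" "t \<in> {0<..<T}"
  shows "nodeval u l im i P t = nodeval u l im j P t"
  using assms(1)[unfolded wave_solution_def, THEN conjunct2, THEN conjunct2, THEN conjunct1, rule_format,
      OF assms(2-4) conjI[OF assms(5,6)] assms(7)] .

lemma wave_solution_Kirchhoff:
  assumes "wave_solution N l im tm p u0 u1 h T u" "P \<in> interior_nodes N im tm" "t \<in> {0<..<T}"
  shows "(\<Sum>j\<in>{j. j \<le> N \<and> incident im tm j P}. nodeder u l im j P t) = 0"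
  using assms(1)[unfolded wave_solution_def, THEN conjunct2, THEN conjunct2, THEN conjunct2, rule_format, OF assms(2,3)] .

theorem theorem1:
  fixes N :: nat and l :: "nat \<Rightarrow> real" and im tm :: "nat \<Rightarrow> 'v"
    and r :: real and p q u0 u1 :: "nat \<Rightarrow> real \<Rightarrow> real" and h :: "real \<Rightarrow> real"
    and Qlast :: 'v
  assumes "tree_network N l im tm"
    and "Qlast \<in> exterior_nodes N im tm"
    and "r > 0"
    and "\<forall>j\<le>N. Linf_on (l j) (p j)"
    and "\<forall>j\<le>N. Linf_on (l j) (q j)"
    and "\<forall>j\<le>N. AE x in lborel. x \<in> {0<..<l j} \<longrightarrow> \<bar>u0 j x\<bar> \<ge> r"
  shows "\<exists>T0>0. \<forall>T\<ge>T0. \<forall>up uq.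
           wave_solution N l im tm p u0 u1 h T up \<and> wave_solution N l im tm q u0 u1 h T uq \<and>
           H3_Linf N l T up \<and> H1_H2 N l T up \<and> H3_Linf N l T uq \<and> H1_H2 N l T uq \<and>
           (\<forall>Q\<in>exterior_nodes N im tm - {Qlast}. \<forall>j\<le>N. incident im tm j Q \<longrightarrow>
              (\<forall>t\<in>{0<..<T}. nodeder up l im j Q t = nodeder uq l im j Q t))
           \<longrightarrow> (\<forall>j\<le>N. AE x in lborel. x \<in> {0<..<l j} \<longrightarrow> p j x = q j x)"
proof -
  have l: "\<And>j. j \<le> N \<Longrightarrow> 0 < l j" and ne: "\<And>j. j \<le> N \<Longrightarrow> im j \<noteq> tm j"
    and deg: "\<And>P. P \<in> net_nodes N im tm \<Longrightarrow> degree N im tm P = 1 \<or> degree N im tm P \<ge> 3"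
    using assms(1) by (auto simp: tree_network_def)
  define L where "L = (\<Sum>j\<le>N. l j)"
  have L: "L \<ge> 0" unfolding L_def using l by (intro sum_nonneg) (auto intro: less_imp_le)
  show ?thesis
  \<comment> \<open>\<open>L\<close> is what the peeling consumes in all; the summand 1 makes the
    bound positive.\<close>
  proof (intro exI[of _ "1 + L"] conjI allI impI; (elim conjE)?)
    fix T up uq j
    assume T: "1 + L \<le> T"
      and up: "wave_solution N l im tm p u0 u1 h T up" and uq: "wave_solution N l im tm q u0 u1 h T uq"
      and H3: "H3_Linf N l T uq" and j: "j \<le> N"
      and obs: "\<forall>Q\<in>exterior_nodes N im tm - {Qlast}. \<forall>j\<le>N. incident im tm j Q \<longrightarrow>
              (\<forall>t\<in>{0<..<T}. nodeder up l im j Q t = nodeder uq l im j Q t)"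
    define good where "good T' j \<longleftrightarrow> (AE x\<in>{0<..<l j} in lborel. p j x = q j x) \<and>
      (\<forall>x\<in>{0..l j}. \<forall>t\<in>{0..T'}. up j x t = uq j x t)" for T' j
    \<comment> \<open>\<open>S\<close> collects the solved segments. All of them are given one
      common horizon, \<open>T\<close> minus their total length, so that at a node where several of
      them meet their data can be combined directly.\<close>
    have "\<exists>S\<subseteq>{..N}. card S = n \<and> (\<forall>j\<in>S. good (T - (\<Sum>i\<in>S. l i)) j)" if "n \<le> Suc N" for n
      using that
    proof (induction n)
      case 0
      show ?case by (intro exI[of _ "{}"]) auto
    next
      case (Suc n)
      then obtain S where S: "S \<subseteq> {..N}" "card S = n" and good: "\<And>j. j \<in> S \<Longrightarrow> good (T - (\<Sum>i\<in>S. l i)) j"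
        by (metis Suc_leD)
      have fin: "finite S" using S(1) finite_subset by blast
      have "S \<noteq> {..N}" using S(2) Suc.prems by auto
      then obtain i P where i: "i \<le> N" "i \<notin> S" "incident im tm i P" "P \<noteq> Qlast"
        and only: "\<And>k. k \<le> N \<Longrightarrow> incident im tm k P \<Longrightarrow> k = i \<or> k \<in> S"
        by (rule tree_network_peel[OF assms(1) S(1), where Q = Qlast]) (rule that, assumption+)
      define T' where "T' = T - (\<Sum>k\<in>S. l k)"
      have sum: "(\<Sum>k\<in>insert i S. l k) = l i + (\<Sum>k\<in>S. l k)" using i fin by simp
      have "(\<Sum>k\<in>insert i S. l k) \<le> L"
        unfolding L_def using S(1) i l by (intro sum_mono2) (auto intro: less_imp_le)
      then have T': "l i \<le> T'" "T' \<le> T" "T - (\<Sum>k\<in>insert i S. l k) = T' - l i"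
        using T sum sum_nonneg[of S l] S(1) l by (auto simp: T'_def less_imp_le subset_iff)
      have P: "P \<in> net_nodes N im tm" using i by (auto simp: net_nodes_def incident_def)
      have ends: "(if im k = P then 0 else l k) \<in> {0..l k}" if "k \<le> N" for k
        using l[OF that] by auto
      have dxS: "nodeval up l im k P t = nodeval uq l im k P t \<and> nodeder up l im k P t = nodeder uq l im k P t"
        if k: "k \<in> S" and t: "t \<in> {0<..<T'}" for k t
      proof -
        have eq: "up k x t = uq k x t" if "x \<in> {0..l k}" for x
          using good[OF k] that t by (auto simp: good_def T'_def)
        have "l k > 0" using l k S(1) by auto
        then show ?thesis
          using eq[of 0] eq[of "l k"] dx_cong[of l k up t uq, OF eq] by (auto simp: nodeval_def nodeder_def)
      qed
      have node: "nodeval up l im i P t = nodeval uq l im i P t \<and> nodeder up l im i P t = nodeder uq l im i P t"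
        if t: "t \<in> {0<..<T'}" for t
      proof -
        have tT: "t \<in> {0<..<T}" using t T' by auto
        from deg[OF P] show ?thesis
        proof
          \<comment> \<open>The end-point is observed because \<open>P \<noteq> Qlast\<close>, and
            the boundary value \<open>h\<close> is common to both solutions.\<close>
          assume "degree N im tm P = 1"
          then have ext: "P \<in> exterior_nodes N im tm" using P by (simp add: exterior_nodes_def)
          have "nodeval up l im i P t = h t" "nodeval uq l im i P t = h t"
            using wave_solution_exterior[OF up ext i(1,3) tT] wave_solution_exterior[OF uq ext i(1,3) tT] .
          moreover have "nodeder up l im i P t = nodeder uq l im i P t" using obs ext i tT by blast
          ultimately show ?thesis by simp
        next
          assume d3: "degree N im tm P \<ge> 3"
          then have intr: "P \<in> interior_nodes N im tm" using P by (simp add: interior_nodes_def)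
          let ?I = "{k. k \<le> N \<and> incident im tm k P}"
          have finI: "finite ?I" by simp
          \<comment> \<open>At least three segments meet here and all but \<open>i\<close> are
            solved: one of them gives the value by continuity, and all of them together determine
            the remaining term of the Kirchhoff sum.\<close>
          have "?I \<noteq> {i}" using d3 by (auto simp: degree_def)
          then obtain k where k: "k \<le> N" "incident im tm k P" "k \<noteq> i" using i by blast
          then have kS: "k \<in> S" using only by blast
          have "nodeval up l im i P t = nodeval up l im k P t" "nodeval uq l im i P t = nodeval uq l im k P t"
            using wave_solution_continuity[OF up intr i(1) k(1) i(3) k(2) tT]
              wave_solution_continuity[OF uq intr i(1) k(1) i(3) k(2) tT] .
          moreover have "(\<Sum>k\<in>?I. nodeder up l im k P t) = 0" "(\<Sum>k\<in>?I. nodeder uq l im k P t) = 0"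
            using wave_solution_Kirchhoff[OF up intr tT] wave_solution_Kirchhoff[OF uq intr tT] .
          moreover have "(\<Sum>k\<in>?I - {i}. nodeder up l im k P t) = (\<Sum>k\<in>?I - {i}. nodeder uq l im k P t)"
            using only dxS[OF _ t] by (intro sum.cong) auto
          ultimately show ?thesis
            using dxS[OF kS t] i sum.remove[OF finI, of i "\<lambda>k. nodeder up l im k P t"]
              sum.remove[OF finI, of i "\<lambda>k. nodeder uq l im k P t"] by auto
        qed
      qed
      define e where "e = (if im i = P then 0 else l i)"
      have "good (T' - l i) i"
        unfolding good_def
      proof (rule segment_uniqueness[OF up uq H3 i(1) l[OF i(1)] T'(1,2) assms(3)])
        show "e = 0 \<or> e = l i" by (simp add: e_def)
        show "up i e t = uq i e t" "dx up l i e t = dx uq l i e t" if "t \<in> {0<..<T'}" for t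
          using node[OF that] by (auto simp: e_def nodeval_def nodeder_def split: if_splits)
      qed (use assms(4-6) i in auto)
      moreover have "good (T' - l i) k" if "k \<in> S" for k
        using good[OF that] l[OF i(1)] unfolding good_def T'_def by auto
      ultimately have "\<forall>k\<in>insert i S. good (T - (\<Sum>k\<in>insert i S. l k)) k"
        unfolding T'(3) by blast
      then show ?case
        using S i fin by (intro exI[of _ "insert i S"] conjI) auto
    qed
    from this[OF order_refl] obtain S where S: "S \<subseteq> {..N}" "card S = Suc N"
      "\<forall>j\<in>S. good (T - (\<Sum>i\<in>S. l i)) j" by blast
    have "S = {..N}" using S by (intro card_subset_eq) auto
    then show "AE x\<in>{0<..<l j} in lborel. p j x = q j x" using S(3) j by (auto simp: good_def)
  qed (use L in auto)
qed

end
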